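(* Assume the setting of the following: $k\ge1$; $\mathcal{S}_w\subset\mathbb{R}^d$, $\mathcal{S}_{v_\ell}\subset\mathbb{R}^{n_\ell}$ compact convex; $\mathcal{S}_v=\mathcal{S}_{v_1}\times\dots\times\mathcal{S}_{v_k}$; $\psi:\mathcal{S}_w\times\mathcal{S}_v\to\mathbb{R}$ continuous and convex-concave; $\alpha_\ell(w)=A_\ell w+a_\ell$, $\beta_\ell(u)=B_\ell u+b_\ell$ affine ($A_\ell\in\mathbb{R}^{d\times d}$, $a_\ell\in\mathbb{R}^d$, $B_\ell\in\mathbb{R}^{n_\ell\times n_\ell}$, $b_\ell\in\mathbb{R}^{n_\ell}$); $G_\ell\in\mathbb{R}^{n_\ell\times d}$, $g_\ell\in\mathbb{R}^d$, $h_\ell\in\mathbb{R}^{n_\ell}$ mutually independent with i.i.d. $\mathcal{N}(0,1)$ entries. For a compact set $T\subset\mathcal{S}_w$ define $$\Phi_T(G):=\min_{w\in T}\max_{v\in\mathcal{S}_v}\sum_{\ell=1}^k\beta_\ell(v_\ell)^TG_\ell\alpha_\ell(w)+\psi(w,v),$$ $$\phi_T(g,h):=\min_{w\in T}\max_{v\in\mathcal{S}_v}\sum_{\ell=1}^k\Big[\|\beta_\ell(v_\ell)\|_2g_\ell^T\alpha_\ell(w)+\|\alpha_\ell(w)\|_2h_\ell^T\beta_\ell(v_\ell)\Big]+\psi(w,v),$$ and write $\Phi=\Phi_{\mathcal{S}_w}$, $\phi=\phi_{\mathcal{S}_w}$. Let $\mathcal{S}$ be a (relatively) open subset of $\mathcal{S}_w$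 and $\mathcal{S}^c:=\mathcal{S}_w\setminus\mathcal{S}$. Suppose there exist $\epsilon>0$, $\delta>0$ and reals $\bar\phi,\bar\phi_{\mathcal{S}^c}$ such that: $\bar\phi_{\mathcal{S}^c}\ge\bar\phi+3\delta$; $\phi(g,h)<\bar\phi+\delta$ with probability at least $1-\epsilon$; and $\phi_{\mathcal{S}^c}(g,h)>\bar\phi_{\mathcal{S}^c}-\delta$ with probability at least $1-\epsilon$. Then, with probability at least $1-2^{k+1}\epsilon$, every minimizer $w_\Phi(G)\in\arg\min_{w\in\mathcal{S}_w}\max_{v\in\mathcal{S}_v}\sum_{\ell}\beta_\ell(v_\ell)^TG_\ell\alpha_\ell(w)+\psi(w,v)$ lies in $\mathcal{S}$.
   Context: Norms are Euclidean. A function $\psi(w,v)$ is convex-concave if it is convex in $w$ for each fixed $v$ and concave in $v$ for each fixed $w$. *)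

theory Defs
  imports "HOL-Probability.Probability"
begin

text \<open>Vectors of R^m are encoded as functions nat => real vanishing from index m on.
  The variable w in R^d is encoded with the type real^'d.\<close>

definition vecs :: "nat \<Rightarrow> (nat \<Rightarrow> real) set" where
  "vecs m = {x. \<forall>i\<ge>m. x i = 0}"

definition fconvex :: "(nat \<Rightarrow> real) set \<Rightarrow> bool" where
  "fconvex S \<longleftrightarrow> (\<forall>x\<in>S. \<forall>y\<in>S. \<forall>t::real. 0 \<le> t \<and> t \<le> 1 \<longrightarrow>
      (\<lambda>i. t * x i + (1 - t) * y i) \<in> S)"

definition blockprod :: "nat \<Rightarrow> (nat \<Rightarrow> (nat \<Rightarrow> real) set) \<Rightarrow> (nat \<Rightarrow> nat \<Rightarrow> real) set" where
  "blockprod k Sv = {v. (\<forall>l<k. v l \<in> Sv l) \<and> (\<forall>l\<ge>k. v l = (\<lambda>_. 0))}"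

definition fconcave_on :: "(nat \<Rightarrow> nat \<Rightarrow> real) set \<Rightarrow> ((nat \<Rightarrow> nat \<Rightarrow> real) \<Rightarrow> real) \<Rightarrow> bool" where
  "fconcave_on S f \<longleftrightarrow> (\<forall>x\<in>S. \<forall>y\<in>S. \<forall>t::real. 0 \<le> t \<and> t \<le> 1 \<longrightarrow>
      f (\<lambda>l i. t * x l i + (1 - t) * y l i) \<ge> t * f x + (1 - t) * f y)"

definition fnorm :: "nat \<Rightarrow> (nat \<Rightarrow> real) \<Rightarrow> real" where
  "fnorm m x = sqrt (\<Sum>i<m. (x i)\<^sup>2)"

definition alpha :: "(nat \<Rightarrow> real^'d^'d) \<Rightarrow> (nat \<Rightarrow> real^'d) \<Rightarrow> nat \<Rightarrow> real^'d \<Rightarrow> real^'d" where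
  "alpha A a l w = A l *v w + a l"

definition beta :: "(nat \<Rightarrow> nat) \<Rightarrow> (nat \<Rightarrow> nat \<Rightarrow> nat \<Rightarrow> real) \<Rightarrow> (nat \<Rightarrow> nat \<Rightarrow> real)
    \<Rightarrow> nat \<Rightarrow> (nat \<Rightarrow> real) \<Rightarrow> (nat \<Rightarrow> real)" where
  "beta n B b l u = (\<lambda>i. if i < n l then (\<Sum>j<n l. B l i j * u j) + b l i else 0)"

text \<open>Primary objective: sum_l beta_l(v_l)^T G_l alpha_l(w) + psi(w,v); the matrix G_l in
  R^{n_l x d} is given by its rows G l i (i < n l).\<close>
definition objP where
  "objP k n A a B b psi (G :: nat \<Rightarrow> nat \<Rightarrow> real^'d) w v =
     (\<Sum>l<k. \<Sum>i<n l. beta n B b l (v l) i * (G l i \<bullet> alpha A a l w)) + psi w v"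

definition objA where
  "objA k n A a B b psi (g :: nat \<Rightarrow> real^'d) (h :: nat \<Rightarrow> nat \<Rightarrow> real) w v =
     (\<Sum>l<k. fnorm (n l) (beta n B b l (v l)) * (g l \<bullet> alpha A a l w)
            + norm (alpha A a l w) * (\<Sum>i<n l. h l i * beta n B b l (v l) i)) + psi w v"

definition minmax :: "'a set \<Rightarrow> 'b set \<Rightarrow> ('a \<Rightarrow> 'b \<Rightarrow> real) \<Rightarrow> real" where
  "minmax T V f = (INF w\<in>T. SUP v\<in>V. f w v)"

datatype 'd gidx = Gent nat nat 'd | gent nat 'd | hent nat nat

definition gidx_set :: "nat \<Rightarrow> (nat \<Rightarrow> nat) \<Rightarrow> 'd gidx set" where
  "gidx_set k n = {Gent l i j | l i j. l < k \<and> i < n l} \<union> {gent l j | l j. l < k}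
                  \<union> {hent l i | l i. l < k \<and> i < n l}"

definition gentry :: "('w \<Rightarrow> nat \<Rightarrow> nat \<Rightarrow> real^'d) \<Rightarrow> ('w \<Rightarrow> nat \<Rightarrow> real^'d)
     \<Rightarrow> ('w \<Rightarrow> nat \<Rightarrow> nat \<Rightarrow> real) \<Rightarrow> 'd gidx \<Rightarrow> 'w \<Rightarrow> real" where
  "gentry G g h \<iota> \<omega> = (case \<iota> of Gent l i j \<Rightarrow> G \<omega> l i $ j | gent l j \<Rightarrow> g \<omega> l $ j
                                | hent l i \<Rightarrow> h \<omega> l i)"

end

theory Submission
  imports Defs
begin

text \<open>For a min-max over finite index sets, Gordon's inequality is obtained from a Lindeberg
  replacement: with independent Gaussian processes \<open>X\<close> and \<open>Y\<close> and a smooth \<open>f\<close>,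
  moving a variance \<open>r\<close> from \<open>Y\<close> to \<open>X\<close> changes \<open>E f (sqrt s X + sqrt t Y)\<close> by \<open>r\<close> times the
  contraction of the second derivative of \<open>f\<close> with half the difference of the covariances, up to
  \<open>O(r powr (3/2))\<close>. Summing \<open>n\<close> steps of size \<open>1/n\<close> leaves an error \<open>O(1 / sqrt n)\<close>. The test function
  is a product over \<open>w\<close> of increasing functions of the row \<open>x (w, _)\<close>, so its mixed second
  derivatives across different rows are nonnegative, and inside a row the covariances agree.

  The difference between the covariances of the (completed) primary and the auxiliary process is
  \<open>(|\<alpha>| |\<alpha>'| - \<alpha> \<bullet> \<alpha>') (|\<beta>| |\<beta>'| - \<beta> \<bullet> \<beta>')\<close> summed over the blocks; it is nonnegative and
  vanishes if \<open>w = w'\<close> or \<open>v = v'\<close>. So the inequality can be used with the roles of \<open>w\<close> and \<open>v\<close> in either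
  order: directly it bounds the primary minimum over the complement of \<open>S\<close> from below, and with the
  roles exchanged, combined with the minimax theorem for the convex-concave primary objective, it
  bounds the primary minimum over \<open>Sw\<close> from above. The gap between the two bounds forces every
  minimizer into \<open>S\<close>.\<close>

section \<open>A smooth step function\<close>

text \<open>The obstacle is that the variances differ: in each block the auxiliary process has twice
  the variance of the primary one. One fresh Gaussian per block, weighted by the product of the
  norms, repairs this, but the conclusion concerns the process without it. As the weight is
  nonnegative, restricting to the event that all \<open>k\<close> fresh Gaussians are nonpositive
  disposes of it at the price of a factor \<open>2 ^ k\<close>; two such comparisons give
  \<open>2 ^ (k + 1)\<close>. Of the gap \<open>3 * \<delta>\<close> the two hypotheses consume one
  \<open>\<delta>\<close> each; the third pays for the margins lost in the smoothing and in the
  passage from finite to compact sets. A second-order expansion with cubic remainder asks only for a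
  Lipschitz second derivative, so a piecewise cubic step suffices and its estimates reduce to
  polynomial arithmetic. \<open>spline_step\<close> is the distribution function of the sum of three
  independent uniform variables on the unit interval; \<open>spline_step'\<close> is its density,
  the quadratic B-spline.\<close>

definition spline_step :: "real \<Rightarrow> real" where
  "spline_step x = (max 0 x ^ 3 - 3 * max 0 (x - 1) ^ 3 + 3 * max 0 (x - 2) ^ 3 - max 0 (x - 3) ^ 3) / 6"

definition spline_step' :: "real \<Rightarrow> real" where
  "spline_step' x = (max 0 x ^ 2 - 3 * max 0 (x - 1) ^ 2 + 3 * max 0 (x - 2) ^ 2 - max 0 (x - 3) ^ 2) / 2"

text \<open>Half of the second derivative.\<close>
definition spline_step'' :: "real \<Rightarrow> real" where
  "spline_step'' x = (max 0 x - 3 * max 0 (x - 1) + 3 * max 0 (x - 2) - max 0 (x - 3)) / 2"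

text \<open>For each pattern of signs the remainder is zero, a cube, or a difference of two
  nonnegative cubes, always of numbers of modulus at most \<open>\<bar>t\<bar>\<close>; hence the
  constant 1.\<close>

lemma truncated_cube_taylor:
  fixes x t :: real
  shows "\<bar>max 0 (x + t) ^ 3 - max 0 x ^ 3 - 3 * max 0 x ^ 2 * t - 3 * max 0 x * t ^ 2\<bar> \<le> \<bar>t\<bar> ^ 3"
proof -
  consider "x \<ge> 0" "x + t \<ge> 0" | "x \<le> 0" "x + t \<le> 0" | "x \<ge> 0" "x + t \<le> 0" | "x \<le> 0" "x + t \<ge> 0"
    by linarith
  then show ?thesis
  proof cases
    case 1
    then have "max 0 (x + t) ^ 3 - max 0 x ^ 3 - 3 * max 0 x ^ 2 * t - 3 * max 0 x * t ^ 2 = t ^ 3"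
      by (simp add: max_def power3_eq_cube power2_eq_square algebra_simps)
    then show ?thesis by (simp add: power_abs)
  next
    case 2
    then have "max 0 (x + t) = 0" "max 0 x = 0" by auto
    then show ?thesis by (simp add: power_abs)
  next
    case 3
    have "max 0 (x + t) = 0" "max 0 x = x" using 3 by auto
    then have "max 0 (x + t) ^ 3 - max 0 x ^ 3 - 3 * max 0 x ^ 2 * t - 3 * max 0 x * t ^ 2
        = (- t - x) ^ 3 - (- t) ^ 3"
      by (simp add: power3_eq_cube power2_eq_square algebra_simps)
    also have "\<bar>\<dots>\<bar> \<le> (- t) ^ 3"
    proof -
      have "(- t - x) ^ 3 \<ge> 0" using 3 by auto
      moreover have "(- t - x) ^ 3 \<le> (- t) ^ 3" using 3 by (intro power_mono) auto
      ultimately show ?thesis by linarith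
    qed
    also have "(- t) ^ 3 = \<bar>t\<bar> ^ 3" using 3 by (simp add: abs_of_nonpos)
    finally show ?thesis .
  next
    case 4
    have "max 0 (x + t) = x + t" "max 0 x = 0" using 4 by auto
    then have "max 0 (x + t) ^ 3 - max 0 x ^ 3 - 3 * max 0 x ^ 2 * t - 3 * max 0 x * t ^ 2 = (x + t) ^ 3"
      by simp
    moreover have "(x + t) ^ 3 \<le> t ^ 3" using 4 by (intro power_mono) auto
    moreover have "(x + t) ^ 3 \<ge> 0" using 4 by auto
    ultimately show ?thesis using 4 by (simp add: abs_if)
  qed
qed

text \<open>The spline is a third difference of truncated cubes: the weights 1, 3, 3, 1 divided by 6
  turn the four errors into 8/6, rounded up to 2.\<close>

lemma spline_step_taylor:
  "\<bar>spline_step (x + t) - spline_step x - spline_step' x * t - spline_step'' x * t ^ 2\<bar> \<le> 2 * \<bar>t\<bar> ^ 3"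
proof -
  define E where "E y = max 0 (y + t) ^ 3 - max 0 y ^ 3 - 3 * max 0 y ^ 2 * t - 3 * max 0 y * t ^ 2" for y
  have E: "\<bar>E y\<bar> \<le> \<bar>t\<bar> ^ 3" for y
    using truncated_cube_taylor unfolding E_def .
  have "x + t - c = x - c + t" for c by simp
  then have "spline_step (x + t) - spline_step x - spline_step' x * t - spline_step'' x * t ^ 2
      = (E x - 3 * E (x - 1) + 3 * E (x - 2) - E (x - 3)) / 6"
    unfolding spline_step_def spline_step'_def spline_step''_def E_def by (simp only:) argo
  then show ?thesis using E[of x] E[of "x - 1"] E[of "x - 2"] E[of "x - 3"] by (simp add: abs_le_iff)
qed

lemma spline_step_pieces:
  fixes x :: real
  obtains "x \<le> 0" "spline_step x = 0" "spline_step' x = 0" "spline_step'' x = 0"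
  | "0 \<le> x" "x \<le> 1" "spline_step x = x ^ 3 / 6" "spline_step' x = x ^ 2 / 2" "spline_step'' x = x / 2"
  | "1 \<le> x" "x \<le> 2" "spline_step x = 1 / 6 + (x - 1) / 2 + (x - 1) ^ 2 * (2 - x) / 2 + (x - 1) ^ 3 / 6"
      "spline_step' x = 1 / 2 + (x - 1) * (2 - x)" "spline_step'' x = (3 - 2 * x) / 2"
  | "2 \<le> x" "x \<le> 3" "spline_step x = 1 - (3 - x) ^ 3 / 6" "spline_step' x = (3 - x) ^ 2 / 2"
      "spline_step'' x = (x - 3) / 2"
  | "3 \<le> x" "spline_step x = 1" "spline_step' x = 0" "spline_step'' x = 0"
proof -
  note defs = spline_step_def spline_step'_def spline_step''_def max_def power3_eq_cube power2_eq_square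
  consider "x \<le> 0" | "0 \<le> x" "x \<le> 1" | "1 \<le> x" "x \<le> 2" | "2 \<le> x" "x \<le> 3" | "3 \<le> x" by linarith
  then show thesis
  proof cases
    case 1 then show ?thesis by (intro that(1)) (auto simp: defs)
  next
    case 2 then show ?thesis by (intro that(2)) (auto simp: defs)
  next
    case 3 then show ?thesis by (intro that(3)) (auto simp: defs field_simps)
  next
    case 4 then show ?thesis by (intro that(4)) (auto simp: defs field_simps)
  next
    case 5 then show ?thesis by (intro that(5)) (auto simp: defs field_simps)
  qed
qed

lemma spline_step_bounds:
  "0 \<le> spline_step x" "spline_step x \<le> 1" "0 \<le> spline_step' x" "spline_step' x \<le> 1" "\<bar>spline_step'' x\<bar> \<le> 1"
proof -
  have unit: "u ^ m \<le> 1" if "0 \<le> u" "u \<le> 1" for u :: real and m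
    using that by (simp add: power_le_one)
  have "0 \<le> spline_step x \<and> spline_step x \<le> 1 \<and> 0 \<le> spline_step' x \<and> spline_step' x \<le> 1 \<and> \<bar>spline_step'' x\<bar> \<le> 1"
  proof (cases x rule: spline_step_pieces)
    case 2
    then show ?thesis unfolding abs_le_iff
      using unit[of x 2] unit[of x 3] zero_le_power[of x 2] zero_le_power[of x 3]
      by (intro conjI; linarith)
  next
    case 3
    define u where "u = x - 1"
    have u: "0 \<le> u" "u \<le> 1" using 3 by (auto simp: u_def)
    \<comment> \<open>The crude bounds \<open>q \<le> 1 - u\<close>, \<open>u ^ 3 \<le> u\<close>
      and \<open>r \<le> 1 / 2\<close> make the estimates on the middle piece linear in
      \<open>u\<close>.\<close>
    define q r where "q = u ^ 2 * (1 - u)" and "r = u * (1 - u)"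
    have "q \<le> 1 - u"
      unfolding q_def using unit[OF u, of 2] u by (intro mult_left_le_one_le) auto
    moreover have "u ^ 3 \<le> u" using u by (simp add: power_decreasing[of 1 3 u, simplified])
    moreover have "q \<ge> 0" "r \<ge> 0" "u ^ 3 \<ge> 0" using u by (auto simp: q_def r_def)
    moreover have "r \<le> 1 / 2"
      using zero_le_power2[of "u - 1 / 2"] by (simp add: r_def power2_eq_square algebra_simps)
    moreover have x: "x = 1 + u" by (simp add: u_def)
    then have "spline_step x = 1 / 6 + u / 2 + q / 2 + u ^ 3 / 6" "spline_step' x = 1 / 2 + r"
      using 3(3,4) by (simp_all add: q_def r_def)
    moreover have "spline_step'' x = 1 / 2 - u" using 3(5) x by simp
    ultimately show ?thesis using u by (auto simp: abs_le_iff)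
  next
    case 4
    have "spline_step' x \<ge> 0" "spline_step' x \<le> 1"
      using 4 zero_le_power2[of "3 - x"] unit[of "3 - x" 2] by linarith+
    then show ?thesis using 4(1-3,5) unit[of "3 - x" 3] by (auto simp: abs_le_iff)
  qed auto
  then show "0 \<le> spline_step x" "spline_step x \<le> 1" "0 \<le> spline_step' x" "spline_step' x \<le> 1" "\<bar>spline_step'' x\<bar> \<le> 1"
    by auto
qed

lemma spline_step_eq_0: "x \<le> 0 \<Longrightarrow> spline_step x = 0"
  by (simp add: spline_step_def)

lemma spline_step_eq_1: "3 \<le> x \<Longrightarrow> spline_step x = 1"
  by (cases x rule: spline_step_pieces) auto

lemma spline_step_measurable [measurable]: "spline_step \<in> borel_measurable borel"
  unfolding spline_step_def by measurable

section \<open>Second-order expansions with cubic remainder\<close>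

text \<open>\<open>H\<close> plays the part of half the Hessian, so no factor 1/2 appears. It need
  not be symmetric, since only its contraction with \<open>x p * x q\<close> matters. The remainder
  bound forces \<open>f\<close> to depend on the coordinates in \<open>N\<close> alone. Prescribing
  the expansion instead of differentiating leaves only a product and a complement rule to
  prove.\<close>

definition jet2 :: "'a set \<Rightarrow> real \<Rightarrow> (('a \<Rightarrow> real) \<Rightarrow> real) \<Rightarrow> (('a \<Rightarrow> real) \<Rightarrow> 'a \<Rightarrow> real)
    \<Rightarrow> (('a \<Rightarrow> real) \<Rightarrow> 'a \<Rightarrow> 'a \<Rightarrow> real) \<Rightarrow> bool" where
  "jet2 N C f D H \<longleftrightarrow> (\<forall>z. \<bar>f z\<bar> \<le> C \<and> (\<forall>p\<in>N. \<bar>D z p\<bar> \<le> C) \<and> (\<forall>p\<in>N. \<forall>q\<in>N. \<bar>H z p q\<bar> \<le> C) \<and>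
     (\<forall>x. \<bar>f (\<lambda>p. z p + x p) - f z - (\<Sum>p\<in>N. D z p * x p) - (\<Sum>p\<in>N. \<Sum>q\<in>N. H z p q * x p * x q)\<bar>
        \<le> C * (\<Sum>p\<in>N. \<bar>x p\<bar>) ^ 3))"

lemma jet2_remainder:
  "jet2 N C f D H \<Longrightarrow>
    \<bar>f (\<lambda>p. z p + x p) - f z - (\<Sum>p\<in>N. D z p * x p) - (\<Sum>p\<in>N. \<Sum>q\<in>N. H z p q * x p * x q)\<bar>
      \<le> C * (\<Sum>p\<in>N. \<bar>x p\<bar>) ^ 3"
  unfolding jet2_def by blast

lemma jet2_mono:
  assumes "jet2 N C f D H" "C \<le> C'"
  shows "jet2 N C' f D H"
proof -
  have "C * (\<Sum>p\<in>N. \<bar>x p\<bar>) ^ 3 \<le> C' * (\<Sum>p\<in>N. \<bar>x p\<bar>) ^ 3" for x :: "'a \<Rightarrow> real"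
    using assms(2) by (intro mult_right_mono zero_le_power sum_nonneg) auto
  then show ?thesis
    using assms unfolding jet2_def by (meson order_trans)
qed

lemma jet2_nonneg: "jet2 N C f D H \<Longrightarrow> 0 \<le> C"
  unfolding jet2_def by (meson abs_ge_zero order_trans)

lemma jet2_const: "jet2 N \<bar>c\<bar> (\<lambda>_. c) (\<lambda>_ _. 0) (\<lambda>_ _ _. 0)"
  unfolding jet2_def by (auto intro!: mult_nonneg_nonneg sum_nonneg)

lemma jet2_compl:
  assumes "jet2 N C f D H"
  shows "jet2 N (1 + C) (\<lambda>z. 1 - f z) (\<lambda>z p. - D z p) (\<lambda>z p q. - H z p q)"
  unfolding jet2_def
proof (intro allI conjI ballI)
  fix z x :: "'a \<Rightarrow> real"
  let ?L = "(\<Sum>p\<in>N. \<bar>x p\<bar>) ^ 3"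
  have *: "\<bar>f z\<bar> \<le> C" and "\<bar>f (\<lambda>p. z p + x p) - f z - (\<Sum>p\<in>N. D z p * x p) - (\<Sum>p\<in>N. \<Sum>q\<in>N. H z p q * x p * x q)\<bar>
        \<le> C * ?L"
    using assms unfolding jet2_def by blast+
  moreover have "C * ?L \<le> (1 + C) * ?L" by (intro mult_right_mono zero_le_power sum_nonneg) auto
  moreover have "1 - f (\<lambda>p. z p + x p) - (1 - f z) - (\<Sum>p\<in>N. - D z p * x p)
      - (\<Sum>p\<in>N. \<Sum>q\<in>N. - H z p q * x p * x q)
    = - (f (\<lambda>p. z p + x p) - f z - (\<Sum>p\<in>N. D z p * x p) - (\<Sum>p\<in>N. \<Sum>q\<in>N. H z p q * x p * x q))"
    by (simp add: sum_negf)
  ultimately show "\<bar>1 - f (\<lambda>p. z p + x p) - (1 - f z) - (\<Sum>p\<in>N. - D z p * x p)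
      - (\<Sum>p\<in>N. \<Sum>q\<in>N. - H z p q * x p * x q)\<bar> \<le> (1 + C) * ?L"
    by (simp only: abs_minus_cancel)
  show "\<bar>1 - f z\<bar> \<le> 1 + C" using * by linarith
  fix p q assume "p \<in> N"
  then have *: "\<bar>D z p\<bar> \<le> C" "q \<in> N \<Longrightarrow> \<bar>H z p q\<bar> \<le> C" using assms unfolding jet2_def by blast+
  then show "\<bar>- D z p\<bar> \<le> 1 + C" by simp
  assume "q \<in> N"
  then show "\<bar>- H z p q\<bar> \<le> 1 + C" using * by simp
qed

text \<open>Here \<open>u\<close> and \<open>u'\<close> are values at a displaced point and
  \<open>c0\<close>, \<open>c1\<close>, \<open>c2\<close>, \<open>d0\<close>, \<open>d1\<close>,
  \<open>d2\<close> the terms of their expansions. The error is grouped so that a term of order i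
  always meets a remainder of order 3 - i; the constant is 1 + 1 + 3 + 3.\<close>

lemma cubic_remainder_mult:
  fixes C L u u' :: real
  assumes L: "L \<ge> 0"
    and u: "\<bar>u\<bar> \<le> C" "\<bar>c0\<bar> \<le> C" "\<bar>c1\<bar> \<le> C * L" "\<bar>c2\<bar> \<le> C * L\<^sup>2" "\<bar>u - c0 - c1 - c2\<bar> \<le> C * L ^ 3"
    and u': "\<bar>u'\<bar> \<le> C" "\<bar>d0\<bar> \<le> C" "\<bar>d1\<bar> \<le> C * L" "\<bar>d2\<bar> \<le> C * L\<^sup>2" "\<bar>u' - d0 - d1 - d2\<bar> \<le> C * L ^ 3"
  shows "\<bar>u * u' - c0 * d0 - (c0 * d1 + c1 * d0) - (c0 * d2 + d0 * c2 + c1 * d1)\<bar> \<le> 8 * C\<^sup>2 * L ^ 3"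
proof -
  have C: "C \<ge> 0" using u by linarith
  have lin: "\<bar>u - c0\<bar> \<le> 3 * C * L" and quad: "\<bar>u - c0 - c1\<bar> \<le> 3 * C * L\<^sup>2"
  proof -
    \<comment> \<open>The lower-order remainders follow from the cubic one only for small
      \<open>L\<close>, where higher powers are dominated by lower ones. For large \<open>L\<close>
      the uniform bounds on \<open>u\<close>, \<open>c0\<close> and \<open>c1\<close> take
      over.\<close>
    consider "L \<le> 1" | "L \<ge> 1" by linarith
    then have "\<bar>u - c0\<bar> \<le> 3 * (C * L) \<and> \<bar>u - c0 - c1\<bar> \<le> 3 * (C * L\<^sup>2)"
    proof cases
      case 1
      have "L ^ 3 \<le> L\<^sup>2" "L\<^sup>2 \<le> L" using L 1 power_decreasing[of 2 3 L] power_decreasing[of 1 2 L] by auto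
      then have "C * L ^ 3 \<le> C * L\<^sup>2" "C * L\<^sup>2 \<le> C * L" using C by (auto intro: mult_left_mono)
      then show ?thesis using u by linarith
    next
      case 2
      have "1 \<le> L\<^sup>2" "L \<le> L\<^sup>2" using 2 power_increasing[of 1 2 L] by auto
      then have "C * 1 \<le> C * L\<^sup>2" "C * L \<le> C * L\<^sup>2" "C * 1 \<le> C * L"
        using C 2 by (intro mult_left_mono; simp)+
      then show ?thesis using u by linarith
    qed
    then show "\<bar>u - c0\<bar> \<le> 3 * C * L" "\<bar>u - c0 - c1\<bar> \<le> 3 * C * L\<^sup>2" by simp_all
  qed
  have "u * u' - c0 * d0 - (c0 * d1 + c1 * d0) - (c0 * d2 + d0 * c2 + c1 * d1)
      = u * (u' - d0 - d1 - d2) + d0 * (u - c0 - c1 - c2) + d1 * (u - c0 - c1) + d2 * (u - c0)"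
    by (simp add: algebra_simps)
  also have "\<bar>\<dots>\<bar> \<le> C * (C * L ^ 3) + C * (C * L ^ 3) + (C * L) * (3 * C * L\<^sup>2) + (C * L\<^sup>2) * (3 * C * L)"
    by (intro abs_triangle_ineq[THEN order_trans] add_mono; simp only: abs_mult)
      (intro mult_mono u u' lin quad; use C L in simp)+
  also have "\<dots> = 8 * C\<^sup>2 * L ^ 3" by (simp add: power2_eq_square power3_eq_cube)
  finally show ?thesis .
qed

text \<open>The cross part \<open>D z p * D' z q\<close> is a single unsymmetrized term: the 1/2 of
  the second-order term absorbs the two symmetric contributions of the product rule. In this form
  its sign follows at once from the signs of \<open>D\<close> and \<open>D'\<close>.\<close>

lemma jet2_mult:
  assumes "jet2 N C f D H" "jet2 N C' f' D' H'"
  shows "\<exists>K. jet2 N K (\<lambda>z. f z * f' z) (\<lambda>z p. f z * D' z p + f' z * D z p)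
     (\<lambda>z p q. f z * H' z p q + f' z * H z p q + D z p * D' z q)"
proof -
  define B where "B = 1 + C + C'"
  have "0 \<le> C" "0 \<le> C'" using jet2_nonneg[OF assms(1)] jet2_nonneg[OF assms(2)] by auto
  then have J: "jet2 N B f D H" "jet2 N B f' D' H'" and B: "B \<ge> 1"
    using jet2_mono[OF assms(1), of B] jet2_mono[OF assms(2), of B] by (auto simp: B_def)
  have bd: "\<bar>f z\<bar> \<le> B" "p \<in> N \<Longrightarrow> \<bar>D z p\<bar> \<le> B" "p \<in> N \<Longrightarrow> q \<in> N \<Longrightarrow> \<bar>H z p q\<bar> \<le> B"
    "\<bar>f' z\<bar> \<le> B" "p \<in> N \<Longrightarrow> \<bar>D' z p\<bar> \<le> B" "p \<in> N \<Longrightarrow> q \<in> N \<Longrightarrow> \<bar>H' z p q\<bar> \<le> B" for z p q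
    using J unfolding jet2_def by auto
  have BB: "\<bar>u * v\<bar> \<le> B * B" if "\<bar>u\<bar> \<le> B" "\<bar>v\<bar> \<le> B" for u v :: real
    unfolding abs_mult using that B by (intro mult_mono) auto
  have "jet2 N (8 * B\<^sup>2) (\<lambda>z. f z * f' z) (\<lambda>z p. f z * D' z p + f' z * D z p)
     (\<lambda>z p q. f z * H' z p q + f' z * H z p q + D z p * D' z q)"
    unfolding jet2_def
  proof (intro allI conjI ballI)
    fix z x :: "'a \<Rightarrow> real"
    define L where "L = (\<Sum>p\<in>N. \<bar>x p\<bar>)"
    have L: "L \<ge> 0" by (auto simp: L_def intro: sum_nonneg)
    have lin: "\<bar>\<Sum>p\<in>N. E p * x p\<bar> \<le> B * L" if "\<And>p. p \<in> N \<Longrightarrow> \<bar>E p\<bar> \<le> B" for E :: "'a \<Rightarrow> real"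
      unfolding L_def sum_distrib_left
      by (rule order_trans[OF sum_abs], rule sum_mono) (auto simp: abs_mult intro!: mult_right_mono that)
    have quad: "\<bar>\<Sum>p\<in>N. \<Sum>q\<in>N. E p q * x p * x q\<bar> \<le> B * L\<^sup>2"
      if "\<And>p q. p \<in> N \<Longrightarrow> q \<in> N \<Longrightarrow> \<bar>E p q\<bar> \<le> B" for E :: "'a \<Rightarrow> 'a \<Rightarrow> real"
    proof -
      have "\<bar>\<Sum>p\<in>N. \<Sum>q\<in>N. E p q * x p * x q\<bar> \<le> (\<Sum>p\<in>N. \<Sum>q\<in>N. B * (\<bar>x p\<bar> * \<bar>x q\<bar>))"
        by (rule order_trans[OF sum_abs], rule sum_mono, rule order_trans[OF sum_abs], rule sum_mono)
          (auto simp: abs_mult mult.assoc intro!: mult_right_mono that)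
      also have "\<dots> = B * L\<^sup>2"
        unfolding L_def power2_eq_square sum_product by (simp add: sum_distrib_left)
      finally show ?thesis .
    qed
    let ?c1 = "\<Sum>p\<in>N. D z p * x p" and ?d1 = "\<Sum>p\<in>N. D' z p * x p"
    let ?c2 = "\<Sum>p\<in>N. \<Sum>q\<in>N. H z p q * x p * x q" and ?d2 = "\<Sum>p\<in>N. \<Sum>q\<in>N. H' z p q * x p * x q"
    have rem: "\<bar>f (\<lambda>p. z p + x p) - f z - ?c1 - ?c2\<bar> \<le> B * L ^ 3" "\<bar>f' (\<lambda>p. z p + x p) - f' z - ?d1 - ?d2\<bar> \<le> B * L ^ 3"
      using J unfolding jet2_def L_def by blast+
    have "\<bar>f (\<lambda>p. z p + x p) * f' (\<lambda>p. z p + x p) - f z * f' z - (f z * ?d1 + ?c1 * f' z)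
      - (f z * ?d2 + f' z * ?c2 + ?c1 * ?d1)\<bar> \<le> 8 * B\<^sup>2 * L ^ 3"
      by (intro cubic_remainder_mult L bd lin quad rem)
    moreover have "f z * ?d1 + ?c1 * f' z = (\<Sum>p\<in>N. (f z * D' z p + f' z * D z p) * x p)"
      by (simp add: sum_distrib_left sum_distrib_right sum.distrib algebra_simps)
    moreover have "f z * ?d2 + f' z * ?c2 + ?c1 * ?d1
        = (\<Sum>p\<in>N. \<Sum>q\<in>N. (f z * H' z p q + f' z * H z p q + D z p * D' z q) * x p * x q)"
      unfolding sum_product by (simp add: sum_distrib_left sum.distrib algebra_simps)
    ultimately show "\<bar>f (\<lambda>p. z p + x p) * f' (\<lambda>p. z p + x p) - f z * f' z -
        (\<Sum>p\<in>N. (f z * D' z p + f' z * D z p) * x p)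
       - (\<Sum>p\<in>N. \<Sum>q\<in>N. (f z * H' z p q + f' z * H z p q + D z p * D' z q) * x p * x q)\<bar> \<le> 8 * B\<^sup>2 * (\<Sum>p\<in>N. \<bar>x p\<bar>) ^ 3"
      unfolding L_def by simp
    have "B * B \<ge> 0" by simp
    have *: "B * B + B * B + B * B \<le> 8 * B\<^sup>2" by (simp add: power2_eq_square)
    show "\<bar>f z * f' z\<bar> \<le> 8 * B\<^sup>2" using BB[OF bd(1)[of z] bd(4)[of z]] * \<open>B * B \<ge> 0\<close> by linarith
    fix p q assume p: "p \<in> N"
    show "\<bar>f z * D' z p + f' z * D z p\<bar> \<le> 8 * B\<^sup>2"
      using BB[OF bd(1)[of z] bd(5)[OF p, of z]] BB[OF bd(4)[of z] bd(2)[OF p, of z]] * \<open>B * B \<ge> 0\<close> by linarith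
    assume q: "q \<in> N"
    show "\<bar>f z * H' z p q + f' z * H z p q + D z p * D' z q\<bar> \<le> 8 * B\<^sup>2"
      using BB[OF bd(1)[of z] bd(6)[OF p q, of z]] BB[OF bd(4)[of z] bd(3)[OF p q, of z]] BB[OF bd(2)[OF p, of z] bd(5)[OF q, of z]] * \<open>B * B \<ge> 0\<close>
      by linarith
  qed
  then show ?thesis by blast
qed

text \<open>Chain rule with scale \<open>\<kappa>\<close>. The value and the two derivatives are of
  order at most \<open>\<kappa>\<^sup>2\<close>, and \<open>\<kappa> \<ge> 1\<close> lets the
  constant of the cubic remainder dominate them.\<close>

lemma jet2_spline_step:
  fixes \<kappa> c :: real
  assumes N: "finite N" "r \<in> N" and \<kappa>: "\<kappa> \<ge> 1"
  shows "jet2 N (2 * \<kappa> ^ 3) (\<lambda>z. spline_step (\<kappa> * (z r - c)))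
     (\<lambda>z p. if p = r then \<kappa> * spline_step' (\<kappa> * (z r - c)) else 0)
     (\<lambda>z p q. if p = r \<and> q = r then \<kappa>\<^sup>2 * spline_step'' (\<kappa> * (z r - c)) else 0)"
  unfolding jet2_def
proof (intro allI conjI ballI)
  fix z x :: "'a \<Rightarrow> real"
  let ?y = "\<kappa> * (z r - c)"
  have \<kappa>3: "1 \<le> \<kappa> ^ 3" "\<kappa> \<le> \<kappa> ^ 3" "\<kappa>\<^sup>2 \<le> \<kappa> ^ 3"
    using \<kappa> power_increasing[of 1 3 \<kappa>] power_increasing[of 2 3 \<kappa>] by (auto simp: one_le_power)
  have "(\<Sum>p\<in>N. (if p = r then \<kappa> * spline_step' ?y else 0) * x p) = spline_step' ?y * (\<kappa> * x r)"
  proof -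
    have "(\<Sum>p\<in>N. (if p = r then \<kappa> * spline_step' ?y else 0) * x p)
        = (\<Sum>p\<in>N. if p = r then \<kappa> * spline_step' ?y * x p else 0)" by (intro sum.cong) auto
    then show ?thesis using N by simp
  qed
  moreover have "(\<Sum>p\<in>N. \<Sum>q\<in>N. (if p = r \<and> q = r then \<kappa>\<^sup>2 * spline_step'' ?y else 0) * x p * x q)
     = spline_step'' ?y * (\<kappa> * x r)\<^sup>2"
  proof -
    have "(\<Sum>p\<in>N. \<Sum>q\<in>N. (if p = r \<and> q = r then \<kappa>\<^sup>2 * spline_step'' ?y else 0) * x p * x q)
       = (\<Sum>p\<in>N. if p = r then (\<Sum>q\<in>N. if q = r then \<kappa>\<^sup>2 * spline_step'' ?y * x p * x q else 0) else 0)"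
      by (intro sum.cong) (auto intro!: sum.cong)
    then show ?thesis using N by (simp add: power2_eq_square)
  qed
  moreover have "\<kappa> * (z r + x r - c) = ?y + \<kappa> * x r" by (simp add: algebra_simps)
  moreover have "\<bar>\<kappa> * x r\<bar> ^ 3 \<le> \<kappa> ^ 3 * (\<Sum>p\<in>N. \<bar>x p\<bar>) ^ 3"
  proof -
    have "\<bar>x r\<bar> \<le> (\<Sum>p\<in>N. \<bar>x p\<bar>)" using N by (intro member_le_sum) auto
    then show ?thesis using \<kappa> by (auto simp: abs_mult power_mult_distrib intro!: power_mono mult_left_mono)
  qed
  ultimately show "\<bar>spline_step (\<kappa> * (z r + x r - c)) - spline_step ?y
      - (\<Sum>p\<in>N. (if p = r then \<kappa> * spline_step' ?y else 0) * x p)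
      - (\<Sum>p\<in>N. \<Sum>q\<in>N. (if p = r \<and> q = r then \<kappa>\<^sup>2 * spline_step'' ?y else 0) * x p * x q)\<bar>
        \<le> 2 * \<kappa> ^ 3 * (\<Sum>p\<in>N. \<bar>x p\<bar>) ^ 3"
    using spline_step_taylor[of ?y "\<kappa> * x r"] by (simp del: abs_mult)
  show "\<bar>spline_step ?y\<bar> \<le> 2 * \<kappa> ^ 3" using spline_step_bounds(1,2)[of ?y] \<kappa>3 by linarith
  fix p q
  have "\<kappa> * spline_step' ?y \<le> \<kappa> * 1" "\<kappa> * spline_step' ?y \<ge> 0"
    using spline_step_bounds(3,4)[of ?y] \<kappa> by (auto intro!: mult_left_mono)
  then have "\<bar>\<kappa> * spline_step' ?y\<bar> \<le> 2 * \<kappa> ^ 3" using \<kappa>3 \<kappa> by linarith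
  then show "\<bar>if p = r then \<kappa> * spline_step' ?y else 0\<bar> \<le> 2 * \<kappa> ^ 3" using \<kappa> by simp
  have "\<kappa>\<^sup>2 * \<bar>spline_step'' ?y\<bar> \<le> \<kappa>\<^sup>2 * 1"
    using spline_step_bounds(5)[of ?y] by (intro mult_left_mono) auto
  then have "\<bar>\<kappa>\<^sup>2 * spline_step'' ?y\<bar> \<le> 2 * \<kappa> ^ 3" using \<kappa>3 by (simp add: abs_mult)
  then show "\<bar>if p = r \<and> q = r then \<kappa>\<^sup>2 * spline_step'' ?y else 0\<bar> \<le> 2 * \<kappa> ^ 3"
    using \<kappa> by simp
qed

text \<open>A smooth minorant of the indicator of the event that for every \<open>w\<close> there is a \<open>v\<close> with
  \<open>c (w, v) < x (w, v)\<close>.\<close>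
definition smooth_event :: "'w set \<Rightarrow> 'v set \<Rightarrow> real \<Rightarrow> ('w \<times> 'v \<Rightarrow> real) \<Rightarrow> ('w \<times> 'v \<Rightarrow> real) \<Rightarrow> real" where
  "smooth_event W V \<kappa> c x = (\<Prod>w\<in>W. 1 - (\<Prod>v\<in>V. 1 - spline_step (\<kappa> * (x (w, v) - c (w, v)))))"

text \<open>The row product decreases in every coordinate and sees only row \<open>w\<close>. That
  \<open>D\<close> vanishes off this row serves the induction: otherwise the cross term of the
  product rule could create second derivatives between different rows.\<close>

lemma jet2_smooth_row:
  assumes "finite N" "finite V" "{w} \<times> V \<subseteq> N" "\<kappa> \<ge> 1"
  shows "\<exists>K D H. jet2 N K (\<lambda>z. \<Prod>v\<in>V. 1 - spline_step (\<kappa> * (z (w, v) - c (w, v)))) D H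
    \<and> (\<forall>z p. D z p \<le> 0) \<and> (\<forall>z p q. fst p \<noteq> fst q \<longrightarrow> H z p q = 0)
    \<and> (\<forall>z p. fst p \<noteq> w \<longrightarrow> D z p = 0)"
  using assms(2,3)
proof (induction V)
  case empty
  show ?case using jet2_const[of N 1] by auto
next
  case (insert v V)
  then obtain K D H where IH: "jet2 N K (\<lambda>z. \<Prod>v\<in>V. 1 - spline_step (\<kappa> * (z (w, v) - c (w, v)))) D H"
    "\<And>z p. D z p \<le> 0" "\<And>z p q. fst p \<noteq> fst q \<Longrightarrow> H z p q = 0" "\<And>z p. fst p \<noteq> w \<Longrightarrow> D z p = 0"
    by auto
  let ?f = "\<lambda>z. 1 - spline_step (\<kappa> * (z (w, v) - c (w, v)))"
  let ?g = "\<lambda>z. \<Prod>v\<in>V. 1 - spline_step (\<kappa> * (z (w, v) - c (w, v)))"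
  have v: "(w, v) \<in> N" using insert by auto
  obtain K' where K': "jet2 N K' (\<lambda>z. ?f z * ?g z)
     (\<lambda>z p. ?f z * D z p + ?g z * (- (if p = (w, v) then \<kappa> * spline_step' (\<kappa> * (z (w, v) - c (w, v))) else 0)))
     (\<lambda>z p q. ?f z * H z p q + ?g z * (- (if p = (w, v) \<and> q = (w, v) then \<kappa>\<^sup>2 * spline_step'' (\<kappa> * (z (w, v) - c (w, v))) else 0))
       + (- (if p = (w, v) then \<kappa> * spline_step' (\<kappa> * (z (w, v) - c (w, v))) else 0)) * D z q)"
    (is "jet2 _ _ _ ?D ?H")
    using jet2_mult[OF jet2_compl[OF jet2_spline_step[OF assms(1) v assms(4), of "c (w, v)"]] IH(1)] by blast
  have g0: "?g z \<ge> 0" "?f z \<ge> 0" for z by (auto intro!: prod_nonneg simp: spline_step_bounds)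
  have "?D z p \<le> 0" for z p
    using g0 IH(2) assms(4) spline_step_bounds(3)
    by (intro add_nonpos_nonpos mult_nonneg_nonpos) auto
  moreover have "?H z p q = 0" if "fst p \<noteq> fst q" for z p q
    using that IH(3)[of p q z] IH(4)[of q z] by auto
  moreover have "?D z p = 0" if "fst p \<noteq> w" for z p
    using that IH(4)[of p z] by auto
  moreover have "jet2 N K' (\<lambda>z. \<Prod>v\<in>insert v V. 1 - spline_step (\<kappa> * (z (w, v) - c (w, v)))) ?D ?H"
    using K' insert(1,2) by simp
  ultimately show ?case by blast
qed

text \<open>Complementing turns the decreasing row products into increasing ones. Between different
  rows the second derivatives come only from products of first derivatives, all nonnegative. Inside
  a row their sign is uncontrolled, which is why the covariances have to agree there.\<close>

lemma jet2_smooth_event: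
  assumes N: "finite N" and V: "finite V" and W: "finite W" "W \<times> V \<subseteq> N" and \<kappa>: "\<kappa> \<ge> 1"
  shows "\<exists>K D H. jet2 N K (smooth_event W V \<kappa> c) D H
    \<and> (\<forall>z p. D z p \<ge> 0) \<and> (\<forall>z p q. fst p \<noteq> fst q \<longrightarrow> H z p q \<ge> 0)"
  using W
proof (induction W)
  case empty
  show ?case using jet2_const[of N 1] by (auto simp: smooth_event_def)
next
  case (insert w W)
  let ?f = "\<lambda>z. 1 - (\<Prod>v\<in>V. 1 - spline_step (\<kappa> * (z (w, v) - c (w, v))))"
  let ?g = "smooth_event W V \<kappa> c"
  have "W \<times> V \<subseteq> N" using insert.prems by auto
  from insert.IH[OF this] obtain K D H where IH: "jet2 N K ?g D H"
    "\<And>z p. D z p \<ge> 0" "\<And>z p q. fst p \<noteq> fst q \<Longrightarrow> H z p q \<ge> 0"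
    by blast
  have "{w} \<times> V \<subseteq> N" using insert by auto
  from jet2_smooth_row[OF N V this \<kappa>, of c]
  obtain K0 D0 H0 where row: "jet2 N K0 (\<lambda>z. \<Prod>v\<in>V. 1 - spline_step (\<kappa> * (z (w, v) - c (w, v)))) D0 H0"
    "\<And>z p. D0 z p \<le> 0" "\<And>z p q. fst p \<noteq> fst q \<Longrightarrow> H0 z p q = 0" by auto
  obtain K' where K': "jet2 N K' (\<lambda>z. ?f z * ?g z)
     (\<lambda>z p. ?f z * D z p + ?g z * (- D0 z p))
     (\<lambda>z p q. ?f z * H z p q + ?g z * (- H0 z p q) + (- D0 z p) * D z q)"
    (is "jet2 _ _ _ ?D ?H")
    using jet2_mult[OF jet2_compl[OF row(1)] IH(1)] by blast
  have le1: "(\<Prod>v\<in>V. 1 - spline_step (\<kappa> * (z (w, v) - c (w, v)))) \<le> 1" for z w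
    by (intro prod_le_1) (auto simp: spline_step_bounds)
  have g0: "?g z \<ge> 0" "?f z \<ge> 0" for z using le1 by (auto intro!: prod_nonneg simp: smooth_event_def)
  have "?D z p \<ge> 0" for z p
    using g0 IH(2) row(2) by (intro add_nonneg_nonneg mult_nonneg_nonneg) auto
  moreover have "?H z p q \<ge> 0" if "fst p \<noteq> fst q" for z p q
    using that g0 IH(2,3) row(2,3) by (intro add_nonneg_nonneg mult_nonneg_nonneg) auto
  moreover have "smooth_event (insert w W) V \<kappa> c = (\<lambda>z. ?f z * ?g z)"
    using insert(1,2) by (simp add: smooth_event_def fun_eq_iff)
  with K' have "jet2 N K' (smooth_event (insert w W) V \<kappa> c) ?D ?H" by (simp only:)
  ultimately show ?case by blast
qed

lemma smooth_event_bounds: "0 \<le> smooth_event W V \<kappa> c x" "smooth_event W V \<kappa> c x \<le> 1"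
proof -
  have le1: "(\<Prod>v\<in>V. 1 - spline_step (\<kappa> * (x (w, v) - c (w, v)))) \<le> 1" for w
    by (intro prod_le_1) (auto simp: spline_step_bounds)
  have ge0: "(\<Prod>v\<in>V. 1 - spline_step (\<kappa> * (x (w, v) - c (w, v)))) \<ge> 0" for w
    by (intro prod_nonneg) (auto simp: spline_step_bounds)
  show "0 \<le> smooth_event W V \<kappa> c x" "smooth_event W V \<kappa> c x \<le> 1"
    unfolding smooth_event_def using le1 ge0 by (auto intro!: prod_nonneg prod_le_1)
qed

lemma smooth_event_eq_0:
  assumes "finite W" "finite V" "\<kappa> \<ge> 0" "w \<in> W" "\<And>v. v \<in> V \<Longrightarrow> x (w, v) \<le> c (w, v)"
  shows "smooth_event W V \<kappa> c x = 0"
proof -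
  have "spline_step (\<kappa> * (x (w, v) - c (w, v))) = 0" if "v \<in> V" for v
    using assms(3) assms(5)[OF that] by (intro spline_step_eq_0 mult_nonneg_nonpos) auto
  then show ?thesis unfolding smooth_event_def using assms(1,4) by (intro prod_zero bexI[of _ w]) auto
qed

lemma smooth_event_eq_1:
  assumes "finite W" "finite V" "\<And>w. w \<in> W \<Longrightarrow> \<exists>v\<in>V. \<kappa> * (x (w, v) - c (w, v)) \<ge> 3"
  shows "smooth_event W V \<kappa> c x = 1"
  unfolding smooth_event_def
proof (intro prod.neutral ballI)
  fix w assume "w \<in> W"
  with assms(3) obtain v where v: "v \<in> V" "\<kappa> * (x (w, v) - c (w, v)) \<ge> 3" by blast
  then have "(\<Prod>v\<in>V. 1 - spline_step (\<kappa> * (x (w, v) - c (w, v)))) = 0"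
    using assms(2) by (intro prod_zero bexI[of _ v]) (auto simp: spline_step_eq_1)
  then show "1 - (\<Prod>v\<in>V. 1 - spline_step (\<kappa> * (x (w, v) - c (w, v)))) = 1" by simp
qed

lemma smooth_event_measurable [measurable (raw)]:
  assumes "\<And>p. (\<lambda>\<omega>. X \<omega> p) \<in> borel_measurable M"
  shows "(\<lambda>\<omega>. smooth_event W V \<kappa> c (X \<omega>)) \<in> borel_measurable M"
  unfolding smooth_event_def using assms by measurable

section \<open>The standard Gaussian measure\<close>

abbreviation std_normal :: "real measure" where
  "std_normal \<equiv> density lborel std_normal_density"

definition gauss :: "'i set \<Rightarrow> ('i \<Rightarrow> real) measure" where
  "gauss I = Pi\<^sub>M I (\<lambda>_. std_normal)"

interpretation std_normal: prob_space std_normal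
  by (rule prob_space_normal_density) simp

interpretation std_normals: product_sigma_finite "\<lambda>_. std_normal"
  by (simp add: product_sigma_finite_def std_normal.sigma_finite_measure_axioms)

lemma sets_gauss [measurable_cong]: "sets (gauss I) = sets (Pi\<^sub>M I (\<lambda>_. borel))"
  unfolding gauss_def by (intro sets_PiM_cong) auto

lemma prob_space_gauss: "prob_space (gauss I)"
  unfolding gauss_def by (intro prob_space_PiM std_normal.prob_space_axioms)

interpretation gauss: prob_space "gauss I"
  by (rule prob_space_gauss)

interpretation gauss_pair: pair_prob_space "gauss I" "gauss J"
  by unfold_locales

interpretation std_normal_pair: pair_prob_space std_normal std_normal
  by unfold_locales

lemma std_normal_stable:
  assumes "a \<ge> 0" "b \<ge> 0" "a\<^sup>2 + b\<^sup>2 = (1::real)"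
  shows "distr (std_normal \<Otimes>\<^sub>M std_normal) borel (\<lambda>(x, y). a * x + b * y) = std_normal"
proof -
  let ?P = "std_normal \<Otimes>\<^sub>M std_normal"
  have sets: "sets ?P = sets (borel \<Otimes>\<^sub>M borel)" by (intro sets_pair_measure_cong) auto
  have fst: "distr ?P borel fst = std_normal"
    using std_normal.distr_pair_fst[of std_normal] distr_cong[of ?P ?P borel std_normal fst fst] by simp
  have sw: "distr ?P ?P (\<lambda>(x, y). (y, x)) = ?P"
    using std_normal_pair.distr_pair_swap by simp
  have snd: "distr ?P borel snd = std_normal"
  proof -
    have "distr ?P borel snd = distr (distr ?P ?P (\<lambda>(x, y). (y, x))) borel snd" by (simp only: sw)
    also have "\<dots> = distr ?P borel fst"
      by (subst distr_distr) (auto simp: comp_def case_prod_beta sets intro!: measurable_pair_swap' distr_cong)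
    finally show ?thesis using fst by simp
  qed
  show ?thesis
  \<comment> \<open>A zero coefficient yields a point mass, which has no density, so the addition
    rule for independent normal densities does not cover it.\<close>
  proof (cases "a = 0 \<or> b = 0")
    case True
    then show ?thesis
    proof
      assume "a = 0"
      then have "b = 1" using assms by (simp add: power2_eq_1_iff)
      then show ?thesis using snd \<open>a = 0\<close> by (simp add: snd_def[abs_def])
    next
      assume "b = 0"
      then have "a = 1" using assms by (simp add: power2_eq_1_iff)
      then show ?thesis using fst \<open>b = 0\<close> by (simp add: fst_def[abs_def])
    qed
  next
    case False
    then have ab: "a > 0" "b > 0" using assms by auto
    have "fst \<in> measurable ?P borel" "snd \<in> measurable ?P borel"
      by (auto simp: measurable_cong_sets[OF sets refl])
    then have X: "distributed ?P lborel fst std_normal_density" "distributed ?P lborel snd std_normal_density"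
      using fst snd by (auto simp: distributed_def cong: distr_cong)
    have ind: "std_normal_pair.indep_var borel fst borel snd"
      unfolding std_normal_pair.indep_var_distribution_eq fst snd
      by (auto simp: measurable_cong_sets[OF sets refl] sets intro!: distr_id2[symmetric] simp: distr_id2)
    have X': "distributed ?P lborel (\<lambda>p. 0 + a * fst p) (normal_density (0 + a * 0) (\<bar>a\<bar> * 1))"
      "distributed ?P lborel (\<lambda>p. 0 + b * snd p) (normal_density (0 + b * 0) (\<bar>b\<bar> * 1))"
      using X ab by (intro std_normal_pair.normal_density_affine; simp)+
    have "std_normal_pair.indep_var borel ((\<lambda>x. a * x) \<circ> fst) borel ((\<lambda>x. b * x) \<circ> snd)"
      by (intro std_normal_pair.indep_var_compose[OF ind]) auto
    then have "distributed ?P lborel (\<lambda>p. a * fst p + b * snd p) (normal_density (0 + 0) (sqrt (a\<^sup>2 + b\<^sup>2)))"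
      using X' ab by (intro std_normal_pair.add_indep_normal) (auto simp: comp_def)
    then have "distr ?P lborel (\<lambda>p. a * fst p + b * snd p) = std_normal"
      using assms(3) by (simp add: distributed_def)
    then show ?thesis by (simp add: case_prod_beta cong: distr_cong)
  qed
qed

text \<open>Boxes suffice to identify the law. The preimage of a box factorizes over the
  coordinates, and Fubini reduces each factor to the one-dimensional statement. The result is used
  to split a Gaussian vector into two independent ones.\<close>

lemma gauss_stable:
  assumes "finite I" "a \<ge> 0" "b \<ge> 0" "a\<^sup>2 + b\<^sup>2 = (1::real)"
  shows "distr (gauss I \<Otimes>\<^sub>M gauss I) (gauss I) (\<lambda>(x, y). \<lambda>i\<in>I. a * x i + b * y i) = gauss I"
proof -
  let ?T = "\<lambda>(x, y). \<lambda>i\<in>I. a * x i + b * y i"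
  have meas: "?T \<in> measurable (gauss I \<Otimes>\<^sub>M gauss I) (gauss I)"
    unfolding measurable_cong_sets[OF refl sets_gauss] by measurable
  have "distr (gauss I \<Otimes>\<^sub>M gauss I) (gauss I) ?T = Pi\<^sub>M I (\<lambda>_. std_normal)"
  proof (rule std_normals.PiM_eqI)
    fix A :: "'a \<Rightarrow> real set" assume "\<And>i. i \<in> I \<Longrightarrow> A i \<in> sets std_normal"
    then have A: "A i \<in> sets borel" if "i \<in> I" for i using that by auto
    have PA: "Pi\<^sub>E I A \<in> sets (gauss I)"
      unfolding sets_gauss using A by (intro sets_PiM_I_finite assms(1)) auto
    have box: "{y. a * t + b * y \<in> A i} \<in> sets borel" if "i \<in> I" for t i
      using A[OF that] by measurable
    have "emeasure (distr (gauss I \<Otimes>\<^sub>M gauss I) (gauss I) ?T) (Pi\<^sub>E I A)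
      = emeasure (gauss I \<Otimes>\<^sub>M gauss I) (?T -` Pi\<^sub>E I A \<inter> space (gauss I \<Otimes>\<^sub>M gauss I))"
      by (intro emeasure_distr meas PA)
    also have "\<dots> = (\<integral>\<^sup>+x. emeasure (gauss I) (Pair x -` (?T -` Pi\<^sub>E I A \<inter> space (gauss I \<Otimes>\<^sub>M gauss I))) \<partial>gauss I)"
      by (intro gauss.emeasure_pair_measure_alt measurable_sets[OF meas PA])
    also have "\<dots> = (\<integral>\<^sup>+x. (\<Prod>i\<in>I. emeasure std_normal {y. a * x i + b * y \<in> A i}) \<partial>gauss I)"
    proof (intro nn_integral_cong)
      fix x assume "x \<in> space (gauss I)"
      then have "Pair x -` (?T -` Pi\<^sub>E I A \<inter> space (gauss I \<Otimes>\<^sub>M gauss I)) = Pi\<^sub>E I (\<lambda>i. {y. a * x i + b * y \<in> A i})"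
        by (auto simp: space_pair_measure gauss_def space_PiM PiE_iff)
      then show "emeasure (gauss I) (Pair x -` (?T -` Pi\<^sub>E I A \<inter> space (gauss I \<Otimes>\<^sub>M gauss I)))
        = (\<Prod>i\<in>I. emeasure std_normal {y. a * x i + b * y \<in> A i})"
        unfolding gauss_def using box assms(1) by (simp add: std_normals.emeasure_PiM)
    qed
    also have "\<dots> = (\<Prod>i\<in>I. \<integral>\<^sup>+t. emeasure std_normal {y. a * t + b * y \<in> A i} \<partial>std_normal)"
      unfolding gauss_def
    proof (intro std_normals.product_nn_integral_prod assms(1))
      fix i assume i: "i \<in> I"
      have "(\<lambda>t. emeasure std_normal (Pair t -` {p. a * fst p + b * snd p \<in> A i})) \<in> borel_measurable borel"
      proof (intro std_normal.measurable_emeasure_Pair)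
        show "{p. a * fst p + b * snd p \<in> A i} \<in> sets (borel \<Otimes>\<^sub>M std_normal)"
        proof -
          have "(\<lambda>p. a * fst p + b * snd p) -` A i \<inter> space (borel \<Otimes>\<^sub>M borel) \<in> sets (borel \<Otimes>\<^sub>M borel)"
            by (rule measurable_sets[OF _ A[OF i]]) measurable
          then show ?thesis
            unfolding sets_pair_measure_cong[OF refl, of std_normal borel borel, simplified]
            by (simp add: vimage_def space_pair_measure)
        qed
      qed
      then show "(\<lambda>t. emeasure std_normal {y. a * t + b * y \<in> A i}) \<in> borel_measurable std_normal"
        by (simp add: vimage_def)
    qed
    also have "\<dots> = (\<Prod>i\<in>I. emeasure std_normal (A i))"
    proof (intro prod.cong refl)
      fix i assume i: "i \<in> I"
      have m: "(\<lambda>(x, y). a * x + b * y) \<in> measurable (std_normal \<Otimes>\<^sub>M std_normal) borel"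
        unfolding measurable_cong_sets[OF sets_pair_measure_cong[of std_normal borel std_normal borel] refl, simplified]
        by measurable
      have "emeasure std_normal (A i) = emeasure (distr (std_normal \<Otimes>\<^sub>M std_normal) borel (\<lambda>(x, y). a * x + b * y)) (A i)"
        using std_normal_stable[OF assms(2-4)] by simp
      also have "\<dots> = emeasure (std_normal \<Otimes>\<^sub>M std_normal) ((\<lambda>(x, y). a * x + b * y) -` A i \<inter> space (std_normal \<Otimes>\<^sub>M std_normal))"
        by (intro emeasure_distr m A i)
      also have "\<dots> = (\<integral>\<^sup>+t. emeasure std_normal (Pair t -` ((\<lambda>(x, y). a * x + b * y) -` A i \<inter> space (std_normal \<Otimes>\<^sub>M std_normal))) \<partial>std_normal)"
        by (intro std_normal.emeasure_pair_measure_alt measurable_sets[OF m] A i)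
      also have "\<dots> = (\<integral>\<^sup>+t. emeasure std_normal {y. a * t + b * y \<in> A i} \<partial>std_normal)"
        by (intro nn_integral_cong arg_cong[where f = "emeasure std_normal"]) (auto simp: space_pair_measure)
      finally show "(\<integral>\<^sup>+t. emeasure std_normal {y. a * t + b * y \<in> A i} \<partial>std_normal) = emeasure std_normal (A i)" ..
    qed
    finally show "emeasure (distr (gauss I \<Otimes>\<^sub>M gauss I) (gauss I) ?T) (Pi\<^sub>E I A) = (\<Prod>i\<in>I. emeasure std_normal (A i))" .
  qed (use assms in \<open>auto simp: gauss_def\<close>)
  then show ?thesis by (simp add: gauss_def)
qed

lemma std_normal_moments:
  "integrable std_normal (\<lambda>x. \<bar>x\<bar> ^ m)"
  "integrable std_normal (\<lambda>x. x)" "(\<integral>x. x \<partial>std_normal) = 0"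
  "integrable std_normal (\<lambda>x. x * x)" "(\<integral>x. x * x \<partial>std_normal) = 1"
proof -
  show "integrable std_normal (\<lambda>x. \<bar>x\<bar> ^ m)"
    using integrable_std_normal_moment_abs by (subst integrable_density) auto
  show "integrable std_normal (\<lambda>x. x)" "(\<integral>x. x \<partial>std_normal) = 0"
    using integrable_std_normal_moment[of 1] integral_std_normal_moment_odd[of 0]
    by (auto simp: integrable_density integral_density)
  show "integrable std_normal (\<lambda>x. x * x)" "(\<integral>x. x * x \<partial>std_normal) = 1"
    using integrable_std_normal_moment[of 2] integral_std_normal_moment_even[of 1]
    by (auto simp: integrable_density integral_density power2_eq_square fact_numeral)
qed

lemma gauss_mean:
  assumes "finite I" "i \<in> I"
  shows "integrable (gauss I) (\<lambda>x. x i)" "(\<integral>x. x i \<partial>gauss I) = 0"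
proof -
  have m: "(\<lambda>x. x i) \<in> measurable (Pi\<^sub>M I (\<lambda>_. std_normal)) std_normal"
    using assms by measurable
  have d: "distr (Pi\<^sub>M I (\<lambda>_. std_normal)) std_normal (\<lambda>x. x i) = std_normal"
    using distr_PiM_component[of I "\<lambda>_. std_normal" i] assms std_normal.prob_space_axioms by simp
  have "integrable std_normal (\<lambda>x. x) \<longleftrightarrow> integrable (gauss I) (\<lambda>x. x i)"
    unfolding gauss_def by (subst d[symmetric], rule integrable_distr_eq[OF m]) simp
  then show "integrable (gauss I) (\<lambda>x. x i)" using std_normal_moments(2) by blast
  have "(\<integral>x. x \<partial>std_normal) = (\<integral>x. x i \<partial>gauss I)"
    unfolding gauss_def by (subst d[symmetric], rule integral_distr[OF m]) simp
  then show "(\<integral>x. x i \<partial>gauss I) = 0" using std_normal_moments(3) by simp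
qed

lemma gauss_covariance:
  assumes "finite I" "i \<in> I" "j \<in> I"
  shows "integrable (gauss I) (\<lambda>x. x i * x j)" "(\<integral>x. x i * x j \<partial>gauss I) = (if i = j then 1 else 0)"
proof -
  \<comment> \<open>The monomial \<open>x i * x j\<close> becomes a product over all coordinates,
    with factor 1 at the others and \<open>y * y\<close> if \<open>i = j\<close>, so that it
    integrates coordinate by coordinate.\<close>
  let ?f = "\<lambda>l y. (if l = i then y else 1) * (if l = j then y else 1 :: real)"
  have int: "integrable std_normal (?f l)" for l
    using std_normal_moments(2,4) by (cases "l = i"; cases "l = j") auto
  have *: "(\<Prod>l\<in>I. ?f l (x l)) = x i * x j" for x
    unfolding prod.distrib using assms by simp
  show "integrable (gauss I) (\<lambda>x. x i * x j)"
    using std_normals.product_integrable_prod[OF assms(1), of ?f, OF int] unfolding * gauss_def .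
  have "(\<integral>x. x i * x j \<partial>gauss I) = (\<Prod>l\<in>I. \<integral>y. ?f l y \<partial>std_normal)"
    using std_normals.product_integral_prod[OF assms(1), of ?f, OF int] unfolding * gauss_def .
  also have "\<dots> = (if i = j then 1 else 0)"
  proof (cases "i = j")
    case True
    then have "(\<integral>y. ?f l y \<partial>std_normal) = 1" for l
      using std_normal_moments(5) std_normal.prob_space by (cases "l = i") auto
    then show ?thesis using True by simp
  next
    case False
    then have "(\<integral>y. ?f i y \<partial>std_normal) = 0" using std_normal_moments(3) by auto
    then have "(\<Prod>l\<in>I. \<integral>y. ?f l y \<partial>std_normal) = 0" using assms by (intro prod_zero bexI[of _ i]) auto
    then show ?thesis using False by simp
  qed
  finally show "(\<integral>x. x i * x j \<partial>gauss I) = (if i = j then 1 else 0)" .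
qed

text \<open>The product dominates every linear function of \<open>x\<close> up to a constant, and
  its third moment factorizes over the coordinates; no multinomial expansion of a cubed sum is
  required.\<close>

lemma gauss_integrable_prod_cube:
  assumes "finite I"
  shows "integrable (gauss I) (\<lambda>x. (\<Prod>i\<in>I. (1 + \<bar>x i\<bar>)) ^ 3)"
proof -
  have "integrable std_normal (\<lambda>y. 1 + 3 * \<bar>y\<bar> ^ 1 + 3 * \<bar>y\<bar> ^ 2 + \<bar>y\<bar> ^ 3)"
    by (intro Bochner_Integration.integrable_add integrable_mult_right std_normal_moments(1)) simp
  moreover have "(\<lambda>y::real. 1 + 3 * \<bar>y\<bar> ^ 1 + 3 * \<bar>y\<bar> ^ 2 + \<bar>y\<bar> ^ 3) = (\<lambda>y. (1 + \<bar>y\<bar>) ^ 3)"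
    by (auto simp: power3_eq_cube power2_eq_square algebra_simps)
  ultimately have "integrable std_normal (\<lambda>y. (1 + \<bar>y\<bar>) ^ 3)" by simp
  then show ?thesis
    using std_normals.product_integrable_prod[OF assms, of "\<lambda>_ y. (1 + \<bar>y\<bar>) ^ 3"]
    by (simp add: gauss_def prod_power_distrib)
qed

section \<open>Linear functions of Gaussian vectors\<close>

text \<open>Under \<open>gauss I\<close> this is a centred Gaussian process indexed by
  \<open>p\<close>; the rows \<open>P p\<close> factorize its covariance
  \<open>\<Sum>i\<in>I. P p i * P q i\<close>.\<close>

definition lin :: "'i set \<Rightarrow> ('a \<Rightarrow> 'i \<Rightarrow> real) \<Rightarrow> ('i \<Rightarrow> real) \<Rightarrow> 'a \<Rightarrow> real" where
  "lin I P x p = (\<Sum>i\<in>I. P p i * x i)"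

lemma lin_measurable [measurable (raw)]:
  assumes "f \<in> measurable M (gauss I)"
  shows "(\<lambda>\<omega>. lin I P (f \<omega>) p) \<in> borel_measurable M"
proof -
  have "(\<lambda>\<omega>. f \<omega> i) \<in> borel_measurable M" if "i \<in> I" for i
  proof -
    have "(\<lambda>x. x i) \<in> borel_measurable (gauss I)"
      unfolding measurable_cong_sets[OF sets_gauss refl] using that by (rule measurable_component_singleton)
    from measurable_compose[OF assms this] show ?thesis .
  qed
  then show ?thesis unfolding lin_def by (intro borel_measurable_sum borel_measurable_times) auto
qed

lemma gauss_lin_moments:
  assumes "finite I"
  shows "integrable (gauss I) (\<lambda>x. lin I P x p)" "(\<integral>x. lin I P x p \<partial>gauss I) = 0"
    "integrable (gauss I) (\<lambda>x. lin I P x p * lin I P x q)"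
    "(\<integral>x. lin I P x p * lin I P x q \<partial>gauss I) = (\<Sum>i\<in>I. P p i * P q i)"
proof -
  show "integrable (gauss I) (\<lambda>x. lin I P x p)" "(\<integral>x. lin I P x p \<partial>gauss I) = 0"
    unfolding lin_def using gauss_mean[OF assms] by (auto simp: Bochner_Integration.integral_sum)
  have prod: "lin I P x p * lin I P x q = (\<Sum>i\<in>I. \<Sum>j\<in>I. (P p i * P q j) * (x i * x j))" for x
    unfolding lin_def sum_product by (simp add: algebra_simps)
  show "integrable (gauss I) (\<lambda>x. lin I P x p * lin I P x q)"
    unfolding prod using gauss_covariance(1)[OF assms]
    by (intro Bochner_Integration.integrable_sum integrable_mult_right) auto
  have "(\<integral>x. lin I P x p * lin I P x q \<partial>gauss I) = (\<Sum>i\<in>I. \<Sum>j\<in>I. (P p i * P q j) * (\<integral>x. x i * x j \<partial>gauss I))"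
    unfolding prod using gauss_covariance(1)[OF assms]
    by (subst Bochner_Integration.integral_sum, intro Bochner_Integration.integrable_sum integrable_mult_right, simp,
        intro sum.cong refl, subst Bochner_Integration.integral_sum) auto
  also have "\<dots> = (\<Sum>i\<in>I. \<Sum>j\<in>I. if i = j then P p i * P q j else 0)"
    by (intro sum.cong refl) (simp add: gauss_covariance(2)[OF assms])
  also have "\<dots> = (\<Sum>i\<in>I. P p i * P q i)"
    using assms by (intro sum.cong refl) simp
  finally show "(\<integral>x. lin I P x p * lin I P x q \<partial>gauss I) = (\<Sum>i\<in>I. P p i * P q i)" .
qed

lemma sum_le_prod_one_plus:
  fixes f :: "'i \<Rightarrow> real"
  assumes "finite I" "\<And>i. i \<in> I \<Longrightarrow> f i \<ge> 0"
  shows "sum f I \<le> (\<Prod>i\<in>I. 1 + f i)"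
proof -
  \<comment> \<open>The additional 1 strengthens the claim enough for the induction.\<close>
  have "1 + sum f I \<le> (\<Prod>i\<in>I. 1 + f i)"
    using assms
  proof (induction I)
    case (insert i I)
    have "1 + sum f (insert i I) \<le> (1 + f i) * (1 + sum f I)"
      using insert by (simp add: algebra_simps sum_nonneg)
    also have "\<dots> \<le> (1 + f i) * (\<Prod>i\<in>I. 1 + f i)"
      using insert by (intro mult_left_mono) auto
    finally show ?case using insert by simp
  qed simp
  then show ?thesis by simp
qed

lemma gauss_lin_cube_integrable:
  assumes "finite I" "finite N"
  shows "integrable (gauss I) (\<lambda>x. (\<Sum>p\<in>N. \<bar>lin I P x p\<bar>) ^ 3)"
proof -
  define B where "B = (\<Sum>p\<in>N. \<Sum>i\<in>I. \<bar>P p i\<bar>)"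
  have "B \<ge> 0" by (auto simp: B_def intro!: sum_nonneg)
  have bd: "(\<Sum>p\<in>N. \<bar>lin I P x p\<bar>) \<le> B * (\<Prod>i\<in>I. 1 + \<bar>x i\<bar>)" for x
  proof -
    have "(\<Sum>p\<in>N. \<bar>lin I P x p\<bar>) \<le> (\<Sum>p\<in>N. \<Sum>i\<in>I. \<bar>P p i\<bar> * \<bar>x i\<bar>)"
      unfolding lin_def by (intro sum_mono order_trans[OF sum_abs]) (simp add: abs_mult)
    also have "\<dots> \<le> (\<Sum>p\<in>N. \<Sum>i\<in>I. \<bar>P p i\<bar> * (\<Prod>i\<in>I. 1 + \<bar>x i\<bar>))"
    proof (intro sum_mono mult_left_mono)
      fix i assume "i \<in> I"
      then have "\<bar>x i\<bar> \<le> (\<Sum>i\<in>I. \<bar>x i\<bar>)" using assms by (intro member_le_sum) auto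
      also have "\<dots> \<le> (\<Prod>i\<in>I. 1 + \<bar>x i\<bar>)" using assms by (intro sum_le_prod_one_plus) auto
      finally show "\<bar>x i\<bar> \<le> (\<Prod>i\<in>I. 1 + \<bar>x i\<bar>)" .
    qed auto
    finally show ?thesis by (simp add: B_def sum_distrib_right)
  qed
  show ?thesis
  proof (rule Bochner_Integration.integrable_bound)
    show "integrable (gauss I) (\<lambda>x. B ^ 3 * (\<Prod>i\<in>I. 1 + \<bar>x i\<bar>) ^ 3)"
      by (intro integrable_mult_right gauss_integrable_prod_cube assms)
    show "(\<lambda>x. (\<Sum>p\<in>N. \<bar>lin I P x p\<bar>) ^ 3) \<in> borel_measurable (gauss I)" by measurable
    show "AE x in gauss I. norm ((\<Sum>p\<in>N. \<bar>lin I P x p\<bar>) ^ 3) \<le> norm (B ^ 3 * (\<Prod>i\<in>I. 1 + \<bar>x i\<bar>) ^ 3)"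
    proof (intro AE_I2)
      fix x :: "'a \<Rightarrow> real"
      have "(\<Sum>p\<in>N. \<bar>lin I P x p\<bar>) ^ 3 \<le> (B * (\<Prod>i\<in>I. 1 + \<bar>x i\<bar>)) ^ 3"
        by (intro power_mono bd sum_nonneg) auto
      moreover have "0 \<le> (\<Sum>p\<in>N. \<bar>lin I P x p\<bar>) ^ 3" by (intro zero_le_power sum_nonneg) auto
      ultimately show "norm ((\<Sum>p\<in>N. \<bar>lin I P x p\<bar>) ^ 3) \<le> norm (B ^ 3 * (\<Prod>i\<in>I. 1 + \<bar>x i\<bar>) ^ 3)"
        unfolding real_norm_def power_mult_distrib by linarith
    qed
  qed
qed

text \<open>Averaging kills the linear term, since the process is centred, and turns the quadratic
  one into a pairing of \<open>H\<close> with the covariance. The scale \<open>c\<close> comes out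
  as \<open>c\<^sup>2\<close> there and as \<open>c ^ 3\<close> in the remainder.\<close>

lemma gauss_jet2_estimate:
  assumes I: "finite I" and N: "finite N" and J: "jet2 N K f D H"
    and meas: "(\<lambda>u. f (\<lambda>p. z p + c * lin I P u p)) \<in> borel_measurable (gauss I)"
    and c: "c \<ge> 0"
  shows "\<bar>(\<integral>u. f (\<lambda>p. z p + c * lin I P u p) \<partial>gauss I) - f z
       - c\<^sup>2 * (\<Sum>p\<in>N. \<Sum>q\<in>N. H z p q * (\<Sum>i\<in>I. P p i * P q i))\<bar>
     \<le> c ^ 3 * (K * (\<integral>u. (\<Sum>p\<in>N. \<bar>lin I P u p\<bar>) ^ 3 \<partial>gauss I))"
proof -
  note lin = gauss_lin_moments[OF I]
  let ?f = "\<lambda>u. f (\<lambda>p. z p + c * lin I P u p)"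
  let ?L = "\<lambda>u. c * (\<Sum>p\<in>N. D z p * lin I P u p)"
  let ?Q = "\<lambda>u. c\<^sup>2 * (\<Sum>p\<in>N. \<Sum>q\<in>N. H z p q * (lin I P u p * lin I P u q))"
  let ?R = "\<lambda>u. c ^ 3 * (K * (\<Sum>p\<in>N. \<bar>lin I P u p\<bar>) ^ 3)"
  have fint: "integrable (gauss I) ?f"
    using J by (intro gauss.integrable_const_bound[where B = K] meas) (auto simp: jet2_def)
  have Lint: "integrable (gauss I) ?L"
    by (intro integrable_mult_right Bochner_Integration.integrable_sum lin(1))
  have "(\<integral>u. (\<Sum>p\<in>N. D z p * lin I P u p) \<partial>gauss I) = (\<Sum>p\<in>N. \<integral>u. D z p * lin I P u p \<partial>gauss I)"
    by (intro Bochner_Integration.integral_sum integrable_mult_right lin(1))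
  then have Lval: "(\<integral>u. ?L u \<partial>gauss I) = 0" by (simp add: lin(2))
  have Qint: "integrable (gauss I) ?Q"
    by (intro integrable_mult_right Bochner_Integration.integrable_sum lin(3))
  have Qval: "(\<integral>u. ?Q u \<partial>gauss I) = c\<^sup>2 * (\<Sum>p\<in>N. \<Sum>q\<in>N. H z p q * (\<Sum>i\<in>I. P p i * P q i))"
  proof -
    have "(\<integral>u. (\<Sum>p\<in>N. \<Sum>q\<in>N. H z p q * (lin I P u p * lin I P u q)) \<partial>gauss I)
      = (\<Sum>p\<in>N. \<integral>u. (\<Sum>q\<in>N. H z p q * (lin I P u p * lin I P u q)) \<partial>gauss I)"
      by (intro Bochner_Integration.integral_sum Bochner_Integration.integrable_sum integrable_mult_right lin(3))
    also have "\<dots> = (\<Sum>p\<in>N. \<Sum>q\<in>N. \<integral>u. H z p q * (lin I P u p * lin I P u q) \<partial>gauss I)"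
      by (intro sum.cong refl Bochner_Integration.integral_sum integrable_mult_right lin(3))
    finally show ?thesis by (simp add: lin(4))
  qed
  have Rint: "integrable (gauss I) ?R"
    by (intro integrable_mult_right gauss_lin_cube_integrable I N)
  have pt: "\<bar>?f u - f z - ?L u - ?Q u\<bar> \<le> ?R u" for u
  proof -
    have "\<bar>?f u - f z - (\<Sum>p\<in>N. D z p * (c * lin I P u p))
      - (\<Sum>p\<in>N. \<Sum>q\<in>N. H z p q * (c * lin I P u p) * (c * lin I P u q))\<bar> \<le> K * (\<Sum>p\<in>N. \<bar>c * lin I P u p\<bar>) ^ 3"
      by (rule jet2_remainder[OF J, of z "\<lambda>p. c * lin I P u p"])
    moreover have "(\<Sum>p\<in>N. D z p * (c * lin I P u p)) = ?L u"
      by (simp add: sum_distrib_left algebra_simps)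
    moreover have "(\<Sum>p\<in>N. \<Sum>q\<in>N. H z p q * (c * lin I P u p) * (c * lin I P u q)) = ?Q u"
      by (simp add: sum_distrib_left algebra_simps power2_eq_square)
    moreover have "K * (\<Sum>p\<in>N. \<bar>c * lin I P u p\<bar>) ^ 3 = ?R u"
      using c by (simp add: abs_mult sum_distrib_left[symmetric] power_mult_distrib)
    ultimately show ?thesis by simp
  qed
  let ?g = "\<lambda>u. ?f u - f z - ?L u - ?Q u"
  have gint: "integrable (gauss I) ?g"
    by (intro Bochner_Integration.integrable_diff fint Lint Qint) simp
  have "(\<integral>u. ?g u \<partial>gauss I) = (\<integral>u. ?f u \<partial>gauss I) - f z - 0 - c\<^sup>2 * (\<Sum>p\<in>N. \<Sum>q\<in>N. H z p q * (\<Sum>i\<in>I. P p i * P q i))"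
  proof -
    have "(\<integral>u. ?g u \<partial>gauss I) = (\<integral>u. ?f u - f z - ?L u \<partial>gauss I) - (\<integral>u. ?Q u \<partial>gauss I)"
      by (intro Bochner_Integration.integral_diff Bochner_Integration.integrable_diff fint Lint Qint) simp
    also have "(\<integral>u. ?f u - f z - ?L u \<partial>gauss I) = (\<integral>u. ?f u - f z \<partial>gauss I) - (\<integral>u. ?L u \<partial>gauss I)"
      by (intro Bochner_Integration.integral_diff Bochner_Integration.integrable_diff fint Lint) simp
    also have "(\<integral>u. ?f u - f z \<partial>gauss I) = (\<integral>u. ?f u \<partial>gauss I) - f z"
      by (subst Bochner_Integration.integral_diff[OF fint]) (simp_all add: gauss.prob_space)
    finally show ?thesis unfolding Lval Qval .
  qed
  moreover have "\<bar>\<integral>u. ?g u \<partial>gauss I\<bar> \<le> (\<integral>u. ?R u \<partial>gauss I)"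
    by (rule order_trans[OF integral_abs_bound integral_mono[OF integrable_abs[OF gint] Rint pt]])
  ultimately show ?thesis by simp
qed

section \<open>Gordon's inequality\<close>

text \<open>In law, variance \<open>s + r\<close> splits into independent parts \<open>s\<close> and
  \<open>r\<close>: the weights \<open>sqrt (s / (s + r))\<close> and
  \<open>sqrt (r / (s + r))\<close> have squares with sum 1. The offset \<open>z\<close> will hold
  the other process, frozen meanwhile.\<close>

lemma gauss_lin_stable:
  assumes I: "finite I" and sr: "s \<ge> 0" "r \<ge> 0"
  shows "(\<integral>x. smooth_event W V \<kappa> c (\<lambda>p. sqrt (s + r) * lin I P x p + z p) \<partial>gauss I)
    = (\<integral>x. \<integral>u. smooth_event W V \<kappa> c (\<lambda>p. sqrt s * lin I P x p + z p + sqrt r * lin I P u p) \<partial>gauss I \<partial>gauss I)"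
proof (cases "s + r = 0")
  case True
  then have "s = 0" "r = 0" using sr by auto
  then show ?thesis by (simp add: gauss.prob_space)
next
  case False
  define a b where "a = sqrt (s / (s + r))" and "b = sqrt (r / (s + r))"
  have ab: "a \<ge> 0" "b \<ge> 0" "a\<^sup>2 + b\<^sup>2 = 1"
    using sr False by (auto simp: a_def b_def add_divide_distrib[symmetric])
  have sab: "sqrt (s + r) * a = sqrt s" "sqrt (s + r) * b = sqrt r"
    using sr False by (auto simp: a_def b_def real_sqrt_divide)
  let ?F = "smooth_event W V \<kappa> c"
  let ?T = "\<lambda>(x, u). \<lambda>i\<in>I. a * x i + b * u i"
  let ?G = "\<lambda>x. ?F (\<lambda>p. sqrt (s + r) * lin I P x p + z p)"
  let ?G' = "\<lambda>(x, u). ?F (\<lambda>p. sqrt s * lin I P x p + z p + sqrt r * lin I P u p)"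
  have T: "?T \<in> measurable (gauss I \<Otimes>\<^sub>M gauss I) (gauss I)"
    unfolding measurable_cong_sets[OF refl sets_gauss] by measurable
  have G: "?G (?T p) = ?G' p" for p
  proof (cases p)
    case (Pair x u)
    have "lin I P (\<lambda>i\<in>I. a * x i + b * u i) q = a * lin I P x q + b * lin I P u q" for q
      unfolding lin_def by (simp add: sum_distrib_left sum.distrib[symmetric] algebra_simps)
    then have "sqrt (s + r) * lin I P (\<lambda>i\<in>I. a * x i + b * u i) q + z q
       = sqrt s * lin I P x q + z q + sqrt r * lin I P u q" for q
      using sab by (simp add: distrib_left mult.assoc[symmetric])
    then show ?thesis using Pair by (simp add: ac_simps)
  qed
  have "(\<integral>x. ?G x \<partial>gauss I) = (\<integral>x. ?G x \<partial>distr (gauss I \<Otimes>\<^sub>M gauss I) (gauss I) ?T)"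
    using gauss_stable[OF I ab] by simp
  also have "\<dots> = (\<integral>p. ?G (?T p) \<partial>(gauss I \<Otimes>\<^sub>M gauss I))"
    by (intro integral_distr T) measurable
  also have "\<dots> = (\<integral>p. ?G' p \<partial>(gauss I \<Otimes>\<^sub>M gauss I))" by (simp only: G)
  also have "\<dots> = (\<integral>x. \<integral>u. ?G' (x, u) \<partial>gauss I \<partial>gauss I)"
  proof (rule gauss_pair.integral_fst'[symmetric])
    show "integrable (gauss I \<Otimes>\<^sub>M gauss I) ?G'"
    proof (rule gauss_pair.integrable_const_bound[where B = 1])
      show "?G' \<in> borel_measurable (gauss I \<Otimes>\<^sub>M gauss I)" by measurable
    qed (auto simp: smooth_event_bounds)
  qed
  finally show ?thesis by simp
qed

lemma gordon_smooth:
  fixes P Q :: "'w \<times> 'v \<Rightarrow> 'i \<Rightarrow> real"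
  assumes I: "finite I" and W: "finite W" and V: "finite V" and \<kappa>: "\<kappa> \<ge> 1"
    and cov_row: "\<And>w v v'. w \<in> W \<Longrightarrow> v \<in> V \<Longrightarrow> v' \<in> V \<Longrightarrow>
      (\<Sum>i\<in>I. P (w, v) i * P (w, v') i) = (\<Sum>i\<in>I. Q (w, v) i * Q (w, v') i)"
    and cov_cross: "\<And>p q. p \<in> W \<times> V \<Longrightarrow> q \<in> W \<times> V \<Longrightarrow>
      (\<Sum>i\<in>I. P p i * P q i) \<ge> (\<Sum>i\<in>I. Q p i * Q q i)"
  shows "(\<integral>x. smooth_event W V \<kappa> c (lin I Q x) \<partial>gauss I) \<le> (\<integral>x. smooth_event W V \<kappa> c (lin I P x) \<partial>gauss I)"
proof -
  define N where "N = W \<times> V"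
  have N: "finite N" using W V by (simp add: N_def)
  define f where "f = smooth_event W V \<kappa> c"
  obtain K D H where J: "jet2 N K f D H" and H: "\<And>z p q. fst p \<noteq> fst q \<Longrightarrow> H z p q \<ge> 0"
    using jet2_smooth_event[OF N V W _ \<kappa>, of c] unfolding N_def f_def by blast
  have f01: "0 \<le> f x" "f x \<le> 1" for x unfolding f_def by (rule smooth_event_bounds)+
  define C where "C = K * (\<integral>u. (\<Sum>p\<in>N. \<bar>lin I P u p\<bar>) ^ 3 \<partial>gauss I) + K * (\<integral>u. (\<Sum>p\<in>N. \<bar>lin I Q u p\<bar>) ^ 3 \<partial>gauss I)"
  define \<Psi> where "\<Psi> R r z = (\<integral>u. f (\<lambda>p. z p + sqrt r * lin I R u p) \<partial>gauss I)" for R r z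
  let ?PP = "gauss I \<Otimes>\<^sub>M gauss I"
  define F where "F s t = (\<integral>(x, y). f (\<lambda>p. sqrt s * lin I P x p + sqrt t * lin I Q y p) \<partial>?PP)" for s t
  \<comment> \<open>The terms \<open>f z\<close> cancel, so the covariance difference contracted
    with \<open>H\<close> is left. It is nonnegative across rows, and inside a row, where the sign
    of \<open>H\<close> is unknown, the difference itself is 0.\<close>
  have local: "\<Psi> P r z - \<Psi> Q r z \<ge> - C * sqrt r ^ 3" if r: "r \<ge> 0" for r z
  proof -
    let ?S = "\<lambda>R. \<Sum>p\<in>N. \<Sum>q\<in>N. H z p q * (\<Sum>i\<in>I. R p i * R q i)"
    have est: "\<bar>\<Psi> R r z - f z - (sqrt r)\<^sup>2 * ?S R\<bar> \<le> sqrt r ^ 3 * (K * (\<integral>u. (\<Sum>p\<in>N. \<bar>lin I R u p\<bar>) ^ 3 \<partial>gauss I))" for R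
      unfolding \<Psi>_def
    proof (rule gauss_jet2_estimate[OF I N J])
      show "(\<lambda>u. f (\<lambda>p. z p + sqrt r * lin I R u p)) \<in> borel_measurable (gauss I)"
        unfolding f_def by measurable
    qed (use r in simp)
    have "?S P - ?S Q = (\<Sum>p\<in>N. \<Sum>q\<in>N. H z p q * ((\<Sum>i\<in>I. P p i * P q i) - (\<Sum>i\<in>I. Q p i * Q q i)))"
      by (simp add: sum_subtractf right_diff_distrib)
    also have "\<dots> \<ge> 0"
    proof (intro sum_nonneg)
      fix p q assume pq: "p \<in> N" "q \<in> N"
      show "0 \<le> H z p q * ((\<Sum>i\<in>I. P p i * P q i) - (\<Sum>i\<in>I. Q p i * Q q i))"
      proof (cases "fst p = fst q")
        case True
        then have "(\<Sum>i\<in>I. P p i * P q i) = (\<Sum>i\<in>I. Q p i * Q q i)"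
          using cov_row[of "fst p" "snd p" "snd q"] pq by (auto simp: N_def)
        then show ?thesis by simp
      next
        case False
        then show ?thesis using H cov_cross[of p q] pq by (auto simp: N_def)
      qed
    qed
    finally have "(sqrt r)\<^sup>2 * (?S P - ?S Q) \<ge> 0" by (intro mult_nonneg_nonneg) auto
    moreover have "C * sqrt r ^ 3 = sqrt r ^ 3 * (K * (\<integral>u. (\<Sum>p\<in>N. \<bar>lin I P u p\<bar>) ^ 3 \<partial>gauss I))
      + sqrt r ^ 3 * (K * (\<integral>u. (\<Sum>p\<in>N. \<bar>lin I Q u p\<bar>) ^ 3 \<partial>gauss I))"
      unfolding C_def by (simp add: algebra_simps)
    ultimately show ?thesis using est[of P] est[of Q] by (simp add: right_diff_distrib abs_le_iff)
  qed
  have intg: "integrable ?PP h" if "h \<in> borel_measurable ?PP" "\<And>x. \<bar>h x\<bar> \<le> 1"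
    for h :: "('i \<Rightarrow> real) \<times> ('i \<Rightarrow> real) \<Rightarrow> real"
    by (rule gauss_pair.integrable_const_bound[where B = 1]) (use that in auto)
  have \<Psi>01: "0 \<le> \<Psi> R r z" "\<Psi> R r z \<le> 1" for R r z
  proof -
    show "0 \<le> \<Psi> R r z" unfolding \<Psi>_def by (intro Bochner_Integration.integral_nonneg f01)
    have "\<Psi> R r z \<le> (\<integral>u. 1 \<partial>gauss I)" unfolding \<Psi>_def
    proof (intro integral_mono)
      show "integrable (gauss I) (\<lambda>u. f (\<lambda>p. z p + sqrt r * lin I R u p))"
      proof (rule gauss.integrable_const_bound[where B = 1])
        show "(\<lambda>u. f (\<lambda>p. z p + sqrt r * lin I R u p)) \<in> borel_measurable (gauss I)"
          unfolding f_def by measurable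
      qed (auto simp: f01)
    qed (auto simp: f01)
    then show "\<Psi> R r z \<le> 1" by (simp add: gauss.prob_space)
  qed
  have fint: "integrable ?PP (\<lambda>(x, y). f (\<lambda>p. sqrt s * lin I P x p + sqrt t * lin I Q y p))" for s t
  proof (rule intg)
    show "(\<lambda>(x, y). f (\<lambda>p. sqrt s * lin I P x p + sqrt t * lin I Q y p)) \<in> borel_measurable ?PP"
      unfolding f_def by measurable
  qed (auto simp: f01)
  have \<Psi>int: "integrable ?PP (\<lambda>(x, y). \<Psi> R r (\<lambda>p. sqrt s * lin I P x p + sqrt t * lin I Q y p))" for R r s t
  proof (rule intg)
    show "(\<lambda>(x, y). \<Psi> R r (\<lambda>p. sqrt s * lin I P x p + sqrt t * lin I Q y p)) \<in> borel_measurable ?PP"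
      unfolding f_def \<Psi>_def by measurable
  qed (auto simp: \<Psi>01)
  \<comment> \<open>Both sides share the base point \<open>?z\<close>, of variances \<open>s\<close>
    and \<open>t\<close>; they differ only in which process receives the increment
    \<open>r\<close>.\<close>
  have step: "F (s + r) t - F s (t + r) \<ge> - C * sqrt r ^ 3" if "s \<ge> 0" "t \<ge> 0" "r \<ge> 0" for s t r
  proof -
    let ?z = "\<lambda>x y p. sqrt s * lin I P x p + sqrt t * lin I Q y p"
    have "F (s + r) t = (\<integral>y. \<integral>x. f (\<lambda>p. sqrt (s + r) * lin I P x p + sqrt t * lin I Q y p) \<partial>gauss I \<partial>gauss I)"
      unfolding F_def using gauss_pair.integral_snd[OF fint] by simp
    also have "\<dots> = (\<integral>y. \<integral>x. \<Psi> P r (?z x y) \<partial>gauss I \<partial>gauss I)"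
      unfolding f_def \<Psi>_def gauss_lin_stable[OF I that(1,3)] ..
    also have "\<dots> = (\<integral>(x, y). \<Psi> P r (?z x y) \<partial>?PP)"
      using gauss_pair.integral_snd[OF \<Psi>int] by simp
    finally have 1: "F (s + r) t = (\<integral>(x, y). \<Psi> P r (?z x y) \<partial>?PP)" .
    \<comment> \<open>The order of integration is opposite to the previous computation, so that
      again the variable to be split is the inner one.\<close>
    have "F s (t + r) = (\<integral>x. \<integral>y. f (\<lambda>p. sqrt (t + r) * lin I Q y p + sqrt s * lin I P x p) \<partial>gauss I \<partial>gauss I)"
      unfolding F_def using gauss_pair.integral_fst[OF fint] by (simp add: add.commute)
    also have "\<dots> = (\<integral>x. \<integral>y. \<Psi> Q r (?z x y) \<partial>gauss I \<partial>gauss I)"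
      unfolding f_def \<Psi>_def gauss_lin_stable[OF I that(2,3)] by (simp add: add.commute)
    also have "\<dots> = (\<integral>(x, y). \<Psi> Q r (?z x y) \<partial>?PP)"
      using gauss_pair.integral_fst[OF \<Psi>int] by simp
    finally have "F (s + r) t - F s (t + r) = (\<integral>p. (case p of (x, y) \<Rightarrow> \<Psi> P r (?z x y)) - (case p of (x, y) \<Rightarrow> \<Psi> Q r (?z x y)) \<partial>?PP)"
      unfolding 1 by (simp only: Bochner_Integration.integral_diff[OF \<Psi>int \<Psi>int])
    moreover have "(\<integral>p. - C * sqrt r ^ 3 \<partial>?PP) \<le> \<dots>"
    proof (intro integral_mono Bochner_Integration.integrable_diff \<Psi>int)
      show "- C * sqrt r ^ 3 \<le> (case p of (x, y) \<Rightarrow> \<Psi> P r (?z x y)) - (case p of (x, y) \<Rightarrow> \<Psi> Q r (?z x y))" for p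
        using local[OF that(3)] by (cases p) simp
    qed simp
    ultimately show ?thesis by (simp add: gauss_pair.prob_space)
  qed
  have tele: "F 1 0 - F 0 1 \<ge> - C / sqrt (real n)" if n: "n > 0" for n :: nat
  proof -
    let ?a = "\<lambda>j. F (real j / real n) (1 - real j / real n)"
    have "?a (Suc j) - ?a j \<ge> - C * sqrt (1 / n) ^ 3" if "j < n" for j
    proof -
      have *: "1 - real (Suc j) / n \<ge> 0" using that n by simp
      have eq: "real j / n + 1 / n = real (Suc j) / n" "1 - real (Suc j) / n + 1 / n = 1 - real j / n"
        by (simp_all add: add_divide_distrib)
      have "F (real j / n + 1 / n) (1 - real (Suc j) / n) - F (real j / n) (1 - real (Suc j) / n + 1 / n)
          \<ge> - C * sqrt (1 / n) ^ 3"
        by (intro step *) auto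
      then show ?thesis unfolding eq .
    qed
    then have "(\<Sum>j<n. - C * sqrt (1 / n) ^ 3) \<le> (\<Sum>j<n. ?a (Suc j) - ?a j)"
      by (intro sum_mono) auto
    also have "\<dots> = F 1 0 - F 0 1" unfolding sum_lessThan_telescope[of ?a n] using n by simp
    also have "(\<Sum>j<n. - C * sqrt (1 / n) ^ 3) = - C / sqrt n"
      using n by (simp add: real_sqrt_divide power3_eq_cube field_simps)
    finally show ?thesis .
  qed
  have "(\<lambda>n. - C / sqrt (real n)) \<longlonglongrightarrow> 0"
    by (intro tendsto_divide_0[OF tendsto_const] filterlim_at_top_imp_at_infinity
        filterlim_compose[OF sqrt_at_top filterlim_real_sequentially])
  then have "0 \<le> F 1 0 - F 0 1"
    by (rule tendsto_upperbound[OF _ eventually_sequentiallyI[of 1, OF tele]]) simp_all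
  moreover have "F 1 0 = (\<integral>x. f (lin I P x) \<partial>gauss I)"
    unfolding F_def using gauss_pair.integral_fst[OF fint[of 1 0]] by (simp add: gauss.prob_space)
  moreover have "F 0 1 = (\<integral>x. f (lin I Q x) \<partial>gauss I)"
    unfolding F_def using gauss_pair.integral_snd[OF fint[of 0 1]] by (simp add: gauss.prob_space)
  ultimately show ?thesis by (simp add: f_def)
qed

text \<open>The function \<open>1 - smooth_event\<close> equals 1 on the event for \<open>P\<close>
  and 0 off the event for \<open>Q\<close>, so it separates the two indicators. The margin
  \<open>\<eta>\<close> is the width on which the step rises.\<close>

lemma gordon_prob:
  fixes P Q :: "'w \<times> 'v \<Rightarrow> 'i \<Rightarrow> real"
  assumes I: "finite I" and W: "finite W" and V: "finite V" and \<eta>: "\<eta> > 0"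
    and cov_row: "\<And>w v v'. w \<in> W \<Longrightarrow> v \<in> V \<Longrightarrow> v' \<in> V \<Longrightarrow>
      (\<Sum>i\<in>I. P (w, v) i * P (w, v') i) = (\<Sum>i\<in>I. Q (w, v) i * Q (w, v') i)"
    and cov_cross: "\<And>p q. p \<in> W \<times> V \<Longrightarrow> q \<in> W \<times> V \<Longrightarrow>
      (\<Sum>i\<in>I. P p i * P q i) \<ge> (\<Sum>i\<in>I. Q p i * Q q i)"
  shows "measure (gauss I) {x \<in> space (gauss I). \<exists>w\<in>W. \<forall>v\<in>V. lin I P x (w, v) \<le> c (w, v)}
    \<le> measure (gauss I) {x \<in> space (gauss I). \<exists>w\<in>W. \<forall>v\<in>V. lin I Q x (w, v) < c (w, v) + \<eta>}"
proof -
  \<comment> \<open>The step is complete at argument 3, hence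
    \<open>\<kappa> * \<eta> \<ge> 3\<close>; the maximum with 1 secures
    \<open>\<kappa> \<ge> 1\<close> for the second-order bounds.\<close>
  define \<kappa> where "\<kappa> = max 1 (3 / \<eta>)"
  have \<kappa>: "\<kappa> \<ge> 1" "\<kappa> * \<eta> \<ge> 3"
    using \<eta> by (auto simp: \<kappa>_def max_def field_simps)
  let ?f = "smooth_event W V \<kappa> c"
  let ?EP = "{x \<in> space (gauss I). \<exists>w\<in>W. \<forall>v\<in>V. lin I P x (w, v) \<le> c (w, v)}"
  let ?EQ = "{x \<in> space (gauss I). \<exists>w\<in>W. \<forall>v\<in>V. lin I Q x (w, v) < c (w, v) + \<eta>}"
  have EP: "?EP \<in> sets (gauss I)" using W V by measurable
  have EQ: "?EQ \<in> sets (gauss I)" using W V by measurable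
  have int: "integrable (gauss I) (\<lambda>x. ?f (lin I R x))" for R
  proof (rule gauss.integrable_const_bound[where B = 1])
    show "(\<lambda>x. ?f (lin I R x)) \<in> borel_measurable (gauss I)" by measurable
  qed (auto simp: smooth_event_bounds)
  have "measure (gauss I) ?EP = (\<integral>x. indicator ?EP x \<partial>gauss I)" using EP by simp
  also have "\<dots> \<le> (\<integral>x. 1 - ?f (lin I P x) \<partial>gauss I)"
  proof (intro integral_mono Bochner_Integration.integrable_diff int)
    fix x
    show "indicator ?EP x \<le> 1 - ?f (lin I P x)"
      using smooth_event_eq_0[OF W V, of \<kappa> _ "lin I P x" c] \<kappa> smooth_event_bounds(2)[of W V \<kappa> c "lin I P x"]
      by (auto simp: indicator_def)
  qed (use EP in \<open>auto simp: less_top[symmetric]\<close>)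
  also have "\<dots> = 1 - (\<integral>x. ?f (lin I P x) \<partial>gauss I)"
    using int by (simp add: gauss.prob_space)
  also have "\<dots> \<le> 1 - (\<integral>x. ?f (lin I Q x) \<partial>gauss I)"
    by (intro diff_left_mono gordon_smooth I W V \<kappa>(1) cov_row cov_cross)
  also have "\<dots> = (\<integral>x. 1 - ?f (lin I Q x) \<partial>gauss I)"
    using int by (simp add: gauss.prob_space)
  also have "\<dots> \<le> (\<integral>x. indicator ?EQ x \<partial>gauss I)"
  proof (intro integral_mono Bochner_Integration.integrable_diff int)
    fix x assume x: "x \<in> space (gauss I)"
    show "1 - ?f (lin I Q x) \<le> indicator ?EQ x"
    proof (cases "x \<in> ?EQ")
      case True
      then show ?thesis using smooth_event_bounds(1)[of W V \<kappa> c "lin I Q x"] by simp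
    next
      case False
      have "\<exists>v\<in>V. \<kappa> * (lin I Q x (w, v) - c (w, v)) \<ge> 3" if "w \<in> W" for w
      proof -
        have "\<not> (\<forall>v\<in>V. lin I Q x (w, v) < c (w, v) + \<eta>)" using False x that by blast
        then obtain v where v: "v \<in> V" "\<eta> \<le> lin I Q x (w, v) - c (w, v)" by (auto simp: not_less)
        have "\<kappa> * \<eta> \<le> \<kappa> * (lin I Q x (w, v) - c (w, v))"
          using v \<kappa> by (intro mult_left_mono) auto
        then show ?thesis using v(1) \<kappa>(2) order_trans by blast
      qed
      then show ?thesis using False smooth_event_eq_1[OF W V, of \<kappa> "lin I Q x" c] by simp
    qed
  qed (use EQ in \<open>auto simp: less_top[symmetric]\<close>)
  also have "\<dots> = measure (gauss I) ?EQ" using EQ by simp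
  finally show ?thesis .
qed

section \<open>The nonpositive orthant and the completion of the primary process\<close>

lemma std_normal_nonpos: "measure std_normal {..0} \<ge> 1 / 2"
proof -
  have d: "distributed std_normal lborel (\<lambda>x. x) (normal_density 0 1)"
    by (auto simp: distributed_def intro: distr_id2)
  have "distributed std_normal lborel (\<lambda>x. 0 + (-1) * x) (normal_density (0 + (-1) * 0) (\<bar>-1\<bar> * 1))"
    by (rule std_normal.normal_density_affine[OF d]) auto
  then have "distr std_normal lborel uminus = std_normal" by (simp add: distributed_def)
  then have "measure std_normal {..0} = measure (distr std_normal lborel uminus) {..0}" by simp
  also have "\<dots> = measure std_normal (uminus -` {..0} \<inter> space std_normal)"
    by (rule measure_distr) auto
  also have "uminus -` {..0} \<inter> space std_normal = {0::real..}" by auto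
  finally have "measure std_normal {..0} = measure std_normal {0..}" .
  \<comment> \<open>By symmetry both half-lines have the same mass; together they cover the line,
    overlapping in 0, which an inequality tolerates.\<close>
  moreover have "measure std_normal ({..0} \<union> {0..}) \<le> measure std_normal {..0} + measure std_normal {0..}"
    by (rule measure_Un_le) auto
  moreover have "{..0} \<union> {0..} = space std_normal" by auto
  ultimately show ?thesis using std_normal.prob_space by simp
qed

lemma gauss_nonpos:
  assumes "finite J"
  shows "measure (gauss J) {y \<in> space (gauss J). \<forall>j\<in>J. y j \<le> 0} \<ge> (1 / 2) ^ card J"
proof -
  have "{y \<in> space (gauss J). \<forall>j\<in>J. y j \<le> 0} = Pi\<^sub>E J (\<lambda>_. {..0})"
    by (auto simp: gauss_def space_PiM PiE_iff extensional_def)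
  then have "emeasure (gauss J) {y \<in> space (gauss J). \<forall>j\<in>J. y j \<le> 0} = (\<Prod>j\<in>J. emeasure std_normal {..0})"
    unfolding gauss_def using assms by (simp add: std_normals.emeasure_PiM)
  also have "\<dots> = ennreal (measure std_normal {..0} ^ card J)"
    by (simp add: std_normal.emeasure_eq_measure ennreal_power)
  finally have "measure (gauss J) {y \<in> space (gauss J). \<forall>j\<in>J. y j \<le> 0} = measure std_normal {..0} ^ card J"
    by (simp add: gauss.emeasure_eq_measure)
  also have "\<dots> \<ge> (1 / 2) ^ card J"
    using std_normal_nonpos by (intro power_mono) auto
  finally show ?thesis .
qed

lemma lin_merge:
  assumes "finite I" "finite J" "I \<inter> J = {}"
  shows "lin (I \<union> J) P (merge I J (x, y)) p = lin I P x p + lin J P y p"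
proof -
  have "(\<Sum>i\<in>I. P p i * merge I J (x, y) i) = (\<Sum>i\<in>I. P p i * x i)"
    by (intro sum.cong) (auto simp: merge_def)
  moreover have "(\<Sum>i\<in>J. P p i * merge I J (x, y) i) = (\<Sum>i\<in>J. P p i * y i)"
    using assms(3) by (intro sum.cong) (auto simp: merge_def)
  ultimately show ?thesis
    unfolding lin_def by (simp add: sum.union_disjoint[OF assms])
qed

text \<open>The primary process has to be completed by the terms \<open>s p j * y j\<close> with fresh Gaussians
  \<open>y j\<close> before Gordon's inequality applies. On the event that all \<open>y j\<close> are nonpositive, which has
  probability at least \<open>2 ^ - card J\<close>, the completion only decreases the process.\<close>
lemma gordon_signed:
  fixes P Q :: "'w \<times> 'v \<Rightarrow> 'i \<Rightarrow> real"
  assumes I: "finite I" and J: "finite J" "I \<inter> J = {}" and W: "finite W" and V: "finite V" and \<eta>: "\<eta> > 0"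
    and s: "\<And>p j. p \<in> W \<times> V \<Longrightarrow> j \<in> J \<Longrightarrow> s p j \<ge> 0"
    and cov_row: "\<And>w v v'. w \<in> W \<Longrightarrow> v \<in> V \<Longrightarrow> v' \<in> V \<Longrightarrow>
      (\<Sum>i\<in>I. P (w, v) i * P (w, v') i) + (\<Sum>j\<in>J. s (w, v) j * s (w, v') j) = (\<Sum>i\<in>I. Q (w, v) i * Q (w, v') i)"
    and cov_cross: "\<And>p q. p \<in> W \<times> V \<Longrightarrow> q \<in> W \<times> V \<Longrightarrow>
      (\<Sum>i\<in>I. P p i * P q i) + (\<Sum>j\<in>J. s p j * s q j) \<ge> (\<Sum>i\<in>I. Q p i * Q q i)"
  shows "measure (gauss I) {x \<in> space (gauss I). \<exists>w\<in>W. \<forall>v\<in>V. lin I P x (w, v) \<le> c (w, v)}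
    \<le> 2 ^ card J * measure (gauss I) {x \<in> space (gauss I). \<exists>w\<in>W. \<forall>v\<in>V. lin I Q x (w, v) < c (w, v) + \<eta>}"
proof -
  \<comment> \<open>Both processes are placed on the common index set \<open>I \<union> J\<close>:
    the primary one gains its completion on \<open>J\<close>, the auxiliary one ignores these
    coordinates.\<close>
  define P' where "P' p i = (if i \<in> J then s p i else P p i)" for p i
  define Q' where "Q' p i = (if i \<in> J then 0 else Q p i)" for p i
  let ?EP = "{x \<in> space (gauss I). \<exists>w\<in>W. \<forall>v\<in>V. lin I P x (w, v) \<le> c (w, v)}"
  let ?EQ = "{x \<in> space (gauss I). \<exists>w\<in>W. \<forall>v\<in>V. lin I Q x (w, v) < c (w, v) + \<eta>}"
  let ?EP' = "{x \<in> space (gauss (I \<union> J)). \<exists>w\<in>W. \<forall>v\<in>V. lin (I \<union> J) P' x (w, v) \<le> c (w, v)}"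
  let ?EQ' = "{x \<in> space (gauss (I \<union> J)). \<exists>w\<in>W. \<forall>v\<in>V. lin (I \<union> J) Q' x (w, v) < c (w, v) + \<eta>}"
  let ?N = "{y \<in> space (gauss J). \<forall>j\<in>J. y j \<le> 0}"
  let ?m = "merge I J"
  have comp: "(\<lambda>y. y j) \<in> borel_measurable (gauss J)" if "j \<in> J" for j
    unfolding measurable_cong_sets[OF sets_gauss refl] using that by (rule measurable_component_singleton)
  have EP: "?EP \<in> sets (gauss I)" and EQ: "?EQ \<in> sets (gauss I)"
    and EP': "?EP' \<in> sets (gauss (I \<union> J))" and EQ': "?EQ' \<in> sets (gauss (I \<union> J))" using W V by measurable
  have N: "?N \<in> sets (gauss J)" using J(1) comp by measurable
  have mm: "?m \<in> measurable (gauss I \<Otimes>\<^sub>M gauss J) (gauss (I \<union> J))"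
    unfolding gauss_def by (rule measurable_merge)
  have distr: "distr (gauss I \<Otimes>\<^sub>M gauss J) (gauss (I \<union> J)) ?m = gauss (I \<union> J)"
    unfolding gauss_def by (rule std_normals.distr_merge) (use I J in auto)
  have via: "measure (gauss (I \<union> J)) E = measure (gauss I \<Otimes>\<^sub>M gauss J) (?m -` E \<inter> space (gauss I \<Otimes>\<^sub>M gauss J))"
    if "E \<in> sets (gauss (I \<union> J))" for E
    using measure_distr[OF mm that] unfolding distr .
  have times: "measure (gauss I \<Otimes>\<^sub>M gauss J) (A \<times> B) = measure (gauss I) A * measure (gauss J) B"
    if "A \<in> sets (gauss I)" "B \<in> sets (gauss J)" for A B
    using gauss.emeasure_pair_measure_Times[OF that]
    by (simp add: gauss_pair.emeasure_eq_measure gauss.emeasure_eq_measure ennreal_mult[symmetric])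
  have linP: "lin (I \<union> J) P' (?m (x, y)) p = lin I P x p + lin J s y p" for x y p
  proof -
    have "lin I P' x p = lin I P x p" "lin J P' y p = lin J s y p"
      using J(2) by (auto simp: lin_def P'_def intro!: sum.cong)
    then show ?thesis using lin_merge[OF I J, of P' x y p] by simp
  qed
  have linQ: "lin (I \<union> J) Q' (?m (x, y)) p = lin I Q x p" for x y p
  proof -
    have "lin I Q' x p = lin I Q x p" "lin J Q' y p = 0"
      using J(2) by (auto simp: lin_def Q'_def intro!: sum.cong)
    then show ?thesis using lin_merge[OF I J, of Q' x y p] by simp
  qed
  have mspace: "?m z \<in> space (gauss (I \<union> J))" if "z \<in> space (gauss I \<Otimes>\<^sub>M gauss J)" for z
    using measurable_space[OF mm that] .
  have covP: "(\<Sum>i\<in>I \<union> J. P' p i * P' q i) = (\<Sum>i\<in>I. P p i * P q i) + (\<Sum>j\<in>J. s p j * s q j)" for p q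
  proof -
    have "(\<Sum>i\<in>I. P' p i * P' q i) = (\<Sum>i\<in>I. P p i * P q i)" "(\<Sum>i\<in>J. P' p i * P' q i) = (\<Sum>j\<in>J. s p j * s q j)"
      using J(2) by (auto simp: P'_def intro!: sum.cong)
    then show ?thesis by (simp add: sum.union_disjoint[OF I J])
  qed
  have covQ: "(\<Sum>i\<in>I \<union> J. Q' p i * Q' q i) = (\<Sum>i\<in>I. Q p i * Q q i)" for p q
  proof -
    have "(\<Sum>i\<in>I. Q' p i * Q' q i) = (\<Sum>i\<in>I. Q p i * Q q i)" "(\<Sum>i\<in>J. Q' p i * Q' q i) = 0"
      using J(2) by (auto simp: Q'_def intro!: sum.cong)
    then show ?thesis by (simp add: sum.union_disjoint[OF I J])
  qed
  \<comment> \<open>The event for \<open>P\<close> depends on \<open>x\<close> and the sign event on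
    \<open>y\<close>, which are independent. On their product the completed process lies below the
    uncompleted one.\<close>
  have "measure (gauss I) ?EP * (1 / 2) ^ card J \<le> measure (gauss I) ?EP * measure (gauss J) ?N"
    by (intro mult_left_mono gauss_nonpos J) auto
  also have "\<dots> = measure (gauss I \<Otimes>\<^sub>M gauss J) (?EP \<times> ?N)"
    using times[OF EP N] by simp
  also have "\<dots> \<le> measure (gauss I \<Otimes>\<^sub>M gauss J) (?m -` ?EP' \<inter> space (gauss I \<Otimes>\<^sub>M gauss J))"
  proof (intro gauss_pair.finite_measure_mono measurable_sets[OF mm] EP' subsetI)
    fix z assume "z \<in> ?EP \<times> ?N"
    then obtain x y where z: "z = (x, y)" and x: "x \<in> ?EP" and y: "y \<in> ?N" by blast
    from x y z have zs: "z \<in> space (gauss I \<Otimes>\<^sub>M gauss J)" by (simp add: space_pair_measure)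
    from x obtain w where w: "w \<in> W" "\<And>v. v \<in> V \<Longrightarrow> lin I P x (w, v) \<le> c (w, v)" by auto
    have "lin J s y (w, v) \<le> 0" if "v \<in> V" for v
      unfolding lin_def using y w that s by (intro sum_nonpos mult_nonneg_nonpos) auto
    with w have "\<forall>v\<in>V. lin (I \<union> J) P' (?m z) (w, v) \<le> c (w, v)"
      unfolding z linP by (fastforce intro: add_nonpos_nonpos)
    with w(1) zs mspace[OF zs] show "z \<in> ?m -` ?EP' \<inter> space (gauss I \<Otimes>\<^sub>M gauss J)" by auto
  qed
  also have "\<dots> = measure (gauss (I \<union> J)) ?EP'" using via[OF EP'] by simp
  also have "\<dots> \<le> measure (gauss (I \<union> J)) ?EQ'"
    using I J W V \<eta> cov_row cov_cross by (intro gordon_prob) (auto simp: covP covQ)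
  also have "\<dots> = measure (gauss I \<Otimes>\<^sub>M gauss J) (?m -` ?EQ' \<inter> space (gauss I \<Otimes>\<^sub>M gauss J))"
    using via[OF EQ'] .
  also have "\<dots> = measure (gauss I \<Otimes>\<^sub>M gauss J) (?EQ \<times> space (gauss J))"
  proof (rule arg_cong[where f = "measure _"], rule set_eqI)
    fix z :: "('i \<Rightarrow> real) \<times> ('i \<Rightarrow> real)"
    obtain x y where z: "z = (x, y)" by (cases z)
    show "z \<in> ?m -` ?EQ' \<inter> space (gauss I \<Otimes>\<^sub>M gauss J) \<longleftrightarrow> z \<in> ?EQ \<times> space (gauss J)"
      using mspace[of z] unfolding z by (auto simp: linQ space_pair_measure)
  qed
  also have "\<dots> = measure (gauss I) ?EQ"
    using times[OF EQ, of "space (gauss J)"] by (simp add: gauss.prob_space)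
  finally show ?thesis by (simp add: field_simps power_divide)
qed

section \<open>Compact index sets\<close>

lemma continuous_on_section:
  assumes F: "continuous_on (T \<times> V) (\<lambda>(w, v). F w v)" and w: "w \<in> T"
  shows "continuous_on V (F w)"
proof -
  have "continuous_on V (\<lambda>v. (w, v))" by (intro continuous_intros)
  moreover have "(\<lambda>v. (w, v)) ` V \<subseteq> T \<times> V" using w by auto
  ultimately show ?thesis using continuous_on_compose2[OF F, of V "\<lambda>v. (w, v)"] by simp
qed

text \<open>Compactness of \<open>V\<close> leaves the positive slack \<open>c - F w v0\<close> at a
  maximizer \<open>v0\<close>, and uniform continuity makes the radius independent of
  \<open>v\<close>.\<close>

lemma all_less_neighbourhood:
  fixes F :: "'w::metric_space \<Rightarrow> 'v::metric_space \<Rightarrow> real"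
  assumes T: "compact T" and V: "compact V" "V \<noteq> {}" and F: "continuous_on (T \<times> V) (\<lambda>(w, v). F w v)"
    and w: "w \<in> T" "\<And>v. v \<in> V \<Longrightarrow> F w v < c"
  obtains d where "d > 0" "\<And>w' v. w' \<in> T \<Longrightarrow> dist w' w < d \<Longrightarrow> v \<in> V \<Longrightarrow> F w' v < c"
proof -
  have "continuous_on V (\<lambda>v. F w v)"
    using continuous_on_section[OF F w(1)] .
  then obtain v0 where v0: "v0 \<in> V" "\<And>v. v \<in> V \<Longrightarrow> F w v \<le> F w v0"
    using continuous_attains_sup[OF V] by blast
  have "uniformly_continuous_on (T \<times> V) (\<lambda>(w, v). F w v)"
    by (intro compact_uniformly_continuous F compact_Times T V)
  moreover have "c - F w v0 > 0" using w v0 by simp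
  ultimately obtain d where d: "d > 0"
    "\<And>p q. p \<in> T \<times> V \<Longrightarrow> q \<in> T \<times> V \<Longrightarrow> dist q p < d \<Longrightarrow>
      dist (case q of (w, v) \<Rightarrow> F w v) (case p of (w, v) \<Rightarrow> F w v) < c - F w v0"
    unfolding uniformly_continuous_on_def by meson
  show thesis
  proof (rule that[OF d(1)])
    fix w' v assume w': "w' \<in> T" "dist w' w < d" and v: "v \<in> V"
    have "dist (F w' v) (F w v) < c - F w v0"
      using d(2)[of "(w, v)" "(w', v)"] w w' v by (simp add: dist_Pair_Pair)
    then show "F w' v < c" using v0(2)[OF v] by (simp add: dist_real_def)
  qed
qed

lemma all_le_closure:
  fixes f :: "'v::metric_space \<Rightarrow> real"
  assumes "continuous_on V f" "closure E = V" "\<And>v. v \<in> E \<Longrightarrow> f v \<le> c" "v \<in> V"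
  shows "f v \<le> c"
  using continuous_le_on_closure[of E f v c] assms by auto

lemma compact_separable:
  fixes S :: "'a::{metric_space, second_countable_topology} set"
  assumes "compact S"
  obtains D where "countable D" "closure D = S"
proof -
  obtain D where D: "countable D" "D \<subseteq> S" "S \<subseteq> closure D" by (rule separable)
  moreover have "closure D \<subseteq> S" using D(2) assms by (intro closure_minimal compact_imp_closed)
  ultimately show ?thesis using that by blast
qed

lemma ex_all_less_dense:
  fixes F :: "'w::metric_space \<Rightarrow> 'v::metric_space \<Rightarrow> real"
  assumes T: "compact T" and V: "compact V" "V \<noteq> {}" and F: "continuous_on (T \<times> V) (\<lambda>(w, v). F w v)"
    and D: "closure D = T"
  shows "(\<exists>w\<in>T. \<forall>v\<in>V. F w v < c) \<longleftrightarrow> (\<exists>w\<in>D. \<forall>v\<in>V. F w v < c)"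
proof
  assume "\<exists>w\<in>T. \<forall>v\<in>V. F w v < c"
  then obtain w where w: "w \<in> T" "\<And>v. v \<in> V \<Longrightarrow> F w v < c" by blast
  obtain d where d: "d > 0" "\<And>w' v. w' \<in> T \<Longrightarrow> dist w' w < d \<Longrightarrow> v \<in> V \<Longrightarrow> F w' v < c"
    using all_less_neighbourhood[OF T V F w] by blast
  have "w \<in> closure D" using w D by simp
  then obtain w' where "w' \<in> D" "dist w' w < d"
    using d(1) unfolding closure_approachable by blast
  then show "\<exists>w\<in>D. \<forall>v\<in>V. F w v < c" using d(2) D closure_subset by blast
qed (use D closure_subset in blast)

text \<open>Both quantifiers are reduced to countable dense sets. For the outer one strictness
  suffices, the condition being open in \<open>w\<close>. For the inner one it does not: a supremum
  over a dense set may equal \<open>c\<close> although every value there is smaller. Hence the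
  uniform margin \<open>1 / Suc j\<close>, available because the maximum over \<open>V\<close> is
  attained.\<close>

lemma ex_all_less_measurable:
  fixes F :: "'x \<Rightarrow> 'w::{metric_space, second_countable_topology} \<Rightarrow> 'v::{metric_space, second_countable_topology} \<Rightarrow> real"
  assumes T: "compact T" and V: "compact V" "V \<noteq> {}"
    and F: "\<And>x. continuous_on (T \<times> V) (\<lambda>(w, v). F x w v)"
    and meas: "\<And>w v. w \<in> T \<Longrightarrow> v \<in> V \<Longrightarrow> (\<lambda>x. F x w v) \<in> borel_measurable M"
  shows "{x \<in> space M. \<exists>w\<in>T. \<forall>v\<in>V. F x w v < c} \<in> sets M"
proof -
  obtain D where D: "countable D" "closure D = T" using compact_separable[OF T] .
  obtain E where E: "countable E" "closure E = V" using compact_separable[OF V(1)] .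
  have sub: "D \<subseteq> T" "E \<subseteq> V" using D E closure_subset by auto
  have eq: "(\<exists>w\<in>T. \<forall>v\<in>V. F x w v < c) \<longleftrightarrow> (\<exists>w\<in>D. \<exists>j::nat. \<forall>v\<in>E. F x w v \<le> c - 1 / Suc j)" for x
    unfolding ex_all_less_dense[OF T V F D(2)]
  proof (intro bex_cong refl iffI)
    fix w assume w: "w \<in> D"
    have cont: "continuous_on V (\<lambda>v. F x w v)"
      using continuous_on_section[OF F] w sub by blast
    show "\<forall>v\<in>V. F x w v < c" if "\<exists>j::nat. \<forall>v\<in>E. F x w v \<le> c - 1 / Suc j"
    proof
      fix v assume v: "v \<in> V"
      from that obtain j :: nat where "\<forall>v\<in>E. F x w v \<le> c - 1 / Suc j" by blast
      then have "F x w v \<le> c - 1 / Suc j" using all_le_closure[OF cont E(2) _ v] by blast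
      also have "\<dots> < c" by simp
      finally show "F x w v < c" .
    qed
    assume less: "\<forall>v\<in>V. F x w v < c"
    obtain v0 where v0: "v0 \<in> V" "\<And>v. v \<in> V \<Longrightarrow> F x w v \<le> F x w v0"
      using continuous_attains_sup[OF V cont] by blast
    obtain j :: nat where "1 / Suc j < c - F x w v0"
      using less v0 nat_approx_posE[of "c - F x w v0"] by auto
    then show "\<exists>j::nat. \<forall>v\<in>E. F x w v \<le> c - 1 / Suc j"
      using v0(2) sub by (intro exI[of _ j]) force
  qed
  have "{x \<in> space M. \<exists>w\<in>D. \<exists>j::nat. \<forall>v\<in>E. F x w v \<le> c - 1 / Suc j} \<in> sets M"
  proof (intro sets.sets_Collect_countable_Ex' sets.sets_Collect_countable_Ex sets.sets_Collect_countable_All' D(1) E(1))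
    fix w v and j :: nat assume "w \<in> D" "v \<in> E"
    then have "(\<lambda>x. F x w v) \<in> borel_measurable M" using sub meas by blast
    then show "{x \<in> space M. F x w v \<le> c - 1 / Suc j} \<in> sets M" by measurable
  qed
  then show ?thesis unfolding eq .
qed

text \<open>A larger \<open>E\<close> shrinks the events and a larger \<open>W\<close> enlarges
  them. So the limit over \<open>E\<close> is taken first, with \<open>W\<close> fixed, by
  continuity of the measure from above, and the limit over \<open>W\<close> afterwards by continuity
  from below.\<close>

lemma comparison_compact:
  fixes X Y :: "'x \<Rightarrow> 'w::{metric_space, second_countable_topology} \<Rightarrow> 'v::{metric_space, second_countable_topology} \<Rightarrow> real"
  assumes M: "prob_space M" and T: "compact T" "T \<noteq> {}" and V: "compact V" "V \<noteq> {}" and C: "C \<ge> 0"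
    and X: "\<And>x. continuous_on (T \<times> V) (\<lambda>(w, v). X x w v)"
      "\<And>w v. w \<in> T \<Longrightarrow> v \<in> V \<Longrightarrow> (\<lambda>x. X x w v) \<in> borel_measurable M"
    and Y: "\<And>x. continuous_on (T \<times> V) (\<lambda>(w, v). Y x w v)"
      "\<And>w v. w \<in> T \<Longrightarrow> v \<in> V \<Longrightarrow> (\<lambda>x. Y x w v) \<in> borel_measurable M"
    and comparison: "\<And>W E a b. finite W \<Longrightarrow> W \<subseteq> T \<Longrightarrow> finite E \<Longrightarrow> E \<subseteq> V \<Longrightarrow> a < b \<Longrightarrow>
      measure M {x \<in> space M. \<exists>w\<in>W. \<forall>v\<in>E. X x w v \<le> a} \<le> C * measure M {x \<in> space M. \<exists>w\<in>W. \<forall>v\<in>E. Y x w v < b}"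
    and c: "c < c'"
  shows "measure M {x \<in> space M. \<exists>w\<in>T. \<forall>v\<in>V. X x w v < c} \<le> C * measure M {x \<in> space M. \<exists>w\<in>T. \<forall>v\<in>V. Y x w v < c'}"
proof -
  interpret prob_space M by (rule M)
  \<comment> \<open>Values below \<open>b\<close> on a dense set give only \<open>\<le> b\<close> on
    \<open>V\<close>; the room between \<open>b\<close> and \<open>c'\<close> restores
    strictness.\<close>
  define b where "b = (c + c') / 2"
  have b: "c < b" "b < c'" using c by (auto simp: b_def)
  obtain D where D: "countable D" "closure D = T" using compact_separable[OF T(1)] .
  obtain E where E: "countable E" "closure E = V" using compact_separable[OF V(1)] .
  have sub: "D \<subseteq> T" "E \<subseteq> V" and ne: "D \<noteq> {}" "E \<noteq> {}" using D E T V closure_subset by auto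
  define Dm where "Dm m = from_nat_into D ` {..m}" for m :: nat
  define En where "En m = from_nat_into E ` {..m}" for m :: nat
  have Dm: "finite (Dm m)" "Dm m \<subseteq> T" "Dm m \<noteq> {}" and En: "finite (En m)" "En m \<subseteq> V" "En m \<noteq> {}" for m
    using sub from_nat_into[OF ne(1)] from_nat_into[OF ne(2)] by (auto simp: Dm_def En_def)
  have mono: "Dm m \<subseteq> Dm n" "En m \<subseteq> En n" if "m \<le> n" for m n
    using that by (auto simp: Dm_def En_def)
  have "range (from_nat_into D) = (\<Union>m. Dm m)" "range (from_nat_into E) = (\<Union>m. En m)"
    unfolding Dm_def En_def image_UN[symmetric] UN_atMost_UNIV by simp_all
  then have D_Un: "D = (\<Union>m. Dm m)" and E_Un: "E = (\<Union>m. En m)"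
    using range_from_nat_into[OF ne(1) D(1)] range_from_nat_into[OF ne(2) E(1)] by simp_all
  let ?X = "\<lambda>m. {x \<in> space M. \<exists>w\<in>Dm m. \<forall>v\<in>V. X x w v < c}"
  let ?YT = "{x \<in> space M. \<exists>w\<in>T. \<forall>v\<in>V. Y x w v < c'}"
  have YT: "?YT \<in> sets M" by (rule ex_all_less_measurable[OF T(1) V Y])
  have Xm: "?X m \<in> sets M" for m
  proof (intro ex_all_less_measurable V finite_imp_compact Dm)
    show "continuous_on (Dm m \<times> V) (\<lambda>(w, v). X x w v)" for x
      using Dm by (intro continuous_on_subset[OF X(1)]) auto
  qed (rule X(2)[OF subsetD[OF Dm(2)]])
  have bound: "prob (?X m) \<le> C * prob ?YT" for m
  proof -
    let ?Xn = "\<lambda>n. {x \<in> space M. \<exists>w\<in>Dm m. \<forall>v\<in>En n. X x w v \<le> c}"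
    let ?Yn = "\<lambda>n. {x \<in> space M. \<exists>w\<in>Dm m. \<forall>v\<in>En n. Y x w v < b}"
    have Yn: "?Yn n \<in> sets M" for n
    proof (intro sets.sets_Collect_countable_Ex' sets.sets_Collect_countable_All' countable_finite Dm(1) En(1))
      fix w v assume "w \<in> Dm m" "v \<in> En n"
      then have "(\<lambda>x. Y x w v) \<in> borel_measurable M" by (intro Y(2) subsetD[OF Dm(2)] subsetD[OF En(2)])
      then show "{x \<in> space M. Y x w v < b} \<in> sets M" by measurable
    qed
    have Xn: "?Xn n \<in> sets M" for n
    proof (intro sets.sets_Collect_countable_Ex' sets.sets_Collect_countable_All' countable_finite Dm(1) En(1))
      fix w v assume "w \<in> Dm m" "v \<in> En n"
      then have "(\<lambda>x. X x w v) \<in> borel_measurable M" by (intro X(2) subsetD[OF Dm(2)] subsetD[OF En(2)])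
      then show "{x \<in> space M. X x w v \<le> c} \<in> sets M" by measurable
    qed
    have le: "prob (?X m) \<le> C * prob (?Yn n)" for n
    proof -
      have "prob (?X m) \<le> prob (?Xn n)"
      proof (intro finite_measure_mono Xn subsetI)
        fix x assume "x \<in> ?X m"
        then obtain w where "w \<in> Dm m" "\<forall>v\<in>V. X x w v < c" "x \<in> space M" by blast
        moreover from this have "\<forall>v\<in>En n. X x w v \<le> c"
          using subsetD[OF En(2)] less_imp_le by metis
        ultimately show "x \<in> ?Xn n" by blast
      qed
      also have "\<dots> \<le> C * prob (?Yn n)" by (rule comparison[OF Dm(1,2) En(1,2) b(1)])
      finally show ?thesis .
    qed
    have "decseq ?Yn"
    proof (intro decseq_SucI subsetI)
      show "x \<in> ?Yn n" if "x \<in> ?Yn (Suc n)" for n x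
        using that mono(2)[of n "Suc n"] by auto
    qed
    then have "(\<lambda>n. C * prob (?Yn n)) \<longlonglongrightarrow> C * prob (\<Inter>n. ?Yn n)"
      using Yn by (intro tendsto_intros finite_Lim_measure_decseq) auto
    then have "prob (?X m) \<le> C * prob (\<Inter>n. ?Yn n)"
      by (rule LIMSEQ_le_const) (use le in blast)
    also have "\<dots> \<le> C * prob ?YT"
    proof (intro mult_left_mono C finite_measure_mono YT subsetI)
      fix x assume x: "x \<in> (\<Inter>n. ?Yn n)"
      \<comment> \<open>The witness \<open>w\<close> could depend on \<open>n\<close>. But
        \<open>Dm m\<close> is finite and the sets \<open>En n\<close> increase: if every
        \<open>w\<close> failed at some stage, all of them would fail at the largest of these
        stages.\<close>
      have "\<exists>w\<in>Dm m. \<forall>n. \<forall>v\<in>En n. Y x w v < b"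
      proof (rule ccontr)
        assume "\<not> ?thesis"
        then have "\<forall>w\<in>Dm m. \<exists>n. \<exists>v\<in>En n. \<not> Y x w v < b" by blast
        from bchoice[OF this] obtain n where n: "\<And>w. w \<in> Dm m \<Longrightarrow> \<exists>v\<in>En (n w). \<not> Y x w v < b" by blast
        define n' where "n' = Max (n ` Dm m)"
        have "n w \<le> n'" if "w \<in> Dm m" for w using that Dm by (auto simp: n'_def)
        then have "\<exists>v\<in>En n'. \<not> Y x w v < b" if "w \<in> Dm m" for w using n[OF that] mono(2) that by blast
        then show False using x by blast
      qed
      then obtain w where w: "w \<in> Dm m" "\<And>n v. v \<in> En n \<Longrightarrow> Y x w v < b" by blast
      have "continuous_on V (\<lambda>v. Y x w v)"
        using continuous_on_section[OF Y(1)] w(1) Dm by blast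
      then have "Y x w v \<le> b" if "v \<in> V" for v
        by (rule all_le_closure[OF _ E(2) _ that]) (use w(2) E_Un in \<open>auto intro: less_imp_le\<close>)
      then have "\<forall>v\<in>V. Y x w v < c'" using b(2) by (meson le_less_trans)
      then show "x \<in> ?YT" using x w(1) Dm(2) by blast
    qed
    finally show ?thesis .
  qed
  have "incseq ?X"
  proof (intro incseq_SucI subsetI)
    show "x \<in> ?X (Suc m)" if "x \<in> ?X m" for m x
      using that mono(1)[of m "Suc m"] by auto
  qed
  then have "(\<lambda>m. prob (?X m)) \<longlonglongrightarrow> prob (\<Union>m. ?X m)"
    using Xm by (intro finite_Lim_measure_incseq) auto
  then have "prob (\<Union>m. ?X m) \<le> C * prob ?YT"
    by (rule LIMSEQ_le_const2) (use bound in blast)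
  moreover have "(\<Union>m. ?X m) = {x \<in> space M. \<exists>w\<in>T. \<forall>v\<in>V. X x w v < c}"
  proof -
    have "(\<Union>m. ?X m) = {x \<in> space M. \<exists>w\<in>D. \<forall>v\<in>V. X x w v < c}"
      by (subst D_Un) auto
    also have "\<dots> = {x \<in> space M. \<exists>w\<in>T. \<forall>v\<in>V. X x w v < c}"
      using ex_all_less_dense[OF T(1) V X(1) D(2), of _ c] by (intro Collect_cong) simp
    finally show ?thesis .
  qed
  ultimately show ?thesis by simp
qed

section \<open>The minimax theorem\<close>

text \<open>A hyperplane separates the set below the pairs \<open>(f v, g v)\<close>, convex by
  concavity, from a quadrant; its normal, scaled to have sum 1, supplies the weights. The parameter
  \<open>mix\<close> abstracts the convex combination, so that only a topology is asked of the type
  of \<open>v\<close>.\<close>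

lemma two_point_minimax:
  fixes V :: "'v::topological_space set" and mix :: "real \<Rightarrow> 'v \<Rightarrow> 'v \<Rightarrow> 'v"
  assumes V: "compact V" and cont: "continuous_on V f" "continuous_on V g"
    and mix: "\<And>x y t. x \<in> V \<Longrightarrow> y \<in> V \<Longrightarrow> 0 \<le> t \<Longrightarrow> t \<le> 1 \<Longrightarrow> mix t x y \<in> V"
    and f: "\<And>x y t. x \<in> V \<Longrightarrow> y \<in> V \<Longrightarrow> 0 \<le> t \<Longrightarrow> t \<le> 1 \<Longrightarrow> f (mix t x y) \<ge> t * f x + (1 - t) * f y"
    and g: "\<And>x y t. x \<in> V \<Longrightarrow> y \<in> V \<Longrightarrow> 0 \<le> t \<Longrightarrow> t \<le> 1 \<Longrightarrow> g (mix t x y) \<ge> t * g x + (1 - t) * g y"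
    and less: "\<And>v. v \<in> V \<Longrightarrow> min (f v) (g v) < (c::real)"
  obtains t where "0 \<le> t" "t \<le> 1" "\<And>v. v \<in> V \<Longrightarrow> t * f v + (1 - t) * g v < c"
proof (cases "V = {}")
  case True
  then show ?thesis using that[of 0] by simp
next
  case False
  have "continuous_on V (\<lambda>v. min (f v) (g v))" using cont by (intro continuous_intros)
  then obtain v0 where v0: "v0 \<in> V" "\<And>v. v \<in> V \<Longrightarrow> min (f v) (g v) \<le> min (f v0) (g v0)"
    using continuous_attains_sup[OF V False] by blast
  \<comment> \<open>Strictly between the maximum of \<open>min (f v) (g v)\<close> and
    \<open>c\<close>: the first inequality keeps the quadrant \<open>?B\<close> away from
    \<open>?A\<close>, the second gives the strict conclusion.\<close>
  define m where "m = (min (f v0) (g v0) + c) / 2"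
  have m: "min (f v0) (g v0) < m" "m < c" using less[OF v0(1)] by (auto simp: m_def)
  let ?A = "{(x, y). \<exists>v\<in>V. x \<le> f v \<and> y \<le> g v}" and ?B = "{m..} \<times> {m..}"
  have "convex ?A"
  proof (rule convexI)
    fix p q and s t :: real
    assume pq: "p \<in> ?A" "q \<in> ?A" and st: "0 \<le> s" "0 \<le> t" "s + t = 1"
    obtain v v' where v: "v \<in> V" "fst p \<le> f v" "snd p \<le> g v" and v': "v' \<in> V" "fst q \<le> f v'" "snd q \<le> g v'"
      using pq by auto
    have t: "t = 1 - s" using st by simp
    have "s * fst p + t * fst q \<le> s * f v + t * f v'" "s * snd p + t * snd q \<le> s * g v + t * g v'"
      by (intro add_mono mult_left_mono; use v v' st in simp)+
    moreover have "s * f v + t * f v' \<le> f (mix s v v')" "s * g v + t * g v' \<le> g (mix s v v')"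
      unfolding t by (intro f g; use v v' st in simp)+
    ultimately have "s * fst p + t * fst q \<le> f (mix s v v')" "s * snd p + t * snd q \<le> g (mix s v v')" by linarith+
    moreover have "mix s v v' \<in> V" using mix[OF v(1) v'(1), of s] st by simp
    ultimately have "\<exists>v\<in>V. fst (s *\<^sub>R p + t *\<^sub>R q) \<le> f v \<and> snd (s *\<^sub>R p + t *\<^sub>R q) \<le> g v"
      by (intro bexI[of _ "mix s v v'"]) auto
    then show "s *\<^sub>R p + t *\<^sub>R q \<in> ?A" by (simp only: mem_Collect_eq case_prod_beta)
  qed
  moreover have "convex ?B" by (intro convex_Times) auto
  moreover have "?A \<noteq> {}" using v0(1) by blast
  moreover have "?B \<noteq> {}" by auto
  moreover have "?A \<inter> ?B = {}"
  proof -
    have False if "v \<in> V" "x \<le> f v" "y \<le> g v" "m \<le> x" "m \<le> y" for v x y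
      using v0(2)[OF that(1)] m(1) that by linarith
    then show ?thesis by blast
  qed
  ultimately have "\<exists>a \<beta>. a \<noteq> 0 \<and> (\<forall>p\<in>?A. a \<bullet> p \<le> \<beta>) \<and> (\<forall>p\<in>?B. \<beta> \<le> a \<bullet> p)"
    by (intro separating_hyperplane_sets)
  then obtain a \<beta> where a: "a \<noteq> 0" "\<And>p. p \<in> ?A \<Longrightarrow> a \<bullet> p \<le> \<beta>" "\<And>p. p \<in> ?B \<Longrightarrow> \<beta> \<le> a \<bullet> p"
    by blast
  obtain a1 a2 where a12: "a = (a1, a2)" by (cases a)
  have A: "a1 * x + a2 * y \<le> \<beta>" if "v \<in> V" "x \<le> f v" "y \<le> g v" for x y v
    using a(2)[of "(x, y)"] that a12 by auto
  have "\<beta> \<le> a1 * m + a2 * m" using a(3)[of "(m, m)"] a12 by simp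
  have nonneg: "a1 \<ge> 0" "a2 \<ge> 0"
  proof -
    have B: "\<beta> \<le> a1 * x + a2 * y" if "m \<le> x" "m \<le> y" for x y using a(3)[of "(x, y)"] that a12 by auto
    \<comment> \<open>If a coefficient of the normal were negative, moving from
      \<open>(m, m)\<close> by \<open>?r\<close> divided by it would stay in the quadrant and bring
      the linear form down to \<open>\<beta> - 1\<close>.\<close>
    let ?r = "\<beta> - a1 * m - a2 * m - 1"
    show "a1 \<ge> 0"
    proof (rule ccontr)
      assume "\<not> a1 \<ge> 0"
      moreover have "?r \<le> 0" using \<open>\<beta> \<le> a1 * m + a2 * m\<close> by simp
      ultimately have "?r / a1 \<ge> 0" "a1 * (?r / a1) = ?r" by (auto simp: divide_nonpos_neg)
      then show False using B[of "m + ?r / a1" m] by (simp add: distrib_left)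
    qed
    show "a2 \<ge> 0"
    proof (rule ccontr)
      assume "\<not> a2 \<ge> 0"
      moreover have "?r \<le> 0" using \<open>\<beta> \<le> a1 * m + a2 * m\<close> by simp
      ultimately have "?r / a2 \<ge> 0" "a2 * (?r / a2) = ?r" by (auto simp: divide_nonpos_neg)
      then show False using B[of m "m + ?r / a2"] by (simp add: distrib_left)
    qed
  qed
  moreover have "a1 \<noteq> 0 \<or> a2 \<noteq> 0" using a(1) a12 by (auto simp: zero_prod_def)
  ultimately have pos: "a1 + a2 > 0" by linarith
  define t where "t = a1 / (a1 + a2)"
  have t: "0 \<le> t" "t \<le> 1" "1 - t = a2 / (a1 + a2)"
    using nonneg pos by (auto simp: t_def field_simps)
  show ?thesis
  proof (rule that[OF t(1,2)])
    fix v assume "v \<in> V"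
    then have "a1 * f v + a2 * g v \<le> (a1 + a2) * m"
      using A[of v "f v" "g v"] \<open>\<beta> \<le> a1 * m + a2 * m\<close> by (simp add: distrib_right)
    then have "(a1 * f v + a2 * g v) / (a1 + a2) \<le> m"
      using pos by (simp add: pos_divide_le_eq mult.commute)
    moreover have "t * f v + (1 - t) * g v = (a1 * f v + a2 * g v) / (a1 + a2)"
      unfolding t(3) by (simp add: t_def add_divide_distrib)
    ultimately have "t * f v + (1 - t) * g v \<le> m" by simp
    then show "t * f v + (1 - t) * g v < c" using m by simp
  qed
qed

text \<open>The induction removes \<open>w0\<close> by shrinking \<open>V\<close> to the set where
  \<open>w0\<close> fails. This set is compact and, by concavity, closed under mixing, so a single
  \<open>w1\<close> handles it. Everywhere on \<open>V\<close> one of \<open>w0\<close>,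
  \<open>w1\<close> is then below \<open>c\<close>, and the two-point case merges them by convexity
  in \<open>w\<close>.\<close>

lemma finite_minimax:
  fixes V :: "'v::topological_space set" and mix :: "real \<Rightarrow> 'v \<Rightarrow> 'v \<Rightarrow> 'v" and S :: "'w::real_vector set"
  assumes W: "finite W" "W \<subseteq> S" and S: "convex S" "S \<noteq> {}" and V: "compact V"
    and cont: "\<And>w. w \<in> S \<Longrightarrow> continuous_on V (F w)"
    and mix: "\<And>x y t. x \<in> V \<Longrightarrow> y \<in> V \<Longrightarrow> 0 \<le> t \<Longrightarrow> t \<le> 1 \<Longrightarrow> mix t x y \<in> V"
    and conc: "\<And>w x y t. w \<in> S \<Longrightarrow> x \<in> V \<Longrightarrow> y \<in> V \<Longrightarrow> 0 \<le> t \<Longrightarrow> t \<le> 1 \<Longrightarrow>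
      F w (mix t x y) \<ge> t * F w x + (1 - t) * F w y"
    and conv: "\<And>v. v \<in> V \<Longrightarrow> convex_on S (\<lambda>w. F w v)"
    and less: "\<And>v. v \<in> V \<Longrightarrow> \<exists>w\<in>W. F w v < (c::real)"
  shows "\<exists>w\<in>S. \<forall>v\<in>V. F w v < c"
  using W V cont mix conc conv less
proof (induction W arbitrary: V rule: finite_induct)
  case empty
  then have "V = {}" by blast
  then show ?case using S(2) by auto
next
  case (insert w0 W)
  have w0: "w0 \<in> S" using insert.prems(1) by simp
  define V' where "V' = V \<inter> F w0 -` {c..}"
  have V': "V' \<subseteq> V" by (auto simp: V'_def)
  have "closedin (top_of_set V) V'"
    unfolding V'_def by (intro continuous_closedin_preimage insert.prems(3) w0) auto
  then have compact: "compact V'" using insert.prems(2) closedin_compact by blast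
  have mix': "mix t x y \<in> V'" if "x \<in> V'" "y \<in> V'" "0 \<le> t" "t \<le> 1" for x y t
  proof -
    have "c \<le> F w0 x" "c \<le> F w0 y" using that by (auto simp: V'_def)
    then have "t * c + (1 - t) * c \<le> t * F w0 x + (1 - t) * F w0 y"
      using that by (intro add_mono mult_left_mono) auto
    also have "\<dots> \<le> F w0 (mix t x y)" using that V' w0 by (intro insert.prems(5)) auto
    finally show ?thesis using insert.prems(4)[of x y t] that V' by (auto simp: V'_def algebra_simps)
  qed
  have "\<exists>w\<in>S. \<forall>v\<in>V'. F w v < c"
  proof (rule insert.IH[OF _ compact])
    show "continuous_on V' (F w)" if "w \<in> S" for w
      using insert.prems(3)[OF that] V' continuous_on_subset by blast
    show "\<exists>w\<in>W. F w v < c" if "v \<in> V'" for v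
      using insert.prems(7)[of v] that by (auto simp: V'_def)
    show "t * F w x + (1 - t) * F w y \<le> F w (mix t x y)"
      if "w \<in> S" "x \<in> V'" "y \<in> V'" "0 \<le> t" "t \<le> 1" for w x y t
      using that V' by (intro insert.prems(5)) auto
    show "W \<subseteq> S" using insert.prems(1) by simp
    show "convex_on S (\<lambda>w. F w v)" if "v \<in> V'" for v
      using that V' by (intro insert.prems(6)) auto
  qed (use mix' in simp)
  then obtain w1 where w1: "w1 \<in> S" "\<And>v. v \<in> V' \<Longrightarrow> F w1 v < c" by blast
  obtain t where t: "0 \<le> t" "t \<le> 1" "\<And>v. v \<in> V \<Longrightarrow> t * F w0 v + (1 - t) * F w1 v < c"
  proof (rule two_point_minimax[of V "F w0" "F w1" mix c])
    show "min (F w0 v) (F w1 v) < c" if "v \<in> V" for v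
      using w1(2)[of v] that by (cases "F w0 v < c") (auto simp: V'_def min_less_iff_disj)
    show "t * F w0 x + (1 - t) * F w0 y \<le> F w0 (mix t x y)" "t * F w1 x + (1 - t) * F w1 y \<le> F w1 (mix t x y)"
      if "x \<in> V" "y \<in> V" "0 \<le> t" "t \<le> 1" for x y t
      using that w0 w1 by (auto intro!: insert.prems(5))
    show "mix t x y \<in> V" if "x \<in> V" "y \<in> V" "0 \<le> t" "t \<le> 1" for x y t
      using that by (rule insert.prems(4))
  qed (use insert.prems(2) insert.prems(3)[OF w0] insert.prems(3)[OF w1(1)] in simp_all)
  define w where "w = t *\<^sub>R w0 + (1 - t) *\<^sub>R w1"
  have "w \<in> S" unfolding w_def using S(1) w0 w1 t by (auto intro: convexD)
  moreover have "F w v < c" if "v \<in> V" for v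
  proof -
    have "F w v \<le> t * F w0 v + (1 - t) * F w1 v"
      unfolding w_def using convex_onD[OF insert.prems(6)[OF that], of "1 - t" w0 w1] t w0 w1 by simp
    then show ?thesis using t(3)[OF that] by linarith
  qed
  ultimately show ?case by blast
qed

text \<open>The sets where a given \<open>w\<close> stays below \<open>c\<close> are open in
  \<open>V\<close> and cover it, so compactness reduces the choice of \<open>w\<close> to finitely
  many candidates.\<close>

lemma minimax:
  fixes V :: "'v::topological_space set" and mix :: "real \<Rightarrow> 'v \<Rightarrow> 'v \<Rightarrow> 'v" and S :: "'w::real_vector set"
  assumes S: "convex S" "S \<noteq> {}" and V: "compact V"
    and cont: "\<And>w. w \<in> S \<Longrightarrow> continuous_on V (F w)"
    and mix: "\<And>x y t. x \<in> V \<Longrightarrow> y \<in> V \<Longrightarrow> 0 \<le> t \<Longrightarrow> t \<le> 1 \<Longrightarrow> mix t x y \<in> V"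
    and conc: "\<And>w x y t. w \<in> S \<Longrightarrow> x \<in> V \<Longrightarrow> y \<in> V \<Longrightarrow> 0 \<le> t \<Longrightarrow> t \<le> 1 \<Longrightarrow>
      F w (mix t x y) \<ge> t * F w x + (1 - t) * F w y"
    and conv: "\<And>v. v \<in> V \<Longrightarrow> convex_on S (\<lambda>w. F w v)"
    and less: "\<And>v. v \<in> V \<Longrightarrow> \<exists>w\<in>S. F w v < (c::real)"
  shows "\<exists>w\<in>S. \<forall>v\<in>V. F w v < c"
proof -
  define U where "U w = V \<inter> F w -` {..<c}" for w
  have "openin (top_of_set V) (U w)" if "w \<in> S" for w
    unfolding U_def using that by (intro continuous_openin_preimage_gen cont) auto
  moreover have "V \<subseteq> \<Union> (U ` S)" using less by (auto simp: U_def)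
  ultimately obtain D where D: "D \<subseteq> U ` S" "finite D" "V \<subseteq> \<Union> D"
    using V[unfolded compact_eq_openin_cover, rule_format, of "U ` S"] by auto
  then obtain W where W: "W \<subseteq> S" "finite W" "D = U ` W" by (meson finite_subset_image)
  have less': "\<exists>w\<in>W. F w v < c" if "v \<in> V" for v
    using that D(3) W(3) by (auto simp: U_def)
  show ?thesis
  proof (rule finite_minimax[OF W(2,1) S V, where mix = mix])
    show "t * F w x + (1 - t) * F w y \<le> F w (mix t x y)"
      if "w \<in> S" "x \<in> V" "y \<in> V" "0 \<le> t" "t \<le> 1" for w x y t
      using that by (rule conc)
    show "mix t x y \<in> V" if "x \<in> V" "y \<in> V" "0 \<le> t" "t \<le> 1" for x y t
      using that by (rule mix)
    show "continuous_on V (F w)" if "w \<in> S" for w using that by (rule cont)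
    show "convex_on S (\<lambda>w. F w v)" if "v \<in> V" for v using that by (rule conv)
    show "\<exists>w\<in>W. F w v < c" if "v \<in> V" for v using that by (rule less')
  qed
qed

section \<open>Min-max values over compact sets\<close>

lemma continuous_on_lin:
  assumes "\<And>i. i \<in> I \<Longrightarrow> continuous_on S (\<lambda>p. P p i)"
  shows "continuous_on S (lin I P x)"
proof -
  have "continuous_on S (\<lambda>p. \<Sum>i\<in>I. P p i * x i)"
    by (intro continuous_on_sum continuous_on_mult assms continuous_on_const)
  then show ?thesis unfolding lin_def[abs_def] .
qed

lemma gordon_compact:
  fixes P Q :: "'w::{metric_space, second_countable_topology} \<times> 'v::{metric_space, second_countable_topology} \<Rightarrow> 'i \<Rightarrow> real"
  assumes I: "finite I" and J: "finite J" "I \<inter> J = {}"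
    and T: "compact T" "T \<noteq> {}" and V: "compact V" "V \<noteq> {}"
    and P: "\<And>i. i \<in> I \<Longrightarrow> continuous_on (T \<times> V) (\<lambda>p. P p i)"
    and Q: "\<And>i. i \<in> I \<Longrightarrow> continuous_on (T \<times> V) (\<lambda>p. Q p i)"
    and psi: "continuous_on (T \<times> V) \<psi>"
    and s: "\<And>p j. p \<in> T \<times> V \<Longrightarrow> j \<in> J \<Longrightarrow> s p j \<ge> 0"
    and cov_row: "\<And>w v v'. w \<in> T \<Longrightarrow> v \<in> V \<Longrightarrow> v' \<in> V \<Longrightarrow>
      (\<Sum>i\<in>I. P (w, v) i * P (w, v') i) + (\<Sum>j\<in>J. s (w, v) j * s (w, v') j) = (\<Sum>i\<in>I. Q (w, v) i * Q (w, v') i)"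
    and cov_cross: "\<And>p q. p \<in> T \<times> V \<Longrightarrow> q \<in> T \<times> V \<Longrightarrow>
      (\<Sum>i\<in>I. P p i * P q i) + (\<Sum>j\<in>J. s p j * s q j) \<ge> (\<Sum>i\<in>I. Q p i * Q q i)"
    and c: "c < c'"
  shows "measure (gauss I) {x \<in> space (gauss I). \<exists>w\<in>T. \<forall>v\<in>V. lin I P x (w, v) + \<psi> (w, v) < c}
    \<le> 2 ^ card J * measure (gauss I) {x \<in> space (gauss I). \<exists>w\<in>T. \<forall>v\<in>V. lin I Q x (w, v) + \<psi> (w, v) < c'}"
proof (rule comparison_compact[OF prob_space_gauss T V])
  have cont: "continuous_on (T \<times> V) (\<lambda>(w, v). lin I R x (w, v) + \<psi> (w, v))"
    if "\<And>i. i \<in> I \<Longrightarrow> continuous_on (T \<times> V) (\<lambda>p. R p i)" for R x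
    using continuous_on_add[OF continuous_on_lin[OF that] psi] by (simp add: case_prod_beta)
  show "continuous_on (T \<times> V) (\<lambda>(w, v). lin I P x (w, v) + \<psi> (w, v))" for x by (rule cont[OF P])
  show "continuous_on (T \<times> V) (\<lambda>(w, v). lin I Q x (w, v) + \<psi> (w, v))" for x by (rule cont[OF Q])
  show "(\<lambda>x. lin I P x (w, v) + \<psi> (w, v)) \<in> borel_measurable (gauss I)" for w v by measurable
  show "(\<lambda>x. lin I Q x (w, v) + \<psi> (w, v)) \<in> borel_measurable (gauss I)" for w v by measurable
  show "measure (gauss I) {x \<in> space (gauss I). \<exists>w\<in>W. \<forall>v\<in>E. lin I P x (w, v) + \<psi> (w, v) \<le> a}
    \<le> 2 ^ card J * measure (gauss I) {x \<in> space (gauss I). \<exists>w\<in>W. \<forall>v\<in>E. lin I Q x (w, v) + \<psi> (w, v) < b}"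
    if W: "finite W" "W \<subseteq> T" and E: "finite E" "E \<subseteq> V" and "a < b" for W E a b
  proof -
    have sub: "w \<in> W \<Longrightarrow> w \<in> T" "v \<in> E \<Longrightarrow> v \<in> V" "p \<in> W \<times> E \<Longrightarrow> p \<in> T \<times> V" for w v p using W E by auto
    \<comment> \<open>The deterministic term \<open>\<psi>\<close> moves into the threshold, which
      may vary with \<open>(w, v)\<close> in the finite comparison.\<close>
    have "measure (gauss I) {x \<in> space (gauss I). \<exists>w\<in>W. \<forall>v\<in>E. lin I P x (w, v) \<le> (\<lambda>p. a - \<psi> p) (w, v)}
      \<le> 2 ^ card J * measure (gauss I) {x \<in> space (gauss I). \<exists>w\<in>W. \<forall>v\<in>E. lin I Q x (w, v) < (\<lambda>p. a - \<psi> p) (w, v) + (b - a)}"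
    proof (rule gordon_signed[OF I J W(1) E(1)])
      show "0 < b - a" using \<open>a < b\<close> by simp
      show "s p j \<ge> 0" if "p \<in> W \<times> E" "j \<in> J" for p j using that by (intro s sub)
      show "(\<Sum>i\<in>I. P (w, v) i * P (w, v') i) + (\<Sum>j\<in>J. s (w, v) j * s (w, v') j) = (\<Sum>i\<in>I. Q (w, v) i * Q (w, v') i)"
        if "w \<in> W" "v \<in> E" "v' \<in> E" for w v v' using that by (intro cov_row sub)
      show "(\<Sum>i\<in>I. P p i * P q i) + (\<Sum>j\<in>J. s p j * s q j) \<ge> (\<Sum>i\<in>I. Q p i * Q q i)"
        if "p \<in> W \<times> E" "q \<in> W \<times> E" for p q using that by (intro cov_cross sub)
    qed
    then show ?thesis by (simp add: algebra_simps)
  qed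
qed (use c in auto)

lemma SUP_less_compact:
  fixes f :: "'v::topological_space \<Rightarrow> real"
  assumes "compact V" "V \<noteq> {}" "continuous_on V f"
  shows "(SUP v\<in>V. f v) < c \<longleftrightarrow> (\<forall>v\<in>V. f v < c)" and "bdd_above (f ` V)"
proof -
  obtain v0 where v0: "v0 \<in> V" "\<And>v. v \<in> V \<Longrightarrow> f v \<le> f v0"
    using continuous_attains_sup[OF assms] by blast
  then have "(SUP v\<in>V. f v) = f v0" by (intro cSup_eq_maximum) auto
  then show "(SUP v\<in>V. f v) < c \<longleftrightarrow> (\<forall>v\<in>V. f v < c)" using v0 by (auto intro: le_less_trans)
  show "bdd_above (f ` V)" by (rule bdd_aboveI2[of _ _ "f v0"]) (rule v0)
qed

lemma continuous_on_SUP_compact: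
  fixes F :: "'w::metric_space \<Rightarrow> 'v::metric_space \<Rightarrow> real"
  assumes T: "compact T" and V: "compact V" "V \<noteq> {}" and F: "continuous_on (T \<times> V) (\<lambda>(w, v). F w v)"
  shows "continuous_on T (\<lambda>w. SUP v\<in>V. F w v)"
  unfolding continuous_on_iff
proof (intro ballI allI impI)
  fix w and e :: real assume w: "w \<in> T" and e: "e > 0"
  have "uniformly_continuous_on (T \<times> V) (\<lambda>(w, v). F w v)"
    by (intro compact_uniformly_continuous F compact_Times T V)
  then obtain d where d: "d > 0"
    "\<And>p q. p \<in> T \<times> V \<Longrightarrow> q \<in> T \<times> V \<Longrightarrow> dist q p < d \<Longrightarrow>
      dist (case q of (w, v) \<Rightarrow> F w v) (case p of (w, v) \<Rightarrow> F w v) < e"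
    using e unfolding uniformly_continuous_on_def by meson
  note SUP = SUP_less_compact[OF V continuous_on_section[OF F]]
  show "\<exists>d>0. \<forall>w'\<in>T. dist w' w < d \<longrightarrow> dist (SUP v\<in>V. F w' v) (SUP v\<in>V. F w v) < e"
  proof (intro exI[of _ d] conjI d(1) ballI impI)
    fix w' assume w': "w' \<in> T" "dist w' w < d"
    have close: "\<bar>F w' v - F w v\<bar> < e" if "v \<in> V" for v
      using d(2)[of "(w, v)" "(w', v)"] w w' that by (simp add: dist_Pair_Pair dist_real_def)
    have upper: "F u v \<le> (SUP v\<in>V. F u v)" if "u \<in> T" "v \<in> V" for u v
      by (rule cSUP_upper[OF that(2) SUP(2)[OF that(1)]])
    have "(SUP v\<in>V. F w' v) < (SUP v\<in>V. F w v) + e"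
      unfolding SUP(1)[OF w'(1)]
    proof
      fix v assume "v \<in> V"
      from close[OF this] upper[OF w this] show "F w' v < (SUP v\<in>V. F w v) + e" by linarith
    qed
    moreover have "(SUP v\<in>V. F w v) < (SUP v\<in>V. F w' v) + e"
      unfolding SUP(1)[OF w]
    proof
      fix v assume "v \<in> V"
      from close[OF this] upper[OF w'(1) this] show "F w v < (SUP v\<in>V. F w' v) + e" by linarith
    qed
    ultimately show "dist (SUP v\<in>V. F w' v) (SUP v\<in>V. F w v) < e"
      by (simp add: dist_real_def abs_less_iff)
  qed
qed

lemma minmax_attained:
  fixes F :: "'w::metric_space \<Rightarrow> 'v::metric_space \<Rightarrow> real"
  assumes T: "compact T" "T \<noteq> {}" and V: "compact V" "V \<noteq> {}" and F: "continuous_on (T \<times> V) (\<lambda>(w, v). F w v)"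
  obtains w where "w \<in> T" "(SUP v\<in>V. F w v) = minmax T V F" "\<And>u. u \<in> T \<Longrightarrow> minmax T V F \<le> (SUP v\<in>V. F u v)"
proof -
  obtain w where w: "w \<in> T" "\<And>u. u \<in> T \<Longrightarrow> (SUP v\<in>V. F w v) \<le> (SUP v\<in>V. F u v)"
    using continuous_attains_inf[OF T continuous_on_SUP_compact[OF T(1) V F]] by blast
  moreover have "minmax T V F = (SUP v\<in>V. F w v)"
    unfolding minmax_def using w by (intro cInf_eq_minimum) auto
  ultimately show thesis by (intro that) auto
qed

lemma minmax_less_iff:
  fixes F :: "'w::metric_space \<Rightarrow> 'v::metric_space \<Rightarrow> real"
  assumes T: "compact T" "T \<noteq> {}" and V: "compact V" "V \<noteq> {}" and F: "continuous_on (T \<times> V) (\<lambda>(w, v). F w v)"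
  shows "minmax T V F < c \<longleftrightarrow> (\<exists>w\<in>T. \<forall>v\<in>V. F w v < c)"
proof -
  obtain w where w: "w \<in> T" "(SUP v\<in>V. F w v) = minmax T V F" "\<And>u. u \<in> T \<Longrightarrow> minmax T V F \<le> (SUP v\<in>V. F u v)"
    using minmax_attained[OF assms] by blast
  note SUP = SUP_less_compact(1)[OF V continuous_on_section[OF F]]
  show ?thesis
  proof
    assume "minmax T V F < c"
    then have "\<forall>v\<in>V. F w v < c" using SUP[OF w(1), of c] w(2) by simp
    then show "\<exists>w\<in>T. \<forall>v\<in>V. F w v < c" using w(1) by blast
  next
    assume "\<exists>w\<in>T. \<forall>v\<in>V. F w v < c"
    then obtain u where "u \<in> T" "(SUP v\<in>V. F u v) < c" using SUP by blast
    then show "minmax T V F < c" using w(3) le_less_trans by blast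
  qed
qed

text \<open>Both minima are attained, so a tie would produce a minimizer outside \<open>S\<close>.
  As a comparison of two values the event becomes measurable and accessible to one-sided
  bounds.\<close>

lemma minimizers_in_iff:
  fixes F :: "'w::metric_space \<Rightarrow> 'v::metric_space \<Rightarrow> real"
  assumes T: "compact T" "T \<noteq> {}" and V: "compact V" "V \<noteq> {}" and F: "continuous_on (T \<times> V) (\<lambda>(w, v). F w v)"
    and S: "compact (T - S)" "T - S \<noteq> {}"
  shows "(\<forall>w\<in>T. (SUP v\<in>V. F w v) = minmax T V F \<longrightarrow> w \<in> S) \<longleftrightarrow> minmax T V F < minmax (T - S) V F"
proof -
  have F': "continuous_on ((T - S) \<times> V) (\<lambda>(w, v). F w v)"
    by (rule continuous_on_subset[OF F]) auto
  obtain w where w: "w \<in> T" "(SUP v\<in>V. F w v) = minmax T V F" "\<And>u. u \<in> T \<Longrightarrow> minmax T V F \<le> (SUP v\<in>V. F u v)"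
    using minmax_attained[OF T V F] by blast
  obtain z where z: "z \<in> T - S" "(SUP v\<in>V. F z v) = minmax (T - S) V F"
      "\<And>u. u \<in> T - S \<Longrightarrow> minmax (T - S) V F \<le> (SUP v\<in>V. F u v)"
    using minmax_attained[OF S V F'] by blast
  show ?thesis
  proof
    assume "\<forall>w\<in>T. (SUP v\<in>V. F w v) = minmax T V F \<longrightarrow> w \<in> S"
    then have "minmax (T - S) V F \<noteq> minmax T V F" using z by auto
    then show "minmax T V F < minmax (T - S) V F" using w(3)[of z] z by auto
  next
    assume "minmax T V F < minmax (T - S) V F"
    then show "\<forall>w\<in>T. (SUP v\<in>V. F w v) = minmax T V F \<longrightarrow> w \<in> S" using z(3) by force
  qed
qed

text \<open>If \<open>B\<close> is not measurable, the bound holds since then \<open>measure M B = 0\<close>.\<close>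
lemma (in prob_space) measure_le_disjoint:
  assumes "A \<in> sets M" "A \<inter> B = {}"
  shows "measure M A \<le> 1 - measure M B"
proof (cases "B \<in> sets M")
  case True
  then have "measure M A + measure M B = measure M (A \<union> B)"
    using assms by (intro finite_measure_Union[symmetric])
  then show ?thesis using prob_le_1[of "A \<union> B"] by linarith
next
  case False
  then show ?thesis using prob_le_1[of A] by (simp add: measure_notin_sets)
qed

section \<open>Primary and auxiliary optimization\<close>

text \<open>Primary coefficients are supported on the \<open>Gent\<close> coordinates and auxiliary
  ones on \<open>gent\<close> and \<open>hent\<close>, so a single Gaussian vector can drive both
  processes.\<close>

definition primary_coeff where
  "primary_coeff n A a B b p \<iota> = (case \<iota> of Gent l i j \<Rightarrow> beta n B b l (snd p l) i * (alpha A a l (fst p) $ j)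
     | _ \<Rightarrow> 0)"

definition auxiliary_coeff where
  "auxiliary_coeff n A a B b p \<iota> = (case \<iota> of Gent l i j \<Rightarrow> 0
     | gent l j \<Rightarrow> fnorm (n l) (beta n B b l (snd p l)) * (alpha A a l (fst p) $ j)
     | hent l i \<Rightarrow> norm (alpha A a l (fst p)) * beta n B b l (snd p l) i)"

text \<open>Per block the primary variance is the squared product of the two norms and the auxiliary
  variance is twice that; the square of this coefficient is the missing amount.\<close>

definition completion_coeff :: "(nat \<Rightarrow> nat) \<Rightarrow> (nat \<Rightarrow> real^'d^'d) \<Rightarrow> (nat \<Rightarrow> real^'d)
    \<Rightarrow> (nat \<Rightarrow> nat \<Rightarrow> nat \<Rightarrow> real) \<Rightarrow> (nat \<Rightarrow> nat \<Rightarrow> real)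
    \<Rightarrow> (real^'d) \<times> (nat \<Rightarrow> nat \<Rightarrow> real) \<Rightarrow> 'd gidx \<Rightarrow> real" where
  "completion_coeff n A a B b p \<iota> = (case \<iota> of
     hent l i \<Rightarrow> fnorm (n l) (beta n B b l (snd p l)) * norm (alpha A a l (fst p)) | _ \<Rightarrow> 0)"

text \<open>The index \<open>hent l (n l)\<close> lies just outside \<open>gidx_set k n\<close>; it serves for the additional Gaussian
  attached to the \<open>l\<close>-th summand.\<close>
definition completion_set :: "nat \<Rightarrow> (nat \<Rightarrow> nat) \<Rightarrow> 'd gidx set" where
  "completion_set k n = (\<lambda>l. hent l (n l)) ` {..<k}"

lemma completion_set:
  "finite (completion_set k n)" "card (completion_set k n) = k" "gidx_set k n \<inter> completion_set k n = {}"
  unfolding completion_set_def gidx_set_def by (auto simp: card_image inj_on_def)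

lemma gidx_set_decomp:
  fixes k :: nat and n :: "nat \<Rightarrow> nat"
  shows "(gidx_set k n :: 'd gidx set) = (\<lambda>(l, i, j). Gent l i j) ` (SIGMA l:{..<k}. {..<n l} \<times> UNIV)
    \<union> (\<lambda>(l, j). gent l j) ` ({..<k} \<times> UNIV) \<union> (\<lambda>(l, i). hent l i) ` (SIGMA l:{..<k}. {..<n l})"
  unfolding gidx_set_def by (force simp: image_iff)

lemma finite_gidx_set: "finite (gidx_set k n :: 'd::finite gidx set)"
  unfolding gidx_set_decomp by auto

lemma sum_gidx_set:
  fixes f :: "'d::finite gidx \<Rightarrow> real"
  shows "(\<Sum>\<iota>\<in>gidx_set k n. f \<iota>) = (\<Sum>l<k. (\<Sum>i<n l. \<Sum>j\<in>UNIV. f (Gent l i j)) + (\<Sum>j\<in>UNIV. f (gent l j))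
     + (\<Sum>i<n l. f (hent l i)))"
proof -
  let ?A = "(\<lambda>(l, i, j). Gent l i j :: 'd gidx) ` (SIGMA l:{..<k}. {..<n l} \<times> UNIV)"
  let ?B = "(\<lambda>(l, j). gent l j :: 'd gidx) ` ({..<k} \<times> UNIV)"
  let ?C = "(\<lambda>(l, i). hent l i :: 'd gidx) ` (SIGMA l:{..<k}. {..<n l})"
  have "(\<Sum>\<iota>\<in>gidx_set k n. f \<iota>) = sum f ?A + sum f ?B + sum f ?C"
    unfolding gidx_set_decomp by (subst sum.union_disjoint; (subst sum.union_disjoint)?) auto
  moreover have "sum f ?A = (\<Sum>l<k. \<Sum>i<n l. \<Sum>j\<in>UNIV. f (Gent l i j))"
    by (subst sum.reindex) (auto simp: inj_on_def sum.Sigma sum.cartesian_product comp_def case_prod_beta)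
  moreover have "sum f ?B = (\<Sum>l<k. \<Sum>j\<in>UNIV. f (gent l j))"
    by (subst sum.reindex) (auto simp: inj_on_def sum.cartesian_product comp_def case_prod_beta)
  moreover have "sum f ?C = (\<Sum>l<k. \<Sum>i<n l. f (hent l i))"
    by (subst sum.reindex) (auto simp: inj_on_def sum.Sigma comp_def case_prod_beta)
  ultimately show ?thesis by (simp add: sum.distrib)
qed

lemma objP_eq_lin:
  "objP k n A a B b psi (G \<omega>) w v = lin (gidx_set k n) (primary_coeff n A a B b) (\<lambda>\<iota>. gentry G g h \<iota> \<omega>) (w, v) + psi w v"
  unfolding objP_def lin_def sum_gidx_set primary_coeff_def gentry_def
  by (simp add: inner_vec_def sum_distrib_left mult_ac)

lemma objA_eq_lin:
  "objA k n A a B b psi (g \<omega>) (h \<omega>) w v = lin (gidx_set k n) (auxiliary_coeff n A a B b) (\<lambda>\<iota>. gentry G g h \<iota> \<omega>) (w, v) + psi w v"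
  unfolding objA_def lin_def sum_gidx_set auxiliary_coeff_def gentry_def
  by (simp add: inner_vec_def sum_distrib_left mult_ac)

section \<open>Comparison of the covariances\<close>

lemma fnorm_nonneg: "0 \<le> fnorm m x"
  unfolding fnorm_def by (intro real_sqrt_ge_zero sum_nonneg) auto

lemma fnorm_square: "(\<Sum>i<m. x i * x i) = fnorm m x * fnorm m x"
  unfolding fnorm_def by (simp add: power2_eq_square sum_nonneg)

lemma fnorm_cauchy_schwarz: "(\<Sum>i<m. x i * y i) \<le> fnorm m x * fnorm m y"
proof -
  have "(\<Sum>i<m. x i * y i)\<^sup>2 \<le> (fnorm m x * fnorm m y)\<^sup>2"
    using Cauchy_Schwarz_ineq_sum[of x y "{..<m}"]
    unfolding fnorm_def power_mult_distrib by (simp add: sum_nonneg)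
  then show ?thesis by (rule power2_le_imp_le) (simp add: fnorm_nonneg)
qed

text \<open>Block by block, a product of two inner products plus a product of four norms minus the
  two mixed products factorizes.\<close>

lemma covariance_identity:
  fixes A :: "nat \<Rightarrow> real^'d^'d" and p q :: "(real^'d) \<times> (nat \<Rightarrow> nat \<Rightarrow> real)"
  shows "(\<Sum>\<iota>\<in>gidx_set k n. primary_coeff n A a B b p \<iota> * primary_coeff n A a B b q \<iota>)
      + (\<Sum>\<iota>\<in>completion_set k n. completion_coeff n A a B b p \<iota> * completion_coeff n A a B b q \<iota>)
      - (\<Sum>\<iota>\<in>gidx_set k n. auxiliary_coeff n A a B b p \<iota> * auxiliary_coeff n A a B b q \<iota>)
    = (\<Sum>l<k. (norm (alpha A a l (fst p)) * norm (alpha A a l (fst q)) - alpha A a l (fst p) \<bullet> alpha A a l (fst q))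
        * (fnorm (n l) (beta n B b l (snd p l)) * fnorm (n l) (beta n B b l (snd q l))
           - (\<Sum>i<n l. beta n B b l (snd p l) i * beta n B b l (snd q l) i)))"
proof -
  let ?\<alpha> = "\<lambda>p l. alpha A a l (fst p)" and ?\<beta> = "\<lambda>p l. beta n B b l (snd p l)"
  let ?N = "\<lambda>p l. fnorm (n l) (?\<beta> p l)"
  let ?aa = "\<lambda>l. ?\<alpha> p l \<bullet> ?\<alpha> q l" and ?bb = "\<lambda>l. \<Sum>i<n l. ?\<beta> p l i * ?\<beta> q l i"
  have "(\<Sum>\<iota>\<in>gidx_set k n. primary_coeff n A a B b p \<iota> * primary_coeff n A a B b q \<iota>) = (\<Sum>l<k. ?bb l * ?aa l)"
    unfolding sum_gidx_set primary_coeff_def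
    by (simp add: inner_vec_def sum_distrib_left sum_distrib_right mult_ac)
  moreover have "(\<Sum>\<iota>\<in>gidx_set k n. auxiliary_coeff n A a B b p \<iota> * auxiliary_coeff n A a B b q \<iota>)
     = (\<Sum>l<k. ?N p l * ?N q l * ?aa l + norm (?\<alpha> p l) * norm (?\<alpha> q l) * ?bb l)"
    unfolding sum_gidx_set auxiliary_coeff_def
    by (simp add: inner_vec_def sum_distrib_left mult_ac)
  moreover have "(\<Sum>\<iota>\<in>completion_set k n. completion_coeff n A a B b p \<iota> * completion_coeff n A a B b q \<iota>)
     = (\<Sum>l<k. (?N p l * norm (?\<alpha> p l)) * (?N q l * norm (?\<alpha> q l)))"
    unfolding completion_set_def by (subst sum.reindex) (auto simp: inj_on_def completion_coeff_def)
  ultimately show ?thesis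
    by (simp add: sum.distrib[symmetric] sum_subtractf[symmetric] algebra_simps)
qed

text \<open>Both factors of every block are nonnegative by Cauchy-Schwarz.\<close>

lemma covariance_ge:
  fixes A :: "nat \<Rightarrow> real^'d^'d"
  shows "(\<Sum>\<iota>\<in>gidx_set k n. primary_coeff n A a B b p \<iota> * primary_coeff n A a B b q \<iota>)
      + (\<Sum>\<iota>\<in>completion_set k n. completion_coeff n A a B b p \<iota> * completion_coeff n A a B b q \<iota>)
      \<ge> (\<Sum>\<iota>\<in>gidx_set k n. auxiliary_coeff n A a B b p \<iota> * auxiliary_coeff n A a B b q \<iota>)"
proof -
  have "0 \<le> (\<Sum>l<k. (norm (alpha A a l (fst p)) * norm (alpha A a l (fst q)) - alpha A a l (fst p) \<bullet> alpha A a l (fst q))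
        * (fnorm (n l) (beta n B b l (snd p l)) * fnorm (n l) (beta n B b l (snd q l))
           - (\<Sum>i<n l. beta n B b l (snd p l) i * beta n B b l (snd q l) i)))"
    by (intro sum_nonneg mult_nonneg_nonneg) (simp_all add: norm_cauchy_schwarz fnorm_cauchy_schwarz)
  then show ?thesis using covariance_identity[where p = p and q = q and A = A and a = a and B = B and b = b and n = n and k = k]
    by linarith
qed

text \<open>One factor of every block vanishes. The disjunction serves both orders of comparison:
  rows with common \<open>w\<close>, and rows with common \<open>v\<close> after the roles are
  exchanged.\<close>

lemma covariance_eq:
  fixes A :: "nat \<Rightarrow> real^'d^'d"
  assumes "fst p = fst q \<or> snd p = snd q"
  shows "(\<Sum>\<iota>\<in>gidx_set k n. primary_coeff n A a B b p \<iota> * primary_coeff n A a B b q \<iota>)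
      + (\<Sum>\<iota>\<in>completion_set k n. completion_coeff n A a B b p \<iota> * completion_coeff n A a B b q \<iota>)
      = (\<Sum>\<iota>\<in>gidx_set k n. auxiliary_coeff n A a B b p \<iota> * auxiliary_coeff n A a B b q \<iota>)"
proof -
  have "(\<Sum>l<k. (norm (alpha A a l (fst p)) * norm (alpha A a l (fst q)) - alpha A a l (fst p) \<bullet> alpha A a l (fst q))
        * (fnorm (n l) (beta n B b l (snd p l)) * fnorm (n l) (beta n B b l (snd q l))
           - (\<Sum>i<n l. beta n B b l (snd p l) i * beta n B b l (snd q l) i))) = 0"
    using assms by (intro sum.neutral) (auto simp: fnorm_square dot_square_norm power2_eq_square)
  then show ?thesis using covariance_identity[where p = p and q = q and A = A and a = a and B = B and b = b and n = n and k = k]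
    by linarith
qed

lemma completion_coeff_nonneg: "0 \<le> completion_coeff n A a B b p \<iota>"
  unfolding completion_coeff_def by (auto split: gidx.split intro!: mult_nonneg_nonneg fnorm_nonneg)

section \<open>Regularity of the objectives and of the product of the blocks\<close>

lemma continuous_on_alpha: "continuous_on S (\<lambda>p. alpha A a l (fst p))"
proof -
  have "continuous_on UNIV (\<lambda>w. A l *v w)" by (rule matrix_vector_mult_linear_continuous_on)
  then have "continuous_on S (\<lambda>p. A l *v fst p)"
    by (rule continuous_on_compose2) (auto intro!: continuous_intros)
  then show ?thesis unfolding alpha_def by (intro continuous_intros)
qed

lemma continuous_on_beta:
  fixes S :: "('a::topological_space \<times> (nat \<Rightarrow> nat \<Rightarrow> real)) set"
  shows "continuous_on S (\<lambda>p. beta n B b l (snd p l) i)"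
proof -
  have row: "continuous_on S (\<lambda>p. snd p l)"
    by (rule continuous_on_compose2[OF continuous_on_product_coordinates[of l] continuous_on_snd[OF continuous_on_id]]) simp
  have "continuous_on S (\<lambda>p. snd p l j)" for j
    by (rule continuous_on_compose2[OF continuous_on_product_coordinates[of j] row]) auto
  then show ?thesis unfolding beta_def by (cases "i < n l") (auto intro!: continuous_intros)
qed

lemma continuous_on_coeffs:
  fixes S :: "((real^'d) \<times> (nat \<Rightarrow> nat \<Rightarrow> real)) set"
  shows "continuous_on S (\<lambda>p. primary_coeff n A a B b p \<iota>)" "continuous_on S (\<lambda>p. auxiliary_coeff n A a B b p \<iota>)"
proof -
  have N: "continuous_on S (\<lambda>p. fnorm (n l) (beta n B b l (snd p l)))" for l
    unfolding fnorm_def by (intro continuous_intros continuous_on_beta)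
  show "continuous_on S (\<lambda>p. primary_coeff n A a B b p \<iota>)"
    unfolding primary_coeff_def
    by (cases \<iota>) (auto intro!: continuous_intros continuous_on_beta continuous_on_alpha)
  show "continuous_on S (\<lambda>p. auxiliary_coeff n A a B b p \<iota>)"
    unfolding auxiliary_coeff_def
    by (cases \<iota>) (auto intro!: continuous_intros continuous_on_beta continuous_on_alpha N)
qed

lemma alpha_affine:
  "alpha A a l ((1 - t) *\<^sub>R x + t *\<^sub>R y) = (1 - t) *\<^sub>R alpha A a l x + t *\<^sub>R alpha A a l y"
  unfolding alpha_def by (simp add: matrix_vector_right_distrib matrix_vector_mult_scaleR algebra_simps)

lemma beta_affine:
  "beta n B b l (\<lambda>i. t * x i + (1 - t) * y i) i = t * beta n B b l x i + (1 - t) * beta n B b l y i"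
  unfolding beta_def by (simp add: sum.distrib sum_subtractf sum_distrib_left algebra_simps)

lemma convex_on_objP:
  assumes "convex_on S (\<lambda>w. psi w v)"
  shows "convex_on S (\<lambda>w. objP k n A a B b psi G w v)"
proof (rule convex_onI)
  show "convex S" using assms by (rule convex_on_imp_convex)
  fix t :: real and x y :: "real^'a" assume t: "0 < t" "t < 1" and xy: "x \<in> S" "y \<in> S"
  have "psi ((1 - t) *\<^sub>R x + t *\<^sub>R y) v \<le> (1 - t) * psi x v + t * psi y v"
    using convex_onD[OF assms, of t x y] t xy by simp
  then show "objP k n A a B b psi G ((1 - t) *\<^sub>R x + t *\<^sub>R y) v \<le> (1 - t) * objP k n A a B b psi G x v + t * objP k n A a B b psi G y v"
    unfolding objP_def alpha_affine
    by (simp add: inner_add_right sum.distrib sum_subtractf sum_distrib_left algebra_simps)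
qed

lemma concave_objP:
  assumes "fconcave_on V (\<lambda>v. psi w v)" "x \<in> V" "y \<in> V" "0 \<le> t" "t \<le> 1"
  shows "t * objP k n A a B b psi G w x + (1 - t) * objP k n A a B b psi G w y
    \<le> objP k n A a B b psi G w (\<lambda>l i. t * x l i + (1 - t) * y l i)"
proof -
  have "t * psi w x + (1 - t) * psi w y \<le> psi w (\<lambda>l i. t * x l i + (1 - t) * y l i)"
    using assms unfolding fconcave_on_def by blast
  then show ?thesis
    unfolding objP_def beta_affine by (simp add: sum.distrib sum_subtractf sum_distrib_left algebra_simps)
qed

text \<open>The blocks from \<open>k\<close> on are frozen to singletons, so the set is a full
  product of compact sets and Tychonoff's theorem applies.\<close>

lemma blockprod_eq_PiE: "blockprod k Sv = Pi\<^sub>E UNIV (\<lambda>l. if l < k then Sv l else {\<lambda>_. 0})"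
  unfolding blockprod_def by (auto simp: PiE_iff split: if_splits)

lemma compact_blockprod:
  assumes "\<And>l. l < k \<Longrightarrow> compact (Sv l)"
  shows "compact (blockprod k Sv)"
proof -
  have "compactin (product_topology (\<lambda>_. euclidean) UNIV) (blockprod k Sv)"
    unfolding blockprod_eq_PiE compactin_PiE using assms by auto
  then show ?thesis by (simp add: euclidean_product_topology)
qed

lemma blockprod_nonempty:
  assumes "\<And>l. l < k \<Longrightarrow> Sv l \<noteq> {}"
  shows "blockprod k Sv \<noteq> {}"
  unfolding blockprod_eq_PiE PiE_eq_empty_iff using assms by auto

lemma blockprod_mix:
  assumes "\<And>l. l < k \<Longrightarrow> fconvex (Sv l)" "x \<in> blockprod k Sv" "y \<in> blockprod k Sv" "0 \<le> t" "t \<le> 1"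
  shows "(\<lambda>l i. t * x l i + (1 - t) * y l i) \<in> blockprod k Sv"
  using assms unfolding blockprod_def fconvex_def by auto

section \<open>Transfer to the standard Gaussian measure and conclusion\<close>

lemma (in prob_space) distr_gentry:
  assumes ne: "I \<noteq> {}" and indep: "indep_vars (\<lambda>_. borel) X I"
    and normal: "\<And>i. i \<in> I \<Longrightarrow> distributed M lborel (X i) std_normal_density"
  shows "(\<lambda>\<omega>. \<lambda>i\<in>I. X i \<omega>) \<in> measurable M (gauss I)" "distr M (gauss I) (\<lambda>\<omega>. \<lambda>i\<in>I. X i \<omega>) = gauss I"
proof -
  have rv: "X i \<in> borel_measurable M" if "i \<in> I" for i
    using distributed_measurable[OF normal[OF that]] by simp
  show "(\<lambda>\<omega>. \<lambda>i\<in>I. X i \<omega>) \<in> measurable M (gauss I)"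
    unfolding measurable_cong_sets[OF refl sets_gauss] by (intro measurable_restrict rv)
  have "distr M (gauss I) (\<lambda>\<omega>. \<lambda>i\<in>I. X i \<omega>) = distr M (Pi\<^sub>M I (\<lambda>_. borel)) (\<lambda>\<omega>. \<lambda>i\<in>I. X i \<omega>)"
    by (intro distr_cong refl sets_gauss)
  also have "\<dots> = Pi\<^sub>M I (\<lambda>i. distr M borel (X i))"
    using indep_vars_iff_distr_eq_PiM'[OF ne, where M' = "\<lambda>_. borel" and X = X] rv indep by simp
  also have "\<dots> = gauss I"
    unfolding gauss_def
  proof (intro PiM_cong refl)
    fix i assume "i \<in> I"
    then have "distr M lborel (X i) = std_normal" using normal by (simp add: distributed_def)
    moreover have "distr M borel (X i) = distr M lborel (X i)" by (intro distr_cong) auto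
    ultimately show "distr M borel (X i) = std_normal" by simp
  qed
  finally show "distr M (gauss I) (\<lambda>\<omega>. \<lambda>i\<in>I. X i \<omega>) = gauss I" .
qed

theorem theorem4p2:
  fixes k :: nat and n :: "nat \<Rightarrow> nat"
    and Sw :: "(real^'d) set" and Sv :: "nat \<Rightarrow> (nat \<Rightarrow> real) set"
    and psi :: "real^'d \<Rightarrow> (nat \<Rightarrow> nat \<Rightarrow> real) \<Rightarrow> real"
    and A :: "nat \<Rightarrow> real^'d^'d" and a :: "nat \<Rightarrow> real^'d"
    and B :: "nat \<Rightarrow> nat \<Rightarrow> nat \<Rightarrow> real" and b :: "nat \<Rightarrow> nat \<Rightarrow> real"
    and M :: "'w measure"
    and G :: "'w \<Rightarrow> nat \<Rightarrow> nat \<Rightarrow> real^'d" and g :: "'w \<Rightarrow> nat \<Rightarrow> real^'d"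
    and h :: "'w \<Rightarrow> nat \<Rightarrow> nat \<Rightarrow> real"
    and S :: "(real^'d) set"
    and \<epsilon> \<delta> phibar phibarc :: real
  assumes k: "k \<ge> 1"
    and Sw: "compact Sw" "convex Sw" "Sw \<noteq> {}"
    and Sv: "\<And>l. l < k \<Longrightarrow> Sv l \<subseteq> vecs (n l) \<and> compact (Sv l) \<and> fconvex (Sv l) \<and> Sv l \<noteq> {}"
    and psi_cont: "continuous_on (Sw \<times> blockprod k Sv) (\<lambda>(w, v). psi w v)"
    and psi_convex: "\<And>v. v \<in> blockprod k Sv \<Longrightarrow> convex_on Sw (\<lambda>w. psi w v)"
    and psi_concave: "\<And>w. w \<in> Sw \<Longrightarrow> fconcave_on (blockprod k Sv) (\<lambda>v. psi w v)"
    and M: "prob_space M"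
    and indep: "prob_space.indep_vars M (\<lambda>_. borel) (gentry G g h) (gidx_set k n)"
    and gauss: "\<And>\<iota>. \<iota> \<in> gidx_set k n \<Longrightarrow> distributed M lborel (gentry G g h \<iota>) std_normal_density"
    and S: "openin (top_of_set Sw) S"
    and eps: "\<epsilon> > 0" and delta: "\<delta> > 0"
    and gap: "phibarc \<ge> phibar + 3 * \<delta>"
    and hyp1: "measure M {\<omega> \<in> space M.
                 minmax Sw (blockprod k Sv) (objA k n A a B b psi (g \<omega>) (h \<omega>)) < phibar + \<delta>} \<ge> 1 - \<epsilon>"
    and hyp2: "measure M {\<omega> \<in> space M.
                 minmax (Sw - S) (blockprod k Sv) (objA k n A a B b psi (g \<omega>) (h \<omega>)) > phibarc - \<delta>} \<ge> 1 - \<epsilon>"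
  shows "measure M {\<omega> \<in> space M. \<forall>w\<in>Sw.
            (SUP v\<in>blockprod k Sv. objP k n A a B b psi (G \<omega>) w v)
              = minmax Sw (blockprod k Sv) (objP k n A a B b psi (G \<omega>)) \<longrightarrow> w \<in> S}
         \<ge> 1 - 2 ^ (k + 1) * \<epsilon>"
proof -
  interpret prob_space M by (rule M)
  define V where "V = blockprod k Sv"
  define I where "I = (gidx_set k n :: 'd gidx set)"
  define J where "J = (completion_set k n :: 'd gidx set)"
  define P where "P = primary_coeff n A a B b"
  define Q where "Q = auxiliary_coeff n A a B b"
  define R where "R = completion_coeff n A a B b"
  define Z where "Z \<omega> = (\<lambda>\<iota>\<in>I. gentry G g h \<iota> \<omega>)" for \<omega>
  define F where "F \<omega> = objP k n A a B b psi (G \<omega>)" for \<omega>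
  define E where "E \<omega> = objA k n A a B b psi (g \<omega>) (h \<omega>)" for \<omega>
  define T where "T = Sw - S"
  define \<psi> where "\<psi> = (\<lambda>(w, v). psi w v)"
  have V: "compact V" "V \<noteq> {}"
    unfolding V_def using Sv by (auto intro!: compact_blockprod blockprod_nonempty)
  have I: "finite I" and J: "finite J" "I \<inter> J = {}" and cardJ: "card J = k"
    unfolding I_def J_def by (simp_all add: finite_gidx_set completion_set)
  \<comment> \<open>Independence is expressed through a product law over a nonempty index set;
    \<open>k \<ge> 1\<close> provides an index.\<close>
  have "gent 0 undefined \<in> I" using k by (auto simp: I_def gidx_set_def)
  then have "I \<noteq> {}" by blast
  then have Z: "Z \<in> measurable M (gauss I)" "distr M (gauss I) Z = gauss I"
    unfolding Z_def[abs_def] using distr_gentry[of I "gentry G g h"] indep gauss by (simp_all add: I_def)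
  have prob_Z: "measure M {\<omega> \<in> space M. \<Theta> (Z \<omega>)} = measure (gauss I) {x \<in> space (gauss I). \<Theta> x}"
    and sets_Z: "{\<omega> \<in> space M. \<Theta> (Z \<omega>)} \<in> sets M"
    if "{x \<in> space (gauss I). \<Theta> x} \<in> sets (gauss I)" for \<Theta>
  proof -
    have "Z -` {x \<in> space (gauss I). \<Theta> x} \<inter> space M = {\<omega> \<in> space M. \<Theta> (Z \<omega>)}"
      using measurable_space[OF Z(1)] by auto
    then show "measure M {\<omega> \<in> space M. \<Theta> (Z \<omega>)} = measure (gauss I) {x \<in> space (gauss I). \<Theta> x}"
      and "{\<omega> \<in> space M. \<Theta> (Z \<omega>)} \<in> sets M"
      using measure_distr[OF Z(1) that] measurable_sets[OF Z(1) that] unfolding Z(2) by simp_all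
  qed
  have lin_Z: "lin I C (Z \<omega>) p = lin I C (\<lambda>\<iota>. gentry G g h \<iota> \<omega>) p" for C :: "(real^'d) \<times> (nat \<Rightarrow> nat \<Rightarrow> real) \<Rightarrow> 'd gidx \<Rightarrow> real" and \<omega> p
    unfolding lin_def Z_def by (intro sum.cong) auto
  have F: "F \<omega> w v = lin I P (Z \<omega>) (w, v) + \<psi> (w, v)" and E: "E \<omega> w v = lin I Q (Z \<omega>) (w, v) + \<psi> (w, v)" for \<omega> w v
    unfolding F_def E_def lin_Z unfolding I_def P_def Q_def \<psi>_def by (simp_all add: objP_eq_lin objA_eq_lin)
  have psi: "continuous_on (Sw \<times> V) \<psi>" unfolding \<psi>_def V_def by (rule psi_cont)
  have cont_coeff: "continuous_on X (\<lambda>p. P p \<iota>)" "continuous_on X (\<lambda>p. Q p \<iota>)" for X \<iota>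
    unfolding P_def Q_def by (rule continuous_on_coeffs)+
  have cont_lin: "continuous_on (U \<times> V) (\<lambda>(w, v). lin I C x (w, v) + \<psi> (w, v))"
    if "U \<subseteq> Sw" "C = P \<or> C = Q" for U C x
  proof -
    have "continuous_on (U \<times> V) (lin I C x)"
      using that(2) by (intro continuous_on_lin) (auto intro: cont_coeff)
    moreover have "continuous_on (U \<times> V) \<psi>" using that(1) by (intro continuous_on_subset[OF psi]) auto
    ultimately show ?thesis using continuous_on_add by (fastforce simp: case_prod_beta)
  qed
  have contF: "continuous_on (U \<times> V) (\<lambda>(w, v). F \<omega> w v)" if "U \<subseteq> Sw" for U \<omega>
    unfolding F using cont_lin[OF that] by simp
  have contE: "continuous_on (U \<times> V) (\<lambda>(w, v). E \<omega> w v)" if "U \<subseteq> Sw" for U \<omega>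
    unfolding E using cont_lin[OF that] by simp
  have T: "compact T" "T \<subseteq> Sw"
    using S Sw(1) closedin_compact[of Sw T] by (auto simp: T_def closedin_diff)
  have sets_event: "{x \<in> space (gauss I). \<exists>w\<in>U. \<forall>v\<in>V. lin I C x (w, v) + \<psi> (w, v) < c} \<in> sets (gauss I)"
    if "compact U" "U \<subseteq> Sw" "C = P \<or> C = Q" for U C c
    using that V by (intro ex_all_less_measurable cont_lin) auto
  \<comment> \<open>Exchange of roles: that the max-min over \<open>v\<close> and \<open>w\<close>
    exceeds a level says that some \<open>v\<close> keeps the negated objective below the negated
    level for all \<open>w\<close>. So the comparison is applied on \<open>V \<times> Sw\<close> to
    negated processes.\<close>
  have neg_cont: "continuous_on (V \<times> Sw) (\<lambda>p. - X (prod.swap p))"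
    if "continuous_on (Sw \<times> V) X" for X :: "(real^'d) \<times> (nat \<Rightarrow> nat \<Rightarrow> real) \<Rightarrow> real"
  proof -
    have "continuous_on (V \<times> Sw) (\<lambda>p. X (prod.swap p))"
      by (rule continuous_on_compose2[OF that continuous_on_swap]) auto
    then show ?thesis by (rule continuous_on_minus)
  qed
  have lin_neg: "lin I (\<lambda>p \<iota>. - C (prod.swap p) \<iota>) x (v, w) = - lin I C x (w, v)"
    for C :: "(real^'d) \<times> (nat \<Rightarrow> nat \<Rightarrow> real) \<Rightarrow> 'd gidx \<Rightarrow> real" and x v w
    unfolding lin_def by (simp add: sum_negf)
  have sets_neg: "{x \<in> space (gauss I). \<exists>v\<in>V. \<forall>w\<in>Sw. - (lin I C x (w, v) + \<psi> (w, v)) < c} \<in> sets (gauss I)"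
    if "C = P \<or> C = Q" for C c
  proof (intro ex_all_less_measurable V Sw(1,3))
    show "continuous_on (V \<times> Sw) (\<lambda>(v, w). - (lin I C x (w, v) + \<psi> (w, v)))" for x
      using neg_cont[OF cont_lin[OF order_refl that, of x]] by (simp add: case_prod_beta)
  qed measurable
  define c1 where "c1 = phibar + \<delta>"
  define c2 where "c2 = phibarc - \<delta>"
  \<comment> \<open>The two hypotheses use up one \<open>\<delta>\<close> each; the third one
    separates the thresholds.\<close>
  have c12: "c1 + \<delta> \<le> c2" using gap by (simp add: c1_def c2_def)
  \<comment> \<open>The bad events: the primary max-min over \<open>Sw\<close> exceeds
    \<open>c1 + \<delta> / 3\<close>, or the primary min-max over \<open>T\<close> falls below
    \<open>c2 - \<delta> / 3\<close>. The shifts provide the strict margin of the comparison and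
    leave \<open>\<delta> / 3\<close> between the two levels.\<close>
  let ?A1 = "{\<omega> \<in> space M. \<exists>v\<in>V. \<forall>w\<in>Sw. - F \<omega> w v < - (c1 + \<delta> / 3)}"
  let ?A2 = "{\<omega> \<in> space M. \<exists>w\<in>T. \<forall>v\<in>V. F \<omega> w v < c2 - \<delta> / 3}"
  have A1: "?A1 \<in> sets M" "prob ?A1 \<le> 2 ^ k * \<epsilon>"
  proof -
    let ?B = "{\<omega> \<in> space M. \<exists>v\<in>V. \<forall>w\<in>Sw. - E \<omega> w v < - c1}"
    show "?A1 \<in> sets M" unfolding F by (rule sets_Z[OF sets_neg]) simp
    have B: "?B \<in> sets M" unfolding E by (rule sets_Z[OF sets_neg]) simp
    have "prob ?A1 = measure (gauss I) {x \<in> space (gauss I). \<exists>v\<in>V. \<forall>w\<in>Sw. - (lin I P x (w, v) + \<psi> (w, v)) < - (c1 + \<delta> / 3)}"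
      unfolding F by (rule prob_Z[OF sets_neg]) simp
    also have "\<dots> \<le> 2 ^ card J * measure (gauss I) {x \<in> space (gauss I). \<exists>v\<in>V. \<forall>w\<in>Sw. - (lin I Q x (w, v) + \<psi> (w, v)) < - c1}"
    proof -
      have "measure (gauss I) {x \<in> space (gauss I). \<exists>v\<in>V. \<forall>w\<in>Sw.
          lin I (\<lambda>p \<iota>. - P (prod.swap p) \<iota>) x (v, w) + (\<lambda>p. - \<psi> (prod.swap p)) (v, w) < - (c1 + \<delta> / 3)}
        \<le> 2 ^ card J * measure (gauss I) {x \<in> space (gauss I). \<exists>v\<in>V. \<forall>w\<in>Sw.
          lin I (\<lambda>p \<iota>. - Q (prod.swap p) \<iota>) x (v, w) + (\<lambda>p. - \<psi> (prod.swap p)) (v, w) < - c1}"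
      \<comment> \<open>Negating the coefficients does not change the covariances. The completion
        keeps its nonnegative sign, as the one-sided argument demands.\<close>
      proof (rule gordon_compact[OF I J V Sw(1,3) neg_cont neg_cont neg_cont[OF psi],
            where s = "\<lambda>p. R (prod.swap p)"])
        show "continuous_on (Sw \<times> V) (\<lambda>p. P p \<iota>)" "continuous_on (Sw \<times> V) (\<lambda>p. Q p \<iota>)" for \<iota>
          by (rule cont_coeff)+
        show "0 \<le> R (prod.swap p) j" for p j unfolding R_def by (rule completion_coeff_nonneg)
        show "- (c1 + \<delta> / 3) < - c1" using delta by simp
        show "(\<Sum>i\<in>I. - P (prod.swap (v, w)) i * - P (prod.swap (v, w')) i)
          + (\<Sum>j\<in>J. R (prod.swap (v, w)) j * R (prod.swap (v, w')) j)
          = (\<Sum>i\<in>I. - Q (prod.swap (v, w)) i * - Q (prod.swap (v, w')) i)" for v w w'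
          using covariance_eq[of "(w, v)" "(w', v)"] unfolding P_def Q_def R_def I_def J_def by simp
        show "(\<Sum>i\<in>I. - Q (prod.swap p) i * - Q (prod.swap q) i)
          \<le> (\<Sum>i\<in>I. - P (prod.swap p) i * - P (prod.swap q) i) + (\<Sum>j\<in>J. R (prod.swap p) j * R (prod.swap q) j)" for p q
          using covariance_ge unfolding P_def Q_def R_def I_def J_def by simp
      qed
      then show ?thesis unfolding lin_neg by simp
    qed
    also have "\<dots> = 2 ^ k * prob ?B"
      unfolding E cardJ by (subst prob_Z[OF sets_neg]) simp_all
    also have "\<dots> \<le> 2 ^ k * \<epsilon>"
    proof (intro mult_left_mono)
      \<comment> \<open>Weak duality: a max-min above \<open>c1\<close> is incompatible with a
        min-max below \<open>c1\<close>.\<close>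
      have "?B \<inter> {\<omega> \<in> space M. minmax Sw V (E \<omega>) < c1} = {}"
      proof -
        have False if v: "v \<in> V" and less: "\<And>w. w \<in> Sw \<Longrightarrow> - E \<omega> w v < - c1" and minmax: "minmax Sw V (E \<omega>) < c1" for \<omega> v
        proof -
          obtain w where "w \<in> Sw" "E \<omega> w v < c1"
            using v minmax unfolding minmax_less_iff[OF Sw(1,3) V contE[OF order_refl]] by blast
          then show False using less[of w] by simp
        qed
        then show ?thesis by blast
      qed
      then have "prob ?B \<le> 1 - prob {\<omega> \<in> space M. minmax Sw V (E \<omega>) < c1}"
        by (rule measure_le_disjoint[OF B])
      then show "prob ?B \<le> \<epsilon>" using hyp1 unfolding c1_def V_def E_def by linarith
    qed simp
    finally show "prob ?A1 \<le> 2 ^ k * \<epsilon>" .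
  qed
  show ?thesis
  \<comment> \<open>Without points outside \<open>S\<close> the claim is immediate, whereas a
    min-max over the empty set would carry no information.\<close>
  proof (cases "T = {}")
    case True
    then have "{\<omega> \<in> space M. \<forall>w\<in>Sw. (SUP v\<in>blockprod k Sv. objP k n A a B b psi (G \<omega>) w v)
        = minmax Sw (blockprod k Sv) (objP k n A a B b psi (G \<omega>)) \<longrightarrow> w \<in> S} = space M"
      unfolding T_def by blast
    then show ?thesis using eps by (simp add: prob_space)
  next
    case False
    let ?W = "{\<omega> \<in> space M. \<forall>w\<in>Sw. (SUP v\<in>V. F \<omega> w v) = minmax Sw V (F \<omega>) \<longrightarrow> w \<in> S}"
    have A2: "?A2 \<in> sets M" "prob ?A2 \<le> 2 ^ k * \<epsilon>"
    proof -
      let ?B = "{\<omega> \<in> space M. \<exists>w\<in>T. \<forall>v\<in>V. E \<omega> w v < c2}"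
      show "?A2 \<in> sets M" unfolding F by (rule sets_Z[OF sets_event[OF T]]) simp
      have B: "?B \<in> sets M" unfolding E by (rule sets_Z[OF sets_event[OF T]]) simp
      have "prob ?A2 = measure (gauss I) {x \<in> space (gauss I). \<exists>w\<in>T. \<forall>v\<in>V. lin I P x (w, v) + \<psi> (w, v) < c2 - \<delta> / 3}"
        unfolding F by (rule prob_Z[OF sets_event[OF T]]) simp
      also have "\<dots> \<le> 2 ^ card J * measure (gauss I) {x \<in> space (gauss I). \<exists>w\<in>T. \<forall>v\<in>V. lin I Q x (w, v) + \<psi> (w, v) < c2}"
      proof (rule gordon_compact[OF I J T(1) False V cont_coeff(1) cont_coeff(2), where s = R])
        show "continuous_on (T \<times> V) \<psi>" using T(2) by (intro continuous_on_subset[OF psi]) auto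
        show "0 \<le> R p j" for p j unfolding R_def by (rule completion_coeff_nonneg)
        show "c2 - \<delta> / 3 < c2" using delta by simp
        show "(\<Sum>i\<in>I. P (w, v) i * P (w, v') i) + (\<Sum>j\<in>J. R (w, v) j * R (w, v') j)
          = (\<Sum>i\<in>I. Q (w, v) i * Q (w, v') i)" for w v v'
          using covariance_eq[of "(w, v)" "(w, v')"] unfolding P_def Q_def R_def I_def J_def by simp
        show "(\<Sum>i\<in>I. Q p i * Q q i) \<le> (\<Sum>i\<in>I. P p i * P q i) + (\<Sum>j\<in>J. R p j * R q j)" for p q
          unfolding P_def Q_def R_def I_def J_def by (rule covariance_ge)
      qed
      also have "\<dots> = 2 ^ k * prob ?B"
        unfolding E cardJ by (subst prob_Z[OF sets_event[OF T]]) simp_all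
      also have "\<dots> \<le> 2 ^ k * \<epsilon>"
      proof (intro mult_left_mono)
        have "?B \<inter> {\<omega> \<in> space M. minmax T V (E \<omega>) > c2} = {}"
          unfolding minmax_less_iff[OF T(1) False V contE[OF T(2)], symmetric] by auto
        then have "prob ?B \<le> 1 - prob {\<omega> \<in> space M. minmax T V (E \<omega>) > c2}"
          by (rule measure_le_disjoint[OF B])
        then show "prob ?B \<le> \<epsilon>" using hyp2 unfolding c2_def V_def E_def T_def by linarith
      qed simp
      finally show "prob ?A2 \<le> 2 ^ k * \<epsilon>" .
    qed
    have W_iff: "(\<forall>w\<in>Sw. (SUP v\<in>V. F \<omega> w v) = minmax Sw V (F \<omega>) \<longrightarrow> w \<in> S) \<longleftrightarrow> minmax Sw V (F \<omega>) < minmax T V (F \<omega>)" for \<omega>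
      unfolding T_def using T(1) False
      by (intro minimizers_in_iff Sw V contF) (auto simp: T_def)
    have meas_minmax: "(\<lambda>\<omega>. minmax U V (F \<omega>)) \<in> borel_measurable M" if U: "compact U" "U \<noteq> {}" "U \<subseteq> Sw" for U
    proof (subst borel_measurable_iff_less, intro allI)
      fix c
      show "{\<omega> \<in> space M. minmax U V (F \<omega>) < c} \<in> sets M"
        unfolding minmax_less_iff[OF U(1,2) V contF[OF U(3)]] unfolding F
        by (rule sets_Z[OF sets_event[OF U(1,3)]]) simp
    qed
    \<comment> \<open>Measurability matters for a lower bound: \<open>measure\<close> assigns 0 to a
      set that is not measurable.\<close>
    have W: "?W \<in> sets M"
      unfolding W_iff using meas_minmax[OF Sw(1,3) order_refl] meas_minmax[OF T(1) False T(2)] by measurable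
    have "space M \<subseteq> ?W \<union> (?A1 \<union> ?A2)"
    proof
      fix \<omega> assume \<omega>: "\<omega> \<in> space M"
      show "\<omega> \<in> ?W \<union> (?A1 \<union> ?A2)"
      proof (rule ccontr)
        assume "\<omega> \<notin> ?W \<union> (?A1 \<union> ?A2)"
        then have no: "\<not> minmax Sw V (F \<omega>) < minmax T V (F \<omega>)" "\<omega> \<notin> ?A1" "\<omega> \<notin> ?A2"
          using \<omega> unfolding W_iff by auto
        \<comment> \<open>Outside \<open>?A1\<close> only the weak bound
          \<open>c1 + \<delta> / 3\<close> is available. The level \<open>c1 + \<delta> / 2\<close>
          gives the strict inequality for the minimax theorem and still lies below
          \<open>c2 - \<delta> / 3\<close>.\<close>
        have "\<exists>w\<in>Sw. F \<omega> w v < c1 + \<delta> / 2" if "v \<in> V" for v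
        proof -
          have "\<not> (\<forall>w\<in>Sw. - F \<omega> w v < - (c1 + \<delta> / 3))" using no(2) \<omega> that by blast
          then obtain w where "w \<in> Sw" "\<not> - F \<omega> w v < - (c1 + \<delta> / 3)" by blast
          moreover from this have "F \<omega> w v < c1 + \<delta> / 2" using delta by linarith
          ultimately show ?thesis by blast
        qed
        then have "\<exists>w\<in>Sw. \<forall>v\<in>V. F \<omega> w v < c1 + \<delta> / 2"
        proof (rule minimax[OF Sw(2,3) V(1), where mix = "\<lambda>t x y l i. t * x l i + (1 - t) * y l i", rotated -1])
          show "continuous_on V (F \<omega> w)" if "w \<in> Sw" for w
            by (rule continuous_on_section[OF contF[OF order_refl] that])
          show "(\<lambda>l i. t * x l i + (1 - t) * y l i) \<in> V" if "x \<in> V" "y \<in> V" "0 \<le> t" "t \<le> 1" for x y t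
            using that Sv unfolding V_def by (intro blockprod_mix) auto
          show "t * F \<omega> w x + (1 - t) * F \<omega> w y \<le> F \<omega> w (\<lambda>l i. t * x l i + (1 - t) * y l i)"
            if "w \<in> Sw" "x \<in> V" "y \<in> V" "0 \<le> t" "t \<le> 1" for w x y t
            using that psi_concave[of w] unfolding V_def F_def by (intro concave_objP) auto
          show "convex_on Sw (\<lambda>w. F \<omega> w v)" if "v \<in> V" for v
            using that psi_convex[of v] unfolding V_def F_def by (intro convex_on_objP) auto
        qed
        then have "minmax Sw V (F \<omega>) < c1 + \<delta> / 2"
          unfolding minmax_less_iff[OF Sw(1,3) V contF[OF order_refl]] .
        moreover have "\<not> minmax T V (F \<omega>) < c2 - \<delta> / 3"
          using no(3) \<omega> unfolding minmax_less_iff[OF T(1) False V contF[OF T(2)]] by blast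
        ultimately show False using no(1) c12 delta by linarith
      qed
    qed
    then have "1 \<le> prob (?W \<union> (?A1 \<union> ?A2))"
      using finite_measure_mono[of "space M" "?W \<union> (?A1 \<union> ?A2)"] W A1(1) A2(1) by (simp add: prob_space)
    also have "\<dots> \<le> prob ?W + (prob ?A1 + prob ?A2)"
      using measure_Un_le[OF W sets.Un[OF A1(1) A2(1)]] measure_Un_le[OF A1(1) A2(1)] by linarith
    also have "\<dots> \<le> prob ?W + 2 ^ (k + 1) * \<epsilon>" using A1(2) A2(2) by simp
    finally show ?thesis unfolding F_def V_def by simp
  qed
qed

end
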